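(* When $N_S\ge N_T$, $$I_s\;\ge\;\frac{N_S-\min\{K,\mathrm{rank}(\mathbf\Phi)\}}{N_S}\,I_{s,\max},$$ where $\mathbf\Phi=\mathbf F\mathbf F^{\mathrm H}$, $$I_s=\mathbb{E}_{\mathbf S}\log\left|\mathbf I+\sigma_s^{-2}\left(\mathbf R_R\otimes \mathbf R_T^{1/2}\mathbf F\mathbf S\mathbf S^{\mathrm H}\mathbf F^{\mathrm H}\mathbf R_T^{1/2}\right)\right|,\qquad I_{s,\max}=\log\left|\mathbf I+\sigma_s^{-2}\left(\mathbf R_R\otimes\mathbf R_T^{1/2}\mathbf\Phi\mathbf R_T^{1/2}\right)\right|.$$
   Context: $\mathbf F\in\mathbb C^{N_T\times N_T}$ is a deterministic precoding matrix, and $\mathbf S\in\mathbb C^{N_T\times N_S}$ is a random matrix with i.i.d. circularly symmetric complex Gaussian entries of mean zero and variance $1/N_S$ (so $\mathbb E(\mathbf S\mathbf S^{\mathrm H})=\mathbf I$). $\mathbf R_R\in\mathbb C^{N_R\times N_R}$ and $\mathbf R_T\in\mathbb C^{N_T\times N_T}$ are Hermitian positive semidefinite matrices with $\mathrm{rank}(\mathbf R_R)\le K$ and $\mathrm{rank}(\mathbf R_T)\le K$, where $K$ is a positive integer (the number of sensing targets), and $\sigma_s^2>0$ is the noise variance. $I_s$ is the sensing mutual information with random signals; $I_{s,\max}$ is its Jensen upper bound. $|\cdot|$ is the determinant, $\log$ the natural logarithm, $\otimes$ the Kronecker product, $(\cdot)^{1/2}$ the Hermitian positive semidefinite square root. 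*)

theory Defs
  imports
    "HOL-Probability.Probability"
    "Jordan_Normal_Form.Schur_Decomposition"
    "Jordan_Normal_Form.DL_Rank"
begin

definition kronecker_product :: "complex mat \<Rightarrow> complex mat \<Rightarrow> complex mat" where
  "kronecker_product A B =
     mat (dim_row A * dim_row B) (dim_col A * dim_col B)
       (\<lambda>(i, j). A $$ (i div dim_row B, j div dim_col B) * B $$ (i mod dim_row B, j mod dim_col B))"

text \<open>Equality with the adjoint forces the matrix to be square. The scalar product
  \<open>(A *\<^sub>v v) \<bullet>c v\<close> is \<open>v\<^sup>H A v\<close>, which is real for Hermitian \<open>A\<close>.\<close>

definition hermitian_psd :: "complex mat \<Rightarrow> bool" where
  "hermitian_psd A \<longleftrightarrow>
     mat_adjoint A = A \<and> (\<forall>v \<in> carrier_vec (dim_row A). 0 \<le> Re ((A *\<^sub>v v) \<bullet>c v))"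

definition psd_sqrt :: "complex mat \<Rightarrow> complex mat" where
  "psd_sqrt A = (THE B. hermitian_psd B \<and> B * B = A)"

definition mat_rank :: "complex mat \<Rightarrow> nat" where
  "mat_rank A = vec_space.rank (dim_row A) A"

text \<open>Only applied to Hermitian matrices, whose determinant is real.\<close>

definition log_det :: "complex mat \<Rightarrow> real" where
  "log_det A = ln (Re (det A))"

text \<open>Circularly symmetric complex Gaussian variable of mean zero and variance
  \<open>v = E(\<bar>X\<bar>\<^sup>2)\<close>: independent centred real and imaginary parts of variance \<open>v / 2\<close> each.
  The second argument of \<^const>\<open>normal_density\<close> is the standard deviation.\<close>

definition circular_complex_gaussian :: "'w measure \<Rightarrow> real \<Rightarrow> ('w \<Rightarrow> complex) \<Rightarrow> bool" where
  "circular_complex_gaussian M v X \<longleftrightarrow>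
     distributed M lborel (\<lambda>\<omega>. Re (X \<omega>)) (\<lambda>x. ennreal (normal_density 0 (sqrt (v / 2)) x)) \<and>
     distributed M lborel (\<lambda>\<omega>. Im (X \<omega>)) (\<lambda>x. ennreal (normal_density 0 (sqrt (v / 2)) x)) \<and>
     prob_space.indep_var M borel (\<lambda>\<omega>. Re (X \<omega>)) borel (\<lambda>\<omega>. Im (X \<omega>))"

definition iid_gaussian_mat ::
    "'w measure \<Rightarrow> nat \<Rightarrow> nat \<Rightarrow> real \<Rightarrow> ('w \<Rightarrow> complex mat) \<Rightarrow> bool" where
  "iid_gaussian_mat M m n v S \<longleftrightarrow>
     (\<forall>\<omega> \<in> space M. S \<omega> \<in> carrier_mat m n) \<and>
     (\<forall>i < m. \<forall>j < n. circular_complex_gaussian M v (\<lambda>\<omega>. S \<omega> $$ (i, j))) \<and>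
     prob_space.indep_vars M (\<lambda>_. borel) (\<lambda>(i, j) \<omega>. S \<omega> $$ (i, j)) ({..<m} \<times> {..<n})"

text \<open>Here \<open>s2\<close> is the noise variance, not the standard deviation.\<close>

definition mi_log_det :: "real \<Rightarrow> complex mat \<Rightarrow> complex mat \<Rightarrow> complex mat \<Rightarrow> real" where
  "mi_log_det s2 R\<^sub>R R\<^sub>T X =
     log_det (1\<^sub>m (dim_row R\<^sub>R * dim_row R\<^sub>T) +
       complex_of_real (inverse s2) \<cdot>\<^sub>m
         kronecker_product R\<^sub>R (psd_sqrt R\<^sub>T * X * psd_sqrt R\<^sub>T))"

definition sensing_mi ::
    "'w measure \<Rightarrow> real \<Rightarrow> complex mat \<Rightarrow> complex mat \<Rightarrow> complex mat \<Rightarrow> ('w \<Rightarrow> complex mat) \<Rightarrow> real" where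
  "sensing_mi M s2 R\<^sub>R R\<^sub>T F S =
     prob_space.expectation M
       (\<lambda>\<omega>. mi_log_det s2 R\<^sub>R R\<^sub>T (F * S \<omega> * mat_adjoint (S \<omega>) * mat_adjoint F))"

definition sensing_mi_max :: "real \<Rightarrow> complex mat \<Rightarrow> complex mat \<Rightarrow> complex mat \<Rightarrow> real" where
  "sensing_mi_max s2 R\<^sub>R R\<^sub>T F = mi_log_det s2 R\<^sub>R R\<^sub>T (F * mat_adjoint F)"

end

theory Submission
  imports Defs
begin

text \<open>
  Diagonalising \<open>R\<^sub>R\<close> splits both sides into sums of terms \<open>log |I + A S S\<^sup>H A\<^sup>H|\<close> and
  \<open>log |I + A A\<^sup>H|\<close>, and diagonalising \<open>A A\<^sup>H\<close> reduces each term to a matrix \<open>C\<close> with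
  \<open>C C\<^sup>H = D = diag d\<close> having at most \<open>r = min K (rank \<Phi>)\<close> nonzero entries. Put
  \<open>W = C S S\<^sup>H C\<^sup>H\<close>, \<open>Q = (I + W)\<^sup>-\<^sup>1\<close> and \<open>a = (N - r) / N\<close>. Gaussian integration by parts in
  every entry of \<open>S\<close> gives \<open>E tr(W Q) = E [tr(Q D) (1 - tr(W Q) / N)]\<close>, and \<open>tr(W Q) \<le> r\<close>, so
  \<open>E tr(W Q) \<ge> a E tr(Q D)\<close>. The tangent inequality of the concave function \<open>log det\<close> reads
  \<open>log |I + W| \<ge> log |I + a D| + tr(W Q) - a tr(D Q)\<close>; taking expectations leaves
  \<open>log |I + a D|\<close>, which is at least \<open>a log |I + D|\<close> because \<open>ln\<close> is concave.
  Integrating by parts instead of using \<open>E (S S\<^sup>H)\<^sup>-\<^sup>1\<close> avoids the inverse Wishart distribution,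
  and it needs no case distinction for \<open>N = r\<close>.
\<close>

section \<open>Gaussian integration by parts\<close>

text \<open>Jensen's inequality uses the tangent of \<open>log det\<close> at the mean. Here the
  tangent is taken at the random point \<open>I + W\<close> and evaluated at the deterministic point
  \<open>I + a D\<close>. This reverses the direction of the estimate, and its linear terms contain
  \<open>S\<close> only through \<open>Q\<close>, whose entries are bounded. The value of
  \<open>a\<close> is dictated by the Stein identity: it is the least value of
  \<open>1 - tr(W Q) / N\<close> allowed by \<open>tr(W Q) \<le> r\<close>, and
  \<open>N\<^sub>S \<ge> N\<^sub>T\<close> makes it nonnegative. The integration by parts needs no
  matrix calculus. Once one column of \<open>S\<close> is split off, a rank-one update makes
  everything a rational function of the single entry, with denominator one plus a nonnegative
  quadratic polynomial; a Stein identity for such functions is all the analysis required. The two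
  ranks in \<open>r\<close> have different sources: \<open>rank \<Phi>\<close> is visible in the
  product of \<Phi> with the square roots, whereas \<open>K\<close> enters because the square root
  of \<open>R\<^sub>T\<close> has \<open>R\<^sub>T\<close> as a factor.\<close>

lemma stein_normal_density:
  fixes g g' :: "real \<Rightarrow> real"
  assumes \<sigma>: "\<sigma> > 0"
    and der: "\<And>x. (g has_real_derivative g' x) (at x)"
    and cont: "\<And>x. isCont g' x"
    and bnd: "\<And>x. \<bar>g x\<bar> \<le> B" "\<And>x. \<bar>g' x\<bar> \<le> B'"
  shows "(\<integral>x. normal_density 0 \<sigma> x * (x * g x - \<sigma>\<^sup>2 * g' x) \<partial>lborel) = 0"
proof -
  let ?\<phi> = "normal_density 0 \<sigma>"
  have gcont: "isCont g x" for x using der DERIV_isCont by blast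
  have [measurable]: "g \<in> borel_measurable borel" "g' \<in> borel_measurable borel"
    using gcont cont
      by (auto intro!: borel_measurable_continuous_onI simp: continuous_on_eq_continuous_at)
  have i1: "integrable lborel (\<lambda>x. ?\<phi> x * (x * g x))"
  proof (rule Bochner_Integration.integrable_bound)
    show "integrable lborel (\<lambda>x. B * (?\<phi> x * \<bar>x\<bar>))"
      using integrable_normal_moment_abs[OF \<sigma>, of 0 1] by simp
    show "AE x in lborel. norm (?\<phi> x * (x * g x)) \<le> norm (B * (?\<phi> x * \<bar>x\<bar>))"
    proof (intro AE_I2)
      fix x
      have "\<bar>?\<phi> x * (x * g x)\<bar> = (?\<phi> x * \<bar>x\<bar>) * \<bar>g x\<bar>"
        by (simp add: abs_mult)
      also have "\<dots> \<le> (?\<phi> x * \<bar>x\<bar>) * B" by (intro mult_left_mono bnd) auto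
      finally show "norm (?\<phi> x * (x * g x)) \<le> norm (B * (?\<phi> x * \<bar>x\<bar>))"
        by (simp add: mult.commute abs_le_iff)
    qed
  qed simp
  have i2: "integrable lborel (\<lambda>x. ?\<phi> x * g' x)"
  proof (rule Bochner_Integration.integrable_bound)
    show "integrable lborel (\<lambda>x. B' * ?\<phi> x)" using \<sigma> by simp
    show "AE x in lborel. norm (?\<phi> x * g' x) \<le> norm (B' * ?\<phi> x)"
    proof (intro AE_I2)
      fix x
      have "\<bar>?\<phi> x * g' x\<bar> = ?\<phi> x * \<bar>g' x\<bar>" by (simp add: abs_mult)
      also have "\<dots> \<le> ?\<phi> x * B'" by (intro mult_left_mono bnd) auto
      finally show "norm (?\<phi> x * g' x) \<le> norm (B' * ?\<phi> x)"
        by (simp add: mult.commute abs_le_iff)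
    qed
  qed simp
  have eq: "?\<phi> x * (x * g x - \<sigma>\<^sup>2 * g' x) = ?\<phi> x * (x * g x) - \<sigma>\<^sup>2 * (?\<phi> x * g' x)" for x
    by (simp add: algebra_simps)
  have int: "integrable lborel (\<lambda>x. ?\<phi> x * (x * g x - \<sigma>\<^sup>2 * g' x))"
    unfolding eq using i1 i2 by simp
  \<comment> \<open>Since the density satisfies \<open>\<phi>' = - (x / \<sigma>^2) \<phi>\<close>,
    the integrand is the exact derivative of \<open>f\<close>, and \<open>f\<close> vanishes at both
    infinities because \<open>g\<close> is bounded.\<close>
  define f where "f x = - \<sigma>\<^sup>2 * (?\<phi> x * g x)" for x
  have phi: "(?\<phi> has_real_derivative (- x / \<sigma>\<^sup>2) * ?\<phi> x) (at x)" for x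
    unfolding normal_density_def using \<sigma>
    by (auto intro!: derivative_eq_intros simp: power2_eq_square field_simps)
  have fd: "(f has_real_derivative ?\<phi> x * (x * g x - \<sigma>\<^sup>2 * g' x)) (at x)" for x
    unfolding f_def
      using \<sigma> by (auto intro!: derivative_eq_intros phi der simp: field_simps power2_eq_square)
  have \<phi>0: "(?\<phi> \<longlongrightarrow> 0) at_top" "(?\<phi> \<longlongrightarrow> 0) at_bot"
    unfolding normal_density_def using \<sigma> by real_asymp+
  have fl: "(f \<longlongrightarrow> 0) F" if "(?\<phi> \<longlongrightarrow> 0) F" for F
  proof -
    have "((\<lambda>x. \<sigma>\<^sup>2 * B * ?\<phi> x) \<longlongrightarrow> 0) F"
      using tendsto_mult_right_zero[OF that] by simp
    moreover have "norm (f x) \<le> \<sigma>\<^sup>2 * B * ?\<phi> x" for x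
    proof -
      have "norm (f x) = (\<sigma>\<^sup>2 * ?\<phi> x) * \<bar>g x\<bar>" by (simp add: f_def abs_mult)
      also have "\<dots> \<le> (\<sigma>\<^sup>2 * ?\<phi> x) * B" by (intro mult_left_mono bnd) auto
      finally show ?thesis by (simp add: ac_simps)
    qed
    ultimately show ?thesis
      by (intro Lim_null_comparison[where f=f and g="\<lambda>x. \<sigma>\<^sup>2 * B * ?\<phi> x"] always_eventually allI)
  qed
  have "(LBINT x=-\<infinity>..\<infinity>. ?\<phi> x * (x * g x - \<sigma>\<^sup>2 * g' x)) = 0 - 0"
  proof (rule interval_integral_FTC_integrable)
    show "(f has_vector_derivative ?\<phi> x * (x * g x - \<sigma>\<^sup>2 * g' x)) (at x)" for x
      using fd by (simp add: has_real_derivative_iff_has_vector_derivative)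
    show "isCont (\<lambda>x. ?\<phi> x * (x * g x - \<sigma>\<^sup>2 * g' x)) x" for x
      using DERIV_isCont[OF phi] gcont cont by (intro continuous_intros) auto
    show "set_integrable lborel (einterval (- \<infinity>) \<infinity>) (\<lambda>x. ?\<phi> x * (x * g x - \<sigma>\<^sup>2 * g' x))"
      using int by (simp add: set_integrable_def einterval_def)
    show "((f \<circ> real_of_ereal) \<longlongrightarrow> 0) (at_right (- \<infinity>))"
      using fl[OF \<phi>0(2)] by (simp add: ereal_tendsto_simps)
    show "((f \<circ> real_of_ereal) \<longlongrightarrow> 0) (at_left \<infinity>)"
      using fl[OF \<phi>0(1)] by (simp add: ereal_tendsto_simps)
  qed simp
  then show "(\<integral>x. ?\<phi> x * (x * g x - \<sigma>\<^sup>2 * g' x) \<partial>lborel) = 0"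
    by (simp add: interval_integral_to_infinity_eq interval_lebesgue_integral_def einterval_def set_lebesgue_integral_def)
qed

text \<open>With \<open>p = a + 2 b x + c x^2\<close> and half-derivative \<open>b + c x\<close> one
  has \<open>c p - (b + c x)^2 = a c - b^2\<close>, so this is the sign of the leading coefficient
  and of the discriminant of a polynomial without negative values.\<close>

lemma quadratic_nonneg_deriv_square_le:
  fixes a b c x :: real
  assumes nn: "\<And>x. 0 \<le> a + 2 * b * x + c * x\<^sup>2"
  shows "0 \<le> c" "(b + c * x)\<^sup>2 \<le> c * (a + 2 * b * x + c * x\<^sup>2)"
proof -
  show c: "0 \<le> c"
  proof (rule ccontr)
    assume "\<not> 0 \<le> c"
    then have c: "c < 0" by simp
    have "filterlim (\<lambda>x. a + 2 * b * x + c * x\<^sup>2) at_bot at_top" using c by real_asymp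
    then have "eventually (\<lambda>x. a + 2 * b * x + c * x\<^sup>2 < 0) at_top"
      by (simp add: filterlim_at_bot_dense)
    then obtain x where "a + 2 * b * x + c * x\<^sup>2 < 0"
      by (meson eventually_happens trivial_limit_at_top_linorder)
    with nn[of x] show False by simp
  qed
  have disc: "b\<^sup>2 \<le> a * c"
  proof (cases "c = 0")
    case True
    have "b = 0"
    proof (rule ccontr)
      assume "b \<noteq> 0"
      \<comment> \<open>This argument gives the affine polynomial the value -1.\<close>
      then have "a + 2 * b * (- (a + 1) / (2 * b)) + c * (- (a + 1) / (2 * b))\<^sup>2 = - 1"
        using True by simp
      with nn[of "- (a + 1) / (2 * b)"] show False by simp
    qed
    then show ?thesis using True by simp
  next
    case False
    with c have c: "c > 0" by simp
    have "0 \<le> c * (a + 2 * b * (- b / c) + c * (- b / c)\<^sup>2)"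
      using c by (intro mult_nonneg_nonneg nn) simp
    also have "\<dots> = a * c - b\<^sup>2" using c by (simp add: field_simps power2_eq_square)
    finally show ?thesis by simp
  qed
  then show "(b + c * x)\<^sup>2 \<le> c * (a + 2 * b * x + c * x\<^sup>2)"
    by (simp add: power2_eq_square algebra_simps)
qed

text \<open>Adding 1 keeps the denominator away from 0, and the discriminant estimate bounds the
  squared half-derivative by \<open>c p\<close>. The bounds involve \<open>c\<close> alone, so they
  survive when \<open>a\<close> absorbs terms in a frozen second variable.\<close>

lemma quadratic_ratio_bounds:
  fixes a b c x :: real
  assumes nn: "\<And>x. 0 \<le> a + 2 * b * x + c * x\<^sup>2"
  defines "p \<equiv> 1 + (a + 2 * b * x + c * x\<^sup>2)"
  shows "\<bar>(b + c * x) / p\<bar> \<le> 1 + c" "\<bar>c / p - 2 * (b + c * x)\<^sup>2 / p\<^sup>2\<bar> \<le> 3 * c"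
proof -
  have p1: "p \<ge> 1" using nn[of x] by (simp add: p_def)
  have p0: "p > 0" using p1 by linarith
  note q = quadratic_nonneg_deriv_square_le[OF nn]
  have sq: "(b + c * x)\<^sup>2 \<le> c * p"
    using q(2)[of x] q(1) unfolding p_def by (simp add: algebra_simps)
  have "(b + c * x)\<^sup>2 / p\<^sup>2 \<le> (c * p) / p\<^sup>2"
    using p0 by (intro divide_right_mono sq) auto
  also have "\<dots> = c / p" using p0 by (simp add: power2_eq_square)
  finally have 1: "(b + c * x)\<^sup>2 / p\<^sup>2 \<le> c / p" .
  have 2: "0 \<le> c / p" "c / p \<le> c" using p1 p0 q(1) divide_left_mono[of 1 p c] by simp_all
  have "((b + c * x) / p)\<^sup>2 \<le> c" using 1 2 by (simp add: power_divide)
  \<comment> \<open>The weaker constant \<open>1 + c\<close> stands in for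
    \<open>sqrt c\<close>.\<close>
  also have "\<dots> \<le> (1 + c)\<^sup>2" using q(1) by (simp add: power2_eq_square algebra_simps)
  finally show "\<bar>(b + c * x) / p\<bar> \<le> 1 + c"
    using q(1) by (simp add: abs_le_square_iff[symmetric])
  have 3: "0 \<le> (b + c * x)\<^sup>2 / p\<^sup>2" by simp
  have "c / p - 2 * (b + c * x)\<^sup>2 / p\<^sup>2 = c / p - 2 * ((b + c * x)\<^sup>2 / p\<^sup>2)"
    by simp
  then show "\<bar>c / p - 2 * (b + c * x)\<^sup>2 / p\<^sup>2\<bar> \<le> 3 * c" using 1 2 3 by linarith
qed

lemma stein_quadratic:
  fixes a b c :: real
  assumes "prob_space M" and \<sigma>: "\<sigma> > 0"
    and X: "distributed M lborel X (\<lambda>x. ennreal (normal_density 0 \<sigma> x))"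
    and nn: "\<And>x. 0 \<le> a + 2 * b * x + c * x\<^sup>2"
  defines "p \<equiv> \<lambda>x. 1 + (a + 2 * b * x + c * x\<^sup>2)"
  shows "prob_space.expectation M (\<lambda>\<omega>. X \<omega> * ((b + c * X \<omega>) / p (X \<omega>))
      - \<sigma>\<^sup>2 * (c / p (X \<omega>) - 2 * (b + c * X \<omega>)\<^sup>2 / (p (X \<omega>))\<^sup>2)) = 0"
proof -
  interpret prob_space M by fact
  define g where "g x = (b + c * x) / p x" for x
  define g' where "g' x = c / p x - 2 * (b + c * x)\<^sup>2 / (p x)\<^sup>2" for x
  have pne: "p x \<noteq> 0" for x using nn[of x] by (simp add: p_def)
  have pd: "(p has_real_derivative 2 * (b + c * x)) (at x)" for x
    unfolding p_def by (auto intro!: derivative_eq_intros)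
  have der: "(g has_real_derivative g' x) (at x)" for x
    unfolding g_def g'_def using pne[of x]
    by (auto intro!: derivative_eq_intros pd simp: field_simps power2_eq_square)
  have cont: "isCont g' x" for x
    unfolding g'_def using pne DERIV_isCont[OF pd] by (intro continuous_intros) auto
  have gb: "\<bar>g x\<bar> \<le> 1 + c" "\<bar>g' x\<bar> \<le> 3 * c" for x
    using quadratic_ratio_bounds[OF nn, of x] by (simp_all add: g_def g'_def p_def)
  have [measurable]: "p \<in> borel_measurable borel" unfolding p_def by measurable
  have "(\<integral>x. normal_density 0 \<sigma> x * (x * g x - \<sigma>\<^sup>2 * g' x) \<partial>lborel) = 0"
    by (rule stein_normal_density[OF \<sigma> der cont gb])
  also have "(\<integral>x. normal_density 0 \<sigma> x * (x * g x - \<sigma>\<^sup>2 * g' x) \<partial>lborel)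
      = expectation (\<lambda>\<omega>. X \<omega> * g (X \<omega>) - \<sigma>\<^sup>2 * g' (X \<omega>))"
    by (rule distributed_integral[OF X]) (auto simp: g_def g'_def)
  finally show ?thesis by (simp add: g_def g'_def)
qed

text \<open>Independence makes the joint law a product, so Fubini allows integrating over
  \<open>X\<close> first; each inner integral is the expectation with \<open>Y\<close> frozen, which
  vanishes.\<close>

lemma (in prob_space) expectation_indep_eq_0:
  fixes h :: "_ \<Rightarrow> real"
  assumes ind: "indep_var S X T Y"
    and h [measurable]: "h \<in> borel_measurable (S \<Otimes>\<^sub>M T)"
    and int: "integrable M (\<lambda>\<omega>. h (X \<omega>, Y \<omega>))"
    and z: "\<And>y. y \<in> space T \<Longrightarrow> expectation (\<lambda>\<omega>. h (X \<omega>, y)) = 0"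
  shows "expectation (\<lambda>\<omega>. h (X \<omega>, Y \<omega>)) = 0"
proof -
  have [measurable]: "X \<in> M \<rightarrow>\<^sub>M S" "Y \<in> M \<rightarrow>\<^sub>M T"
    using ind indep_var_rv1 indep_var_rv2 by blast+
  interpret X: prob_space "distr M S X" by (rule prob_space_distr) simp
  interpret Y: prob_space "distr M T Y" by (rule prob_space_distr) simp
  interpret XY: pair_sigma_finite "distr M S X" "distr M T Y" ..
  have eq: "distr M S X \<Otimes>\<^sub>M distr M T Y = distr M (S \<Otimes>\<^sub>M T) (\<lambda>x. (X x, Y x))"
    using ind indep_var_distribution_eq by blast
  have i: "integrable (distr M S X \<Otimes>\<^sub>M distr M T Y) (\<lambda>(x, y). h (x, y))"
    unfolding eq by (subst integrable_distr_eq) (use int in auto)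
  have "expectation (\<lambda>\<omega>. h (X \<omega>, Y \<omega>)) = (\<integral>(x, y). h (x, y) \<partial>(distr M S X \<Otimes>\<^sub>M distr M T Y))"
    unfolding eq by (subst integral_distr) auto
  also have "\<dots> = (\<integral>y. (\<integral>x. h (x, y) \<partial>distr M S X) \<partial>distr M T Y)"
    by (rule XY.integral_snd[symmetric, OF i])
  also have "\<dots> = (\<integral>y. 0 \<partial>distr M T Y)"
  proof (rule Bochner_Integration.integral_cong[OF refl])
    fix y assume "y \<in> space (distr M T Y)"
    then have y[measurable]: "y \<in> space T" by simp
    have "(\<integral>x. h (x, y) \<partial>distr M S X) = expectation (\<lambda>\<omega>. h (X \<omega>, y))"
      by (subst integral_distr) auto
    then show "(\<integral>x. h (x, y) \<partial>distr M S X) = 0" using z[OF y] by simp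
  qed
  finally show ?thesis by simp
qed


lemma (in prob_space) indep_var_swap:
  assumes "indep_var S X T Y"
  shows "indep_var T Y S X"
proof -
  have "indep_set B A" if AB: "indep_set A B" for A B
    unfolding indep_sets2_eq
  proof (intro conjI ballI)
    show "A \<subseteq> events" "B \<subseteq> events" using AB by (simp_all add: indep_sets2_eq)
    fix b a assume "b \<in> B" "a \<in> A"
    then have "prob (a \<inter> b) = prob a * prob b" using AB by (simp add: indep_sets2_eq)
    then show "prob (b \<inter> a) = prob b * prob a" by (simp add: Int_commute mult.commute)
  qed
  then show ?thesis using assms unfolding indep_var_eq by blast
qed

text \<open>Freezing \<open>y\<close> leaves a polynomial in \<open>x\<close> with the same
  \<open>b\<close> and \<open>c\<close>; only its constant term \<open>a + 2 b' y + c y^2\<close>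
  changes. The majorant used for integrability therefore does not depend on
  \<open>Y\<close>.\<close>

lemma (in prob_space) stein_quadratic_indep:
  fixes X Y :: "_ \<Rightarrow> real" and a b c b' :: real
  assumes \<sigma>: "\<sigma> > 0"
    and X: "distributed M lborel X (\<lambda>x. ennreal (normal_density 0 \<sigma> x))"
    and ind: "indep_var borel X borel Y"
    and nn: "\<And>x y. 0 \<le> a + 2 * (b * x + b' * y) + c * (x\<^sup>2 + y\<^sup>2)"
  defines "p \<equiv> \<lambda>x y. 1 + (a + 2 * (b * x + b' * y) + c * (x\<^sup>2 + y\<^sup>2))"
  defines "h \<equiv> \<lambda>(x, y). x * ((b + c * x) / p x y) - \<sigma>\<^sup>2 * (c / p x y - 2 * (b + c * x)\<^sup>2 / (p x y)\<^sup>2)"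
  shows "integrable M (\<lambda>\<omega>. h (X \<omega>, Y \<omega>))" "expectation (\<lambda>\<omega>. h (X \<omega>, Y \<omega>)) = 0"
proof -
  have [measurable]: "X \<in> borel_measurable M" "Y \<in> borel_measurable M"
    using ind indep_var_rv1 indep_var_rv2 by blast+
  have nn': "0 \<le> (a + 2 * b' * y + c * y\<^sup>2) + 2 * b * x + c * x\<^sup>2" for x y
    using nn[of x y] by (simp add: algebra_simps)
  have peq: "p x y = 1 + ((a + 2 * b' * y + c * y\<^sup>2) + 2 * b * x + c * x\<^sup>2)" for x y
    by (simp add: p_def algebra_simps)
  have hm [measurable]: "h \<in> borel_measurable (borel \<Otimes>\<^sub>M borel)"
    unfolding h_def p_def by measurable
  have iX: "integrable M X"
    using integrable_normal_moment_nz_1[OF \<sigma>, of 0]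
      by (intro distributed_integrable_var[OF X]) auto
  show int: "integrable M (\<lambda>\<omega>. h (X \<omega>, Y \<omega>))"
  proof (rule Bochner_Integration.integrable_bound)
    show "integrable M (\<lambda>\<omega>. (1 + c) * \<bar>X \<omega>\<bar> + \<sigma>\<^sup>2 * (3 * c))"
      using iX by auto
    show "AE \<omega> in M. norm (h (X \<omega>, Y \<omega>)) \<le> norm ((1 + c) * \<bar>X \<omega>\<bar> + \<sigma>\<^sup>2 * (3 * c))"
    proof (intro AE_I2)
      fix \<omega>
      let ?x = "X \<omega>" and ?y = "Y \<omega>"
      note b = quadratic_ratio_bounds[OF nn'[of ?y], where x = ?x, folded peq]
      have "\<bar>h (?x, ?y)\<bar> \<le> \<bar>?x\<bar> * \<bar>(b + c * ?x) / p ?x ?y\<bar> + \<sigma>\<^sup>2 * \<bar>c / p ?x ?y - 2 * (b + c * ?x)\<^sup>2 / (p ?x ?y)\<^sup>2\<bar>"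
        unfolding h_def prod.case by (rule order_trans[OF abs_triangle_ineq4]) (simp add: abs_mult)
      also have "\<dots> \<le> \<bar>?x\<bar> * (1 + c) + \<sigma>\<^sup>2 * (3 * c)"
        by (intro add_mono mult_left_mono b) auto
      finally show "norm (h (?x, ?y)) \<le> norm ((1 + c) * \<bar>?x\<bar> + \<sigma>\<^sup>2 * (3 * c))"
        by (simp add: mult.commute)
    qed
  qed simp
  show "expectation (\<lambda>\<omega>. h (X \<omega>, Y \<omega>)) = 0"
  proof (rule expectation_indep_eq_0[OF ind hm int])
    fix y
    show "expectation (\<lambda>\<omega>. h (X \<omega>, y)) = 0"
      unfolding h_def prod.case peq by (rule stein_quadratic[OF prob_space_axioms \<sigma> X nn'])
  qed
qed

text \<open>For \<open>g z = (b + c z) / p z\<close> the Wirtinger derivative in \<open>z\<close> is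
  \<open>c / p z - |b + c z|^2 / (p z)^2\<close>, so this is the real part of the complex Stein
  identity \<open>E (cnj Z g(Z)) = v E (dg/dz)\<close>. It is the sum of the real identities for the
  real and the imaginary part, each of variance \<open>v / 2\<close>.\<close>

lemma (in prob_space) stein_circular_gaussian:
  fixes Z :: "_ \<Rightarrow> complex" and a c v :: real and b :: complex
  assumes v: "v > 0" and Z: "circular_complex_gaussian M v Z"
    and nn: "\<And>z. 0 \<le> a + 2 * Re (cnj z * b) + c * (cmod z)\<^sup>2"
  defines "p \<equiv> \<lambda>z. 1 + (a + 2 * Re (cnj z * b) + c * (cmod z)\<^sup>2)"
  shows "expectation (\<lambda>\<omega>. Re (cnj (Z \<omega>) * (b + c * Z \<omega>)) / p (Z \<omega>)
    - v * (c / p (Z \<omega>) - (cmod (b + c * Z \<omega>))\<^sup>2 / (p (Z \<omega>))\<^sup>2)) = 0"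
proof -
  let ?\<sigma> = "sqrt (v / 2)"
  have \<sigma>: "?\<sigma> > 0" using v by simp
  have \<sigma>2: "?\<sigma>\<^sup>2 = v / 2" using v by simp
  have X: "distributed M lborel (\<lambda>\<omega>. Re (Z \<omega>)) (\<lambda>x. ennreal (normal_density 0 ?\<sigma> x))"
    and Y: "distributed M lborel (\<lambda>\<omega>. Im (Z \<omega>)) (\<lambda>x. ennreal (normal_density 0 ?\<sigma> x))"
    and ind: "indep_var borel (\<lambda>\<omega>. Re (Z \<omega>)) borel (\<lambda>\<omega>. Im (Z \<omega>))"
    using Z by (auto simp: circular_complex_gaussian_def)
  have nnR: "0 \<le> a + 2 * (Re b * x + Im b * y) + c * (x\<^sup>2 + y\<^sup>2)" for x y
    using nn[of "Complex x y"] by (simp add: cmod_power2 algebra_simps)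
  have nnI: "0 \<le> a + 2 * (Im b * x + Re b * y) + c * (x\<^sup>2 + y\<^sup>2)" for x y
    using nnR[of y x] by (simp add: algebra_simps)
  note R = stein_quadratic_indep[OF \<sigma> X ind nnR, unfolded prod.case \<sigma>2]
  note I = stein_quadratic_indep[OF \<sigma> Y indep_var_swap[OF ind] nnI, unfolded prod.case \<sigma>2]
  have pR: "p z = 1 + (a + 2 * (Re b * Re z + Im b * Im z) + c * ((Re z)\<^sup>2 + (Im z)\<^sup>2))"
    and pI: "p z = 1 + (a + 2 * (Im b * Im z + Re b * Re z) + c * ((Im z)\<^sup>2 + (Re z)\<^sup>2))" for z
    by (simp_all add: p_def cmod_power2 algebra_simps)
  have eq: "Re (cnj z * (b + c * z)) / p z - v * (c / p z - (cmod (b + c * z))\<^sup>2 / (p z)\<^sup>2)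
    = (Re z * ((Re b + c * Re z) / p z) - v / 2 * (c / p z - 2 * (Re b + c * Re z)\<^sup>2 / (p z)\<^sup>2))
    + (Im z * ((Im b + c * Im z) / p z) - v / 2 * (c / p z - 2 * (Im b + c * Im z)\<^sup>2 / (p z)\<^sup>2))" for z :: complex
    by (simp add: cmod_power2 add_divide_distrib algebra_simps)
  show ?thesis unfolding eq
    using Bochner_Integration.integral_add[OF R(1) I(1)] R(2) I(2)
      unfolding pR[symmetric] pI[symmetric] by simp
qed

section \<open>The spectral theorem and positive semidefinite matrices\<close>

lemma mat_adjoint_index [simp]:
  "i < dim_col A \<Longrightarrow> j < dim_row A \<Longrightarrow> mat_adjoint A $$ (i, j) = cnj (A $$ (j, i))"
  for A :: "complex mat"
  by (simp add: mat_adjoint_def mat_of_rows_def)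

lemma mat_adjoint_dim [simp]:
  "dim_row (mat_adjoint A) = dim_col A" "dim_col (mat_adjoint A) = dim_row A"
  by (simp_all add: mat_adjoint_def)

lemma mat_adjoint_carrier [simp, intro]:
  "A \<in> carrier_mat n m \<Longrightarrow> mat_adjoint A \<in> carrier_mat m n"
  unfolding carrier_mat_def by simp

lemma mat_adjoint_adjoint [simp]: "mat_adjoint (mat_adjoint A) = A" for A :: "complex mat"
  by (rule eq_matI) auto

text \<open>The side conditions are equations between dimensions instead of carrier memberships, so
  as a rewrite rule it needs no instantiation and brings products into right-nested form.\<close>

lemma mat_assoc:
  fixes A B C :: "complex mat"
  assumes "dim_col A = dim_row B" "dim_col B = dim_row C"
  shows "A * B * C = A * (B * C)"
  using assms by (intro assoc_mult_mat[of _ "dim_row A" "dim_col A" _ "dim_col B" _ "dim_col C"]) auto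

lemma mat_distrib:
  fixes A B C :: "complex mat"
  assumes A: "dim_row A = dim_row B" "dim_col A = dim_col B"
  shows "dim_col C = dim_row B \<Longrightarrow> C * (A + B) = C * A + C * B"
    and "dim_col B = dim_row C \<Longrightarrow> (A + B) * C = A * C + B * C"
proof -
  have AB: "A \<in> carrier_mat (dim_row B) (dim_col B)" "B \<in> carrier_mat (dim_row B) (dim_col B)"
    using A by (simp_all only: carrier_matI)
  show "C * (A + B) = C * A + C * B" if "dim_col C = dim_row B"
    by (rule mult_add_distrib_mat[OF _ AB]) (rule carrier_matI[OF refl that])
  show "(A + B) * C = A * C + B * C" if "dim_col B = dim_row C"
    by (rule add_mult_distrib_mat[OF AB]) (rule carrier_matI[OF that[symmetric] refl])
qed

lemma mat_adjoint_mult: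
  fixes A B :: "complex mat"
  assumes "dim_col A = dim_row B"
  shows "mat_adjoint (A * B) = mat_adjoint B * mat_adjoint A"
  using assms by (intro eq_matI) (auto simp: scalar_prod_def intro!: sum.cong)

lemma mat_adjoint_add:
  fixes A B :: "complex mat"
  assumes "A \<in> carrier_mat n m" "B \<in> carrier_mat n m"
  shows "mat_adjoint (A + B) = mat_adjoint A + mat_adjoint B"
  using assms by (intro eq_matI) auto

lemma mat_adjoint_smult: "mat_adjoint (c \<cdot>\<^sub>m A) = cnj c \<cdot>\<^sub>m mat_adjoint A" for A :: "complex mat"
  by (intro eq_matI) auto

text \<open>Real-valued \<open>d\<close> builds the reality of the eigenvalues of a Hermitian matrix
  into the type.\<close>

definition diag_of :: "nat \<Rightarrow> (nat \<Rightarrow> real) \<Rightarrow> complex mat" where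
  "diag_of n d = mat n n (\<lambda>(i, j). if i = j then complex_of_real (d i) else 0)"

lemma diag_of_carrier [simp, intro]: "diag_of n d \<in> carrier_mat n n"
  by (simp add: diag_of_def)

lemma diag_of_dim [simp]: "dim_row (diag_of n d) = n" "dim_col (diag_of n d) = n"
  by (simp_all add: diag_of_def)

lemma diag_of_index [simp]:
  "i < n \<Longrightarrow> j < n \<Longrightarrow> diag_of n d $$ (i, j) = (if i = j then complex_of_real (d i) else 0)"
  by (simp add: diag_of_def)

lemma diag_of_cong: "(\<And>i. i < n \<Longrightarrow> d i = e i) \<Longrightarrow> diag_of n d = diag_of n e"
  by (intro eq_matI) auto

lemma diag_of_mult_left:
  "A \<in> carrier_mat n m \<Longrightarrow> diag_of n d * A = mat n m (\<lambda>(i, j). complex_of_real (d i) * A $$ (i, j))"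
  by (intro eq_matI) (auto simp: scalar_prod_def if_distrib[of "\<lambda>x. x * _"] cong: if_cong)

lemma diag_of_mult_right:
  "A \<in> carrier_mat n m \<Longrightarrow> A * diag_of m d = mat n m (\<lambda>(i, j). A $$ (i, j) * complex_of_real (d j))"
  by (intro eq_matI) (auto simp: scalar_prod_def if_distrib[of "\<lambda>x. _ * x"] cong: if_cong)

lemma diag_of_mult: "diag_of n d * diag_of n e = diag_of n (\<lambda>i. d i * e i)"
  by (subst diag_of_mult_left[of _ n n]) (auto intro!: eq_matI)

lemma diag_of_adjoint [simp]: "mat_adjoint (diag_of n d) = diag_of n d"
  by (intro eq_matI) auto

lemma diag_of_one: "diag_of n (\<lambda>_. 1) = 1\<^sub>m n"
  by (intro eq_matI) auto

lemma one_plus_smult_diag_of: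
  "1\<^sub>m n + complex_of_real t \<cdot>\<^sub>m diag_of n d = diag_of n (\<lambda>i. 1 + t * d i)"
  by (intro eq_matI) auto

lemma det_diag_of: "det (diag_of n d) = complex_of_real (\<Prod>i<n. d i)"
proof -
  have "det (diag_of n d) = prod_list (diag_mat (diag_of n d))"
    by (rule det_upper_triangular) (auto simp: upper_triangular_def)
  also have "\<dots> = (\<Prod>i<n. complex_of_real (d i))"
    by (auto simp: diag_mat_def prod.distinct_set_conv_list[symmetric] lessThan_atLeast0 intro!: prod.cong)
  finally show ?thesis by simp
qed

definition unitary_mat :: "nat \<Rightarrow> complex mat \<Rightarrow> bool" where
  "unitary_mat n V \<longleftrightarrow> V \<in> carrier_mat n n \<and> mat_adjoint V * V = 1\<^sub>m n \<and> V * mat_adjoint V = 1\<^sub>m n"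

lemma unitary_matI:
  assumes "V \<in> carrier_mat n n" "mat_adjoint V * V = 1\<^sub>m n"
  shows "unitary_mat n V"
  using assms mat_mult_left_right_inverse[of "mat_adjoint V" n V] by (auto simp: unitary_mat_def)

lemma unitary_mat_carrier: "unitary_mat n V \<Longrightarrow> V \<in> carrier_mat n n"
  by (simp add: unitary_mat_def)

text \<open>Orthogonality of the columns makes \<open>W^H W\<close> diagonal with the squared column
  norms as entries; dividing each column by its norm turns this into the identity.\<close>

lemma corthogonal_imp_unitary_scaled:
  assumes W: "W \<in> carrier_mat n n" and o: "corthogonal_mat (W :: complex mat)"
  shows "\<exists>d. (\<forall>i<n. 0 < d i) \<and> unitary_mat n (W * diag_of n d)"
proof -
  define B where "B = mat_adjoint W * W"
  have B: "B \<in> carrier_mat n n" using W unfolding B_def by auto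
  have dB: "i < n \<Longrightarrow> j < n \<Longrightarrow> i \<noteq> j \<Longrightarrow> B $$ (i, j) = 0" 
    and nzB: "i < n \<Longrightarrow> B $$ (i, i) \<noteq> 0" for i j
    using o W B unfolding corthogonal_mat_def Let_def B_def[symmetric] diagonal_mat_def by auto
  define s where "s i = (\<Sum>k<n. (cmod (W $$ (k, i)))\<^sup>2)" for i
  have Bii: "B $$ (i, i) = complex_of_real (s i)" if "i < n" for i
    using that W unfolding B_def s_def
    by (auto simp: scalar_prod_def lessThan_atLeast0 complex_norm_square mult.commute
        simp del: of_real_power intro!: sum.cong)
  have s: "0 < s i" if "i < n" for i
  proof -
    have "s i \<noteq> 0" using nzB[OF that] Bii[OF that] by auto
    moreover have "0 \<le> s i" unfolding s_def by (intro sum_nonneg) auto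
    ultimately show ?thesis by simp
  qed
  define d where "d i = 1 / sqrt (s i)" for i
  let ?D = "diag_of n d"
  have "mat_adjoint (W * ?D) * (W * ?D) = (?D * mat_adjoint W) * (W * ?D)"
    using W by (simp add: mat_adjoint_mult)
  also have "\<dots> = ?D * (B * ?D)"
    unfolding B_def using W by (simp add: mat_assoc)
  also have "\<dots> = 1\<^sub>m n"
    unfolding diag_of_mult_right[OF B] 
    by (subst diag_of_mult_left[of _ n n], simp, intro eq_matI)
       (auto simp: dB Bii d_def simp del: of_real_divide simp flip: of_real_mult dest!: s)
  finally have "unitary_mat n (W * ?D)" using W by (intro unitary_matI) auto
  then show ?thesis using s by (intro exI[of _ d]) (auto simp: d_def)
qed

lemma four_block_1_adjoint:
  fixes a :: complex
  assumes "A \<in> carrier_mat n n"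
  shows "mat_adjoint (four_block_mat (mat 1 1 (\<lambda>_. a)) (0\<^sub>m 1 n) (0\<^sub>m n 1) A)
    = four_block_mat (mat 1 1 (\<lambda>_. cnj a)) (0\<^sub>m 1 n) (0\<^sub>m n 1) (mat_adjoint A)"
  using assms by (intro eq_matI) auto

lemma four_block_1_mult:
  fixes a b :: complex
  assumes "A \<in> carrier_mat n n" "B \<in> carrier_mat n n"
  shows "four_block_mat (mat 1 1 (\<lambda>_. a)) (0\<^sub>m 1 n) (0\<^sub>m n 1) A * four_block_mat (mat 1 1 (\<lambda>_. b)) (0\<^sub>m 1 n) (0\<^sub>m n 1) B
    = four_block_mat (mat 1 1 (\<lambda>_. a * b)) (0\<^sub>m 1 n) (0\<^sub>m n 1) (A * B)"
proof -
  have 1: "mat 1 1 (\<lambda>_. a) * mat 1 1 (\<lambda>_. b) + 0\<^sub>m 1 1 = mat 1 1 (\<lambda>_. a * b)"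
    by (intro eq_matI) (auto simp: scalar_prod_def)
  show ?thesis
    by (subst mult_four_block_mat[of _ 1 1 _ n _ n _ _ 1 _ n]) (use assms 1 in auto)
qed

text \<open>Deflation: in an orthonormal basis starting with an eigenvector the first column of the
  matrix is a multiple of the first unit vector, Hermitian symmetry clears the first row as well,
  and the remaining block is Hermitian of dimension one less.\<close>

lemma spectral_theorem:
  fixes A :: "complex mat"
  assumes "A \<in> carrier_mat n n" "mat_adjoint A = A"
  shows "\<exists>V d. unitary_mat n V \<and> A = V * diag_of n d * mat_adjoint V"
  using assms
proof (induction n arbitrary: A)
  case 0
  then show ?case
    by (intro exI[of _ "1\<^sub>m 0"] exI[of _ "\<lambda>_. 0"]) (auto simp: unitary_mat_def intro!: eq_matI)
next
  case (Suc n A)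
  note A = Suc.prems(1) and hA = Suc.prems(2)
  let ?m = "Suc n"
  have "degree (char_poly A) = Suc n" using degree_monic_char_poly[OF A] by simp
  then have "\<not> constant (poly (char_poly A))" by (simp add: constant_degree)
  then obtain e where "poly (char_poly A) e = 0" using fundamental_theorem_of_algebra by blast
  then have "eigenvalue A e" using eigenvalue_root_char_poly[OF A] by simp
  then obtain v where v: "v \<in> carrier_vec ?m" "v \<noteq> 0\<^sub>v ?m" and Av: "A *\<^sub>v v = e \<cdot>\<^sub>v v"
    unfolding eigenvalue_def eigenvector_def using A by auto
  interpret cof_vec_space ?m "TYPE(complex)" .
  define b where "b = basis_completion v"
  \<comment> \<open>Gram-Schmidt keeps the head of the list, so after scaling the first column of
    the unitary matrix is still an eigenvector.\<close>
  define ws where "ws = gram_schmidt ?m b"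
  define W where "W = mat_of_cols ?m ws"
  from basis_completion[OF v, folded b_def]
  have b: "distinct b" "\<not> lin_dep (set b)" "set b \<subseteq> carrier_vec ?m" "hd b = v" "length b = ?m"
    by auto
  obtain vs where bv: "b = v # vs" using b(4,5) by (cases b) auto
  from gram_schmidt_result[OF b(3) b(1) b(2) refl, folded ws_def]
  have ws: "set ws \<subseteq> carrier_vec ?m" "corthogonal ws" "length ws = ?m" by (auto simp: b(5))
  have hdws: "hd ws = v" unfolding ws_def bv using gram_schmidt_hd[OF v(1), of vs] by simp
  have W: "W \<in> carrier_mat ?m ?m" using mat_of_cols_carrier(1)[of ?m ws] ws(3) by (simp add: W_def)
  have "corthogonal_mat W" unfolding W_def using orthogonal_mat_of_cols ws by blast
  from corthogonal_imp_unitary_scaled[OF W this] obtain d where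
    d: "\<forall>i<?m. 0 < d i" and U: "unitary_mat ?m (W * diag_of ?m d)" by blast
  define U where "U = W * diag_of ?m d"
  have Uc: "U \<in> carrier_mat ?m ?m" and UU: "mat_adjoint U * U = 1\<^sub>m ?m" "U * mat_adjoint U = 1\<^sub>m ?m"
    using U by (auto simp: U_def unitary_mat_def)
  have colU: "col U 0 = complex_of_real (d 0) \<cdot>\<^sub>v v"
  proof -
    have "col W 0 = v" unfolding W_def using ws hdws by (cases ws) auto
    then have "W $$ (i, 0) = v $ i" if "i < ?m" for i
      using W that by (metis carrier_matD index_col zero_less_Suc)
    then show ?thesis unfolding U_def diag_of_mult_right[OF W] using v by (intro eq_vecI) auto
  qed
  have cU: "col U 0 \<in> carrier_vec ?m" using Uc by (metis carrier_matD(1) col_dim)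
  define A' where "A' = mat_adjoint U * A * U"
  have A': "A' \<in> carrier_mat ?m ?m" using Uc A by (auto simp: A'_def)
  have hA': "mat_adjoint A' = A'"
    unfolding A'_def using Uc A hA
    by (simp add: mat_adjoint_mult mat_assoc)
  have col0: "A' $$ (i, 0) = (if i = 0 then e else 0)" if i: "i < ?m" for i
  proof -
    have "col A' 0 = (mat_adjoint U * A) *\<^sub>v col U 0"
      unfolding A'_def using Uc A by (subst col_mult2[of _ ?m ?m _ ?m]) auto
    also have "\<dots> = mat_adjoint U *\<^sub>v (A *\<^sub>v col U 0)"
      using Uc A cU by (intro assoc_mult_mat_vec[of _ ?m ?m _ ?m]) auto
    also have "A *\<^sub>v col U 0 = e \<cdot>\<^sub>v col U 0"
      unfolding colU using A v Av by (auto simp: mult_mat_vec[of _ ?m ?m] smult_smult_assoc mult.commute)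
    also have "mat_adjoint U *\<^sub>v (e \<cdot>\<^sub>v col U 0) = e \<cdot>\<^sub>v (mat_adjoint U *\<^sub>v col U 0)"
      using Uc cU by (intro mult_mat_vec[of _ ?m ?m]) auto
    also have "mat_adjoint U *\<^sub>v col U 0 = col (mat_adjoint U * U) 0"
      using Uc by (subst col_mult2[of _ ?m ?m _ ?m]) auto
    also have "\<dots> = unit_vec ?m 0" unfolding UU by simp
    finally have "col A' 0 $ i = (e \<cdot>\<^sub>v unit_vec ?m 0) $ i" by simp
    then show ?thesis using i A' by simp
  qed
  have row0: "A' $$ (0, j) = (if j = 0 then cnj e else 0)" if "j < ?m" for j
    using arg_cong[OF hA', of "\<lambda>M. M $$ (0, j)"] that A' col0[OF that] by auto
  \<comment> \<open>The corner entry is \<open>e\<close> as part of column 0 and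
    \<open>cnj e\<close> as part of row 0, so the eigenvalue is real.\<close>
  have ce: "cnj e = e" using col0[of 0] row0[of 0] by simp
  define A3 where "A3 = mat n n (\<lambda>(i, j). A' $$ (Suc i, Suc j))"
  have A3: "A3 \<in> carrier_mat n n" by (simp add: A3_def)
  have "mat_adjoint A3 = A3"
  proof (rule eq_matI)
    fix i j assume "i < dim_row A3" "j < dim_col A3"
    then show "mat_adjoint A3 $$ (i, j) = A3 $$ (i, j)"
      using arg_cong[OF hA', of "\<lambda>M. M $$ (Suc i, Suc j)"] A' by (auto simp: A3_def)
  qed (auto simp: A3_def)
  from Suc.IH[OF A3 this] obtain V d' where V: "unitary_mat n V" and A3V: "A3 = V * diag_of n d' * mat_adjoint V"
    by blast
  have Vc: "V \<in> carrier_mat n n" and VV: "mat_adjoint V * V = 1\<^sub>m n"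
    using V by (auto simp: unitary_mat_def)
  let ?B = "\<lambda>a M. four_block_mat (mat 1 1 (\<lambda>_. a)) (0\<^sub>m 1 n) (0\<^sub>m n 1) M :: complex mat"
  define V' where "V' = ?B 1 V"
  have V'c: "V' \<in> carrier_mat ?m ?m" using Vc by (auto simp: V'_def)
  have one: "?B 1 (1\<^sub>m n) = 1\<^sub>m ?m" by (intro eq_matI) auto
  have V'V': "mat_adjoint V' * V' = 1\<^sub>m ?m" unfolding V'_def using Vc
    by (subst four_block_1_adjoint, simp, subst four_block_1_mult) (use one in \<open>auto simp: VV\<close>)
  define f where "f i = (case i of 0 \<Rightarrow> Re e | Suc k \<Rightarrow> d' k)" for i
  have df: "diag_of ?m f = ?B e (diag_of n d')"
    using ce by (intro eq_matI) (auto simp: f_def complex_eq_iff split: nat.split)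
  have A'B: "A' = ?B e A3"
  proof (rule eq_matI)
    fix i j assume "i < dim_row (?B e A3)" "j < dim_col (?B e A3)"
    then have "i < ?m" "j < ?m" using A3 by auto
    then show "A' $$ (i, j) = ?B e A3 $$ (i, j)"
      using A3 ce col0[of i] row0[of j] by (cases i; cases j) (auto simp: A3_def)
  qed (use A' A3 in auto)
  have A'V: "A' = V' * diag_of ?m f * mat_adjoint V'"
    unfolding A'B df V'_def A3V using Vc
    by (subst four_block_1_adjoint, simp, subst four_block_1_mult, simp, simp,
        subst four_block_1_mult, auto intro!: mult_carrier_mat)
  have "A = (U * mat_adjoint U) * A * (U * mat_adjoint U)" unfolding UU using A by simp
  also have "\<dots> = U * A' * mat_adjoint U" unfolding A'_def using Uc A
    by (simp add: mat_assoc)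
  also have "\<dots> = (U * V') * diag_of ?m f * mat_adjoint (U * V')"
    unfolding A'V using Uc V'c by (simp add: mat_assoc mat_adjoint_mult)
  finally have "A = (U * V') * diag_of ?m f * mat_adjoint (U * V')" .
  moreover have "unitary_mat ?m (U * V')"
  proof (rule unitary_matI)
    have "mat_adjoint (U * V') * (U * V') = mat_adjoint V' * ((mat_adjoint U * U) * V')"
      using Uc V'c by (simp add: mat_assoc mat_adjoint_mult)
    then show "mat_adjoint (U * V') * (U * V') = 1\<^sub>m ?m" unfolding UU using V'c V'V' by simp
  qed (use Uc V'c in auto)
  ultimately show ?case by blast
qed

section \<open>Quadratic forms and the semidefinite square root\<close>

lemma scalar_prod_mat_adjoint:
  fixes A :: "complex mat"
  assumes A: "A \<in> carrier_mat n m" and u: "u \<in> carrier_vec m" and v: "v \<in> carrier_vec n"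
  shows "(A *\<^sub>v u) \<bullet>c v = u \<bullet>c (mat_adjoint A *\<^sub>v v)"
proof -
  have "(A *\<^sub>v u) \<bullet>c v = (\<Sum>i = 0..<n. \<Sum>j = 0..<m. A $$ (i, j) * vec_index u j * cnj (vec_index v i))"
    using assms by (auto simp: scalar_prod_def sum_distrib_right intro!: sum.cong)
  also have "\<dots> = (\<Sum>j = 0..<m. \<Sum>i = 0..<n. A $$ (i, j) * vec_index u j * cnj (vec_index v i))"
    by (rule sum.swap)
  also have "\<dots> = u \<bullet>c (mat_adjoint A *\<^sub>v v)"
    using assms by (auto simp: scalar_prod_def sum_distrib_left ac_simps intro!: sum.cong)
  finally show ?thesis .
qed

lemma mult_unit_vec_eq_col:
  fixes A :: "complex mat"
  assumes "A \<in> carrier_mat n m" "i < m"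
  shows "A *\<^sub>v unit_vec m i = col A i"
  using assms by (intro eq_vecI) auto

lemma unitary_adjoint_mult_col:
  assumes V: "unitary_mat n V" and i: "i < n"
  shows "mat_adjoint V *\<^sub>v col V i = unit_vec n i"
  using V i col_mult2[of "mat_adjoint V" n n V n i] by (simp add: unitary_mat_def)

lemma spectral_mult_col:
  assumes V: "unitary_mat n V" and i: "i < n"
  shows "(V * diag_of n d * mat_adjoint V) *\<^sub>v col V i = complex_of_real (d i) \<cdot>\<^sub>v col V i"
proof -
  have Vc: "V \<in> carrier_mat n n" using V by (simp add: unitary_mat_def)
  have c: "col V i \<in> carrier_vec n" using Vc i by simp
  have "(V * diag_of n d * mat_adjoint V) *\<^sub>v col V i = V * diag_of n d *\<^sub>v (mat_adjoint V *\<^sub>v col V i)"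
    using Vc c by (intro assoc_mult_mat_vec[of _ n n _ n]) auto
  also have "\<dots> = (V * diag_of n d) *\<^sub>v unit_vec n i"
    using unitary_adjoint_mult_col[OF V i] by simp
  also have "\<dots> = col (V * diag_of n d) i" using Vc i by (intro mult_unit_vec_eq_col) auto
  also have "\<dots> = complex_of_real (d i) \<cdot>\<^sub>v col V i"
    unfolding diag_of_mult_right[OF Vc] using Vc i by (intro eq_vecI) auto
  finally show ?thesis .
qed

lemma quadratic_form_spectral:
  assumes V: "V \<in> carrier_mat n n" and v: "v \<in> carrier_vec n"
  shows "((V * diag_of n d * mat_adjoint V) *\<^sub>v v) \<bullet>c v
    = complex_of_real (\<Sum>i<n. d i * (cmod (vec_index (mat_adjoint V *\<^sub>v v) i))\<^sup>2)"
proof -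
  define w where "w = mat_adjoint V *\<^sub>v v"
  have w: "w \<in> carrier_vec n" using V v by (auto simp: w_def intro!: mult_mat_vec_carrier)
  have "(V * diag_of n d * mat_adjoint V) *\<^sub>v v = V *\<^sub>v (diag_of n d *\<^sub>v w)"
    unfolding w_def
      using V v by (simp add: assoc_mult_mat_vec[of _ n n _ n] mult_mat_vec_carrier[of _ n n])
  then have "((V * diag_of n d * mat_adjoint V) *\<^sub>v v) \<bullet>c v = (diag_of n d *\<^sub>v w) \<bullet>c w"
    using scalar_prod_mat_adjoint[OF V _ v, of "diag_of n d *\<^sub>v w"] w
    by (simp add: w_def mult_mat_vec_carrier[of _ n n])
  also have "\<dots> = (\<Sum>i<n. complex_of_real (d i) * (vec_index w i * cnj (vec_index w i)))"
    using w by (auto simp: scalar_prod_def lessThan_atLeast0 mult.assoc if_distrib[of "\<lambda>x. x * _"] cong: if_cong intro!: sum.cong)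
  finally show ?thesis by (simp add: w_def complex_norm_square[symmetric])
qed

text \<open>Evaluating the quadratic form at column \<open>i\<close> of \<open>V\<close> isolates
  the eigenvalue \<open>d i\<close>.\<close>

lemma hermitian_psd_spectral:
  assumes "A \<in> carrier_mat n n" "hermitian_psd A"
  obtains V d where "unitary_mat n V" "A = V * diag_of n d * mat_adjoint V" "\<And>i. i < n \<Longrightarrow> 0 \<le> d i"
proof -
  obtain V d where V: "unitary_mat n V" and A: "A = V * diag_of n d * mat_adjoint V"
    using spectral_theorem[OF assms(1)] assms(2) unfolding hermitian_psd_def by blast
  have Vc: "V \<in> carrier_mat n n" using V by (simp add: unitary_mat_def)
  have "0 \<le> d i" if i: "i < n" for i
  proof -
    have "0 \<le> Re ((A *\<^sub>v col V i) \<bullet>c col V i)"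
      using assms i Vc unfolding hermitian_psd_def by auto
    also have "(A *\<^sub>v col V i) \<bullet>c col V i = complex_of_real (d i)"
      unfolding A quadratic_form_spectral[OF Vc col_carrier_vec[OF i Vc]] unitary_adjoint_mult_col[OF V i]
      using i by (auto simp: unit_vec_def if_distrib[of "\<lambda>x. (cmod x)\<^sup>2"] if_distrib[of "\<lambda>x. _ * x"] cong: if_cong)
    finally show ?thesis by simp
  qed
  with V A that show ?thesis by blast
qed

lemma hermitian_psd_of_spectral:
  assumes V: "V \<in> carrier_mat n n" and d: "\<And>i. i < n \<Longrightarrow> 0 \<le> d i"
  shows "hermitian_psd (V * diag_of n d * mat_adjoint V)"
proof -
  have "mat_adjoint (V * diag_of n d * mat_adjoint V) = V * diag_of n d * mat_adjoint V"
    using V by (simp add: mat_adjoint_mult mat_assoc)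
  moreover have "0 \<le> Re (((V * diag_of n d * mat_adjoint V) *\<^sub>v v) \<bullet>c v)" if "v \<in> carrier_vec n" for v
    unfolding quadratic_form_spectral[OF V that] using d by (auto intro!: sum_nonneg)
  ultimately show ?thesis using V unfolding hermitian_psd_def by auto
qed

text \<open>For \<open>M = B - C\<close> one has \<open>B M + M C = B^2 - C^2 = 0\<close>, although
  \<open>B\<close> and \<open>C\<close> may fail to commute. At a unit eigenvector \<open>x\<close>
  of \<open>M\<close> with eigenvalue \<open>t\<close> this gives \<open>t (b + c) = 0\<close>,
  where \<open>b\<close> and \<open>c\<close> are the nonnegative values of the two quadratic forms
  at \<open>x\<close>, while \<open>t = b - c\<close>. Hence \<open>t = 0\<close> in either case,
  and \<open>M\<close> vanishes.\<close>

lemma hermitian_psd_square_inj: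
  assumes Bp: "hermitian_psd B" and Cp: "hermitian_psd C"
    and B: "B \<in> carrier_mat n n" and C: "C \<in> carrier_mat n n" and eq: "B * B = C * C"
  shows "B = C"
proof -
  define M where "M = B + (-1) \<cdot>\<^sub>m C"
  have M: "M \<in> carrier_mat n n" using B C by (auto simp: M_def)
  have hB: "mat_adjoint B = B" and hC: "mat_adjoint C = C" using Bp Cp by (auto simp: hermitian_psd_def)
  have hM: "mat_adjoint M = M"
    unfolding M_def using B C hB hC by (simp add: mat_adjoint_add[of _ n n] mat_adjoint_smult)
  obtain V d where V: "unitary_mat n V" and MV: "M = V * diag_of n d * mat_adjoint V"
    using spectral_theorem[OF M hM] by blast
  have Vc: "V \<in> carrier_mat n n" using V by (simp add: unitary_mat_def)
  have "d i = 0" if i: "i < n" for i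
  proof -
    define x where "x = col V i"
    have x: "x \<in> carrier_vec n" using Vc i by (simp add: x_def)
    have Mx: "M *\<^sub>v x = complex_of_real (d i) \<cdot>\<^sub>v x"
      unfolding x_def MV by (rule spectral_mult_col[OF V i])
    have xx: "x \<bullet>c x = 1"
      using scalar_prod_mat_adjoint[OF Vc, of "unit_vec n i" x] x Vc i
      by (simp add: x_def unitary_adjoint_mult_col[OF V i] mult_unit_vec_eq_col[of _ n n])
    define b where "b = (B *\<^sub>v x) \<bullet>c x"
    define c where "c = (C *\<^sub>v x) \<bullet>c x"
    have b0: "0 \<le> Re b" and c0: "0 \<le> Re c"
      using Bp Cp B C x unfolding b_def c_def hermitian_psd_def by auto
    have [simp]: "B *\<^sub>v x \<in> carrier_vec n" "C *\<^sub>v x \<in> carrier_vec n"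
      using B C x by (auto intro: mult_mat_vec_carrier)
    have Mx': "M *\<^sub>v x = B *\<^sub>v x + (-1) \<cdot>\<^sub>v (C *\<^sub>v x)"
      unfolding M_def using B C x 
      by (intro eq_vecI) (auto simp: scalar_prod_def sum.distrib[symmetric] sum_negf[symmetric] algebra_simps intro!: sum.cong)
    have bc: "b - c = complex_of_real (d i)"
    proof -
      have "(M *\<^sub>v x) \<bullet>c x = b - c" unfolding Mx' b_def c_def using B C x
        by (subst add_scalar_prod_distrib[of _ n]) auto
      then show ?thesis unfolding Mx using x xx by simp
    qed
    have "(B *\<^sub>v (M *\<^sub>v x)) \<bullet>c x + (M *\<^sub>v (C *\<^sub>v x)) \<bullet>c x = 0"
    proof -
      have "B * M + M * C = 0\<^sub>m n n"
      proof -
        have "B * M = B * B + (-1) \<cdot>\<^sub>m (B * C)" unfolding M_def using B C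
          by (simp add: mult_add_distrib_mat[of _ n n _ n] mult_smult_distrib[of _ n n _ n])
        moreover have "M * C = B * C + (-1) \<cdot>\<^sub>m (C * C)" unfolding M_def using B C
          by (simp add: add_mult_distrib_mat[of _ n n _ _ n] mult_smult_assoc_mat[of _ n n _ n])
        ultimately show ?thesis using B C eq by (intro eq_matI) auto
      qed
      then have "(B * M + M * C) *\<^sub>v x = 0\<^sub>v n" using x by (intro eq_vecI) auto
      then have "B *\<^sub>v (M *\<^sub>v x) + M *\<^sub>v (C *\<^sub>v x) = 0\<^sub>v n"
        using B C M x by (simp add: add_mult_distrib_mat_vec[of _ n n] assoc_mult_mat_vec[of _ n n _ n])
      moreover have "B *\<^sub>v (M *\<^sub>v x) \<in> carrier_vec n" "M *\<^sub>v (C *\<^sub>v x) \<in> carrier_vec n"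
        using B C M x by (auto intro!: mult_mat_vec_carrier)
      ultimately show ?thesis using x by (subst add_scalar_prod_distrib[of _ n, symmetric]) auto
    qed
    moreover have "(B *\<^sub>v (M *\<^sub>v x)) \<bullet>c x = complex_of_real (d i) * b"
      unfolding Mx b_def using B x by (subst mult_mat_vec[of _ n n]) auto
    moreover have "(M *\<^sub>v (C *\<^sub>v x)) \<bullet>c x = complex_of_real (d i) * c"
    proof -
      have "(M *\<^sub>v (C *\<^sub>v x)) \<bullet>c x = (C *\<^sub>v x) \<bullet>c (M *\<^sub>v x)"
        by (subst scalar_prod_mat_adjoint[OF M _ x]) (auto simp: hM)
      then show ?thesis unfolding Mx c_def using x
        by (simp add: conjugate_smult_vec scalar_prod_smult_distrib[of _ n])
    qed
    ultimately have "complex_of_real (d i) * (b + c) = 0" by (simp add: algebra_simps)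
    then have "d i = 0 \<or> Re b + Re c = 0" by (auto simp: complex_eq_iff)
    moreover have "Re b - Re c = d i" using bc by (simp add: complex_eq_iff)
    ultimately show ?thesis using b0 c0 by linarith
  qed
  then have "diag_of n d = 0\<^sub>m n n" by (intro eq_matI) auto
  then have "M = 0\<^sub>m n n" unfolding MV using Vc by simp
  show ?thesis
  proof (rule eq_matI)
    fix i j assume "i < dim_row C" "j < dim_col C"
    then show "B $$ (i, j) = C $$ (i, j)"
      using arg_cong[OF \<open>M = 0\<^sub>m n n\<close>, of "\<lambda>M. M $$ (i, j)"] B C
        by (auto simp: M_def)
  qed (use B C in auto)
qed

text \<open>\<open>psd_sqrt\<close> is a definite description, so its properties rest on existence
  and uniqueness of the root. The factorisation, with the pseudo-inverse root as \<open>X\<close>,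
  is what later transfers the rank bound on \<open>R\<^sub>T\<close> to products containing its
  root.\<close>

lemma psd_sqrt_factor:
  assumes A: "A \<in> carrier_mat n n" and pA: "hermitian_psd A"
  shows "psd_sqrt A \<in> carrier_mat n n" "mat_adjoint (psd_sqrt A) = psd_sqrt A"
    "\<exists>X \<in> carrier_mat n n. psd_sqrt A = A * X"
proof -
  obtain V d where V: "unitary_mat n V" and AV: "A = V * diag_of n d * mat_adjoint V"
    and d: "\<And>i. i < n \<Longrightarrow> 0 \<le> d i" using hermitian_psd_spectral[OF A pA] by blast
  have Vc: "V \<in> carrier_mat n n" and VV: "mat_adjoint V * V = 1\<^sub>m n"
    using V by (auto simp: unitary_mat_def)
  have mult: "(V * diag_of n f * mat_adjoint V) * (V * diag_of n g * mat_adjoint V)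
      = V * diag_of n (\<lambda>i. f i * g i) * mat_adjoint V" for f g
  proof -
    have "(V * diag_of n f * mat_adjoint V) * (V * diag_of n g * mat_adjoint V)
        = V * diag_of n f * ((mat_adjoint V * V) * (diag_of n g * mat_adjoint V))"
      using Vc by (simp add: mat_assoc)
    also have "\<dots> = V * (diag_of n f * diag_of n g) * mat_adjoint V"
      unfolding VV using Vc by (simp add: mat_assoc left_mult_one_mat[of _ n n])
    finally show ?thesis by (simp add: diag_of_mult)
  qed
  define B where "B = V * diag_of n (\<lambda>i. sqrt (d i)) * mat_adjoint V"
  have B: "B \<in> carrier_mat n n" "hermitian_psd B"
    unfolding B_def using Vc d by (auto intro!: hermitian_psd_of_spectral)
  have BB: "B * B = A" unfolding B_def mult AV using d by (simp cong: diag_of_cong)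
  have sq: "psd_sqrt A = B" unfolding psd_sqrt_def
  proof (rule the_equality)
    fix C assume C: "hermitian_psd C \<and> C * C = A"
    \<comment> \<open>The description ranges over matrices of every size, so the dimensions of a
      competitor are recovered from \<open>C * C = A\<close> and from its equality with its
      adjoint.\<close>
    then have "dim_row C = n" using A by auto
    moreover have "dim_col C = dim_row C"
      using C unfolding hermitian_psd_def by (metis mat_adjoint_dim(1))
    ultimately have "C \<in> carrier_mat n n" by auto
    then show "C = B" using C B BB by (intro hermitian_psd_square_inj[of C B n]) auto
  qed (use B BB in auto)
  show "psd_sqrt A \<in> carrier_mat n n" "mat_adjoint (psd_sqrt A) = psd_sqrt A"
    using B unfolding sq hermitian_psd_def by auto
  \<comment> \<open>For singular \<open>A\<close> this uses \<open>1 / sqrt 0 = 0\<close>.\<close>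
  have "B = A * (V * diag_of n (\<lambda>i. 1 / sqrt (d i)) * mat_adjoint V)"
    unfolding B_def AV mult using d by (simp add: real_div_sqrt cong: diag_of_cong)
  then show "\<exists>X \<in> carrier_mat n n. psd_sqrt A = A * X"
    unfolding sq
      using Vc by (intro bexI[of _ "V * diag_of n (\<lambda>i. 1 / sqrt (d i)) * mat_adjoint V"]) auto
qed

section \<open>Rank and Kronecker products\<close>

text \<open>The columns of \<open>U\<close> are a maximal independent set of columns of
  \<open>M\<close>, and \<open>W\<close> holds the coordinates of all columns in it. Rank is used
  below only as this inner dimension.\<close>

lemma rank_factorization:
  fixes M :: "complex mat"
  assumes M: "M \<in> carrier_mat n m"
  obtains U W where "U \<in> carrier_mat n (mat_rank M)" "W \<in> carrier_mat (mat_rank M) m" "M = U * W"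
proof -
  interpret vec_space "TYPE(complex)" n .
  have "\<exists>S. maximal S (\<lambda>T. T \<subseteq> set (cols M) \<and> lin_indpt T) \<and> finite S"
    using maximal_exists_superset[of "set (cols M)" "\<lambda>T. T \<subseteq> set (cols M) \<and> lin_indpt T" "{}"]
    by (auto simp: lin_dep_def)
  then obtain S where mx: "maximal S (\<lambda>T. T \<subseteq> set (cols M) \<and> lin_indpt T)" and fS: "finite S"
    by blast
  have rk: "mat_rank M = card S" using rank_card_indpt[OF M mx] M by (simp add: mat_rank_def)
  have colsc: "set (cols M) \<subseteq> carrier_vec n" using M cols_dim by blast
  have S: "S \<subseteq> set (cols M)" "lin_indpt S" using mx by (auto simp: maximal_def)
  have Sc: "S \<subseteq> carrier_vec n" using S colsc by blast
  have span: "v \<in> span S" if v: "v \<in> set (cols M)" for v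
  proof (cases "v \<in> S")
    case True
    then show ?thesis using in_own_span[of S] Sc by auto
  next
    case False
    have "\<not> lin_indpt (S \<union> {v})"
    proof
      assume "lin_indpt (S \<union> {v})"
      then have "S \<union> {v} = S" using mx S v unfolding maximal_def by blast
      with False show False by blast
    qed
    then show ?thesis using lin_dep_iff_in_span[of S v] Sc S(2) False v colsc by auto
  qed
  obtain ss where ss: "set ss = S" "distinct ss" using finite_distinct_list[OF fS] by blast
  have lss: "length ss = card S" using ss distinct_card by force
  have "\<exists>a. col M j = lincomb a S" if "j < m" for j
  proof -
    have "col M j \<in> set (cols M)" using that M by (auto simp: cols_def)
    from span[OF this] have "\<exists>a. lincomb a S = col M j"
      using finite_in_span[OF fS, of "col M j"] Sc by auto
    then show ?thesis by metis
  qed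
  then obtain a where a: "\<And>j. j < m \<Longrightarrow> col M j = lincomb (a j) S" by metis
  define U where "U = mat n (card S) (\<lambda>(i, k). vec_index (ss ! k) i)"
  define W where "W = mat (card S) m (\<lambda>(k, j). a j (ss ! k))"
  have "M = U * W"
  proof (rule eq_matI)
    fix i j assume "i < dim_row (U * W)" "j < dim_col (U * W)"
    then have i: "i < n" and j: "j < m" by (auto simp: U_def W_def)
    have "M $$ (i, j) = vec_index (col M j) i" using i j M by simp
    also have "\<dots> = (\<Sum>x\<in>S. a j x * vec_index x i)"
      unfolding a[OF j] by (rule lincomb_index[OF i Sc])
    also have "\<dots> = (\<Sum>k<card S. a j (ss ! k) * vec_index (ss ! k) i)"
      unfolding ss(1)[symmetric] lss[symmetric, unfolded ss(1)[symmetric]]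
      by (rule sum.reindex_bij_betw[symmetric, OF bij_betw_nth[OF ss(2)]]) auto
    also have "\<dots> = (U * W) $$ (i, j)" using i j
      by (auto simp: U_def W_def scalar_prod_def lessThan_atLeast0 mult.commute)
    finally show "M $$ (i, j) = (U * W) $$ (i, j)" .
  qed (use M in \<open>auto simp: U_def W_def\<close>)
  then show ?thesis using that[of U W] unfolding rk by (auto simp: U_def W_def)
qed

text \<open>Restriction to the \<open>k\<close> indices with nonzero entries gives an invertible
  diagonal matrix that factors through dimension \<open>r\<close>. If \<open>r < k\<close>, padding
  the factors with zeros to square shape produces a singular factor, contradicting the nonzero
  determinant.\<close>

lemma card_diag_factor_le:
  assumes U: "U \<in> carrier_mat n r" and W: "W \<in> carrier_mat r n" and eq: "diag_of n d = U * W"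
  shows "card {i. i < n \<and> d i \<noteq> 0} \<le> r"
proof (rule ccontr)
  define J where "J = {i. i < n \<and> d i \<noteq> 0}"
  define js where "js = sorted_list_of_set J"
  define k where "k = card J"
  have fJ: "finite J" by (simp add: J_def)
  have js: "set js = J" "distinct js" "length js = k" using fJ by (auto simp: js_def k_def)
  assume "\<not> card {i. i < n \<and> d i \<noteq> 0} \<le> r"
  then have rk: "r < k" by (simp add: k_def J_def)
  have jsn: "js ! a < n" "d (js ! a) \<noteq> 0" if "a < k" for a
    using nth_mem[of a js] that js by (auto simp: J_def)
  \<comment> \<open>Column \<open>r\<close> of \<open>P\<close> lies in the padding and vanishes;
    this is the vector that shows \<open>det P = 0\<close>.\<close>
  define P where "P = mat k k (\<lambda>(a, b). if b < r then U $$ (js ! a, b) else 0)"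
  define Q where "Q = mat k k (\<lambda>(b, a). if b < r then W $$ (b, js ! a) else 0)"
  have "P * Q = diag_of k (\<lambda>a. d (js ! a))"
  proof (rule eq_matI)
    fix a b assume "a < dim_row (diag_of k (\<lambda>a. d (js ! a)))" "b < dim_col (diag_of k (\<lambda>a. d (js ! a)))"
    then have ab: "a < k" "b < k" by auto
    have "(P * Q) $$ (a, b) = (\<Sum>c<k. (if c < r then U $$ (js ! a, c) else 0) * (if c < r then W $$ (c, js ! b) else 0))"
      using ab by (simp add: P_def Q_def scalar_prod_def lessThan_atLeast0)
    also have "\<dots> = (\<Sum>c<r. U $$ (js ! a, c) * W $$ (c, js ! b))"
      using rk by (intro sum.mono_neutral_cong_right) auto
    also have "\<dots> = (U * W) $$ (js ! a, js ! b)"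
      using jsn ab U W by (simp add: scalar_prod_def lessThan_atLeast0)
    also have "\<dots> = diag_of k (\<lambda>a. d (js ! a)) $$ (a, b)"
      unfolding eq[symmetric] using jsn ab js by (simp add: nth_eq_iff_index_eq)
    finally show "(P * Q) $$ (a, b) = diag_of k (\<lambda>a. d (js ! a)) $$ (a, b)" .
  qed (auto simp: P_def Q_def)
  then have "det P * det Q = complex_of_real (\<Prod>a<k. d (js ! a))"
    using det_mult[of P k Q] by (simp add: P_def Q_def det_diag_of)
  moreover have "(\<Prod>a<k. d (js ! a)) \<noteq> 0" using jsn by simp
  ultimately have "det P \<noteq> 0" by auto
  moreover have "det P = 0"
  proof -
    have "P *\<^sub>v unit_vec k r = 0\<^sub>v k" using rk
      by (subst mult_unit_vec_eq_col[of _ k k]) (auto simp: P_def intro!: eq_vecI)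
    moreover have "unit_vec k r \<noteq> (0\<^sub>v k :: complex vec)"
      using rk by (metis index_unit_vec(2) index_zero_vec(1) zero_neq_one)
    ultimately show ?thesis
      using det_0_iff_vec_prod_zero_field[of P k] by (auto simp: P_def intro: unit_vec_carrier)
  qed
  ultimately show False by simp
qed

text \<open>Conjugating by \<open>V\<close> and factoring \<open>M\<close> through its rank exhibits
  \<open>diag_of n d\<close> as a product through dimension \<open>mat_rank M\<close>. It serves
  twice, with \<Phi> and with \<open>R\<^sub>T\<close> as the middle factor.\<close>

lemma card_spectral_le_rank:
  assumes V: "unitary_mat n V" and X: "X \<in> carrier_mat n k" and M: "M \<in> carrier_mat k l" and Y: "Y \<in> carrier_mat l n"
    and eq: "X * M * Y = V * diag_of n d * mat_adjoint V"
  shows "card {i. i < n \<and> d i \<noteq> 0} \<le> mat_rank M"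
proof -
  have Vc: "V \<in> carrier_mat n n" and VV: "mat_adjoint V * V = 1\<^sub>m n"
    using V by (auto simp: unitary_mat_def)
  obtain U W where U: "U \<in> carrier_mat k (mat_rank M)" and W: "W \<in> carrier_mat (mat_rank M) l" and MU: "M = U * W"
    using rank_factorization[OF M] by blast
  have "diag_of n d = (mat_adjoint V * V) * diag_of n d * (mat_adjoint V * V)" unfolding VV by simp
  also have "\<dots> = mat_adjoint V * (V * diag_of n d * mat_adjoint V) * V"
    using Vc by (simp add: mat_assoc)
  also have "\<dots> = mat_adjoint V * (X * M * Y) * V" by (simp only: eq)
  also have "\<dots> = (mat_adjoint V * X * U) * (W * Y * V)"
    unfolding MU using Vc X U W Y by (simp add: mat_assoc)
  finally show ?thesis
    by (intro card_diag_factor_le) (use Vc X U W Y in \<open>auto intro!: mult_carrier_mat\<close>)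
qed

section \<open>Kronecker products and their log determinants\<close>

lemma bij_betw_div_mod:
  "bij_betw (\<lambda>l. (l div d, l mod d)) {..<b * d} ({..<b} \<times> {..<(d::nat)})"
proof (rule bij_betwI[where g="\<lambda>(p, q). p * d + q"])
  show "(\<lambda>(p, q). p * d + q) \<in> {..<b} \<times> {..<d} \<rightarrow> {..<b * d}"
  proof (clarsimp)
    fix p q assume "p < b" "q < d"
    then have "p * d + q < Suc p * d" by simp
    moreover have "Suc p * d \<le> b * d" using \<open>p < b\<close> by (intro mult_right_mono) auto
    ultimately show "p * d + q < b * d" by linarith
  qed
  show "(\<lambda>l. (l div d, l mod d)) \<in> {..<b * d} \<rightarrow> {..<b} \<times> {..<d}"
    by (auto simp: less_mult_imp_div_less intro!: mod_less_divisor) (metis gr_zeroI mult_0_right not_less_zero)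
qed (auto simp: mult.commute)

lemma sum_div_mod: "(\<Sum>l<b * d. f (l div d) (l mod d)) = (\<Sum>p<b. \<Sum>q<d. f p q)" for d :: nat
  using sum.reindex_bij_betw[OF bij_betw_div_mod[of d b], of "\<lambda>(p, q). f p q"]
  by (simp add: sum.cartesian_product)

lemma prod_div_mod: "(\<Prod>l<b * d. f (l div d) (l mod d)) = (\<Prod>p<b. \<Prod>q<d. f p q)" for d :: nat
  using prod.reindex_bij_betw[OF bij_betw_div_mod[of d b], of "\<lambda>(p, q). f p q"]
  by (simp add: prod.cartesian_product)

lemma div_mod_less_mult: "i < a * (b::nat) \<Longrightarrow> i div b < a \<and> i mod b < b"
  using bij_betw_div_mod[of b a] by (auto simp: bij_betw_def)

lemma kronecker_product_dim [simp]:
  "dim_row (kronecker_product A B) = dim_row A * dim_row B"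
  "dim_col (kronecker_product A B) = dim_col A * dim_col B"
  by (simp_all add: kronecker_product_def)

lemma kronecker_product_mult:
  assumes "dim_col A = dim_row C" "dim_col B = dim_row D"
  shows "kronecker_product A B * kronecker_product C D = kronecker_product (A * C) (B * D)"
proof (rule eq_matI)
  fix i j
  assume "i < dim_row (kronecker_product (A * C) (B * D))" "j < dim_col (kronecker_product (A * C) (B * D))"
  then have i: "i < dim_row A * dim_row B" and j: "j < dim_col C * dim_col D" by auto
  note ij = div_mod_less_mult[OF i] div_mod_less_mult[OF j]
  let ?f = "\<lambda>p q. A $$ (i div dim_row B, p) * C $$ (p, j div dim_col D) * (B $$ (i mod dim_row B, q) * D $$ (q, j mod dim_col D))"
  have "(kronecker_product A B * kronecker_product C D) $$ (i, j)
      = (\<Sum>l<dim_row C * dim_row D. ?f (l div dim_row D) (l mod dim_row D))"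
    using i j assms
      by (auto simp: kronecker_product_def scalar_prod_def lessThan_atLeast0 ac_simps intro!: sum.cong)
  also have "\<dots> = (\<Sum>p<dim_row C. \<Sum>q<dim_row D. ?f p q)" by (rule sum_div_mod)
  also have "\<dots> = kronecker_product (A * C) (B * D) $$ (i, j)"
    using i j ij assms by (simp add: kronecker_product_def scalar_prod_def lessThan_atLeast0 sum_product)
  finally show "(kronecker_product A B * kronecker_product C D) $$ (i, j) = kronecker_product (A * C) (B * D) $$ (i, j)" .
qed auto

lemma kronecker_product_adjoint:
  "mat_adjoint (kronecker_product A B) = kronecker_product (mat_adjoint A) (mat_adjoint B)"
  by (intro eq_matI) (auto simp: kronecker_product_def dest!: div_mod_less_mult)

lemma kronecker_product_diag_of:
  "kronecker_product (diag_of a l) (diag_of b g) = diag_of (a * b) (\<lambda>i. l (i div b) * g (i mod b))"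
proof (rule eq_matI)
  fix i j
  assume "i < dim_row (diag_of (a * b) (\<lambda>i. l (i div b) * g (i mod b)))"
    "j < dim_col (diag_of (a * b) (\<lambda>i. l (i div b) * g (i mod b)))"
  then have i: "i < a * b" and j: "j < a * b" by auto
  have "i = j \<longleftrightarrow> i div b = j div b \<and> i mod b = j mod b"
    by (metis div_mult_mod_eq)
  then show "kronecker_product (diag_of a l) (diag_of b g) $$ (i, j)
      = diag_of (a * b) (\<lambda>i. l (i div b) * g (i mod b)) $$ (i, j)"
    using i j div_mod_less_mult[OF i] div_mod_less_mult[OF j] by (simp add: kronecker_product_def)
qed auto

lemma kronecker_product_one: "kronecker_product (1\<^sub>m a) (1\<^sub>m b) = 1\<^sub>m (a * b)"
  using kronecker_product_diag_of[of a "\<lambda>_. 1" b "\<lambda>_. 1"] by (simp add: diag_of_one)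

lemma unitary_mat_kronecker:
  assumes "unitary_mat a V" "unitary_mat b U"
  shows "unitary_mat (a * b) (kronecker_product V U)"
  using assms
  by (intro unitary_matI) (auto simp: unitary_mat_def kronecker_product_adjoint kronecker_product_mult kronecker_product_one)

lemma det_mult_adjoint_unitary:
  assumes V: "unitary_mat n V" and A: "A \<in> carrier_mat n n"
  shows "det (V * A * mat_adjoint V) = det A"
proof -
  have Vc: "V \<in> carrier_mat n n" and VV: "V * mat_adjoint V = 1\<^sub>m n"
    using V by (auto simp: unitary_mat_def)
  have "det (V * A * mat_adjoint V) = det V * det A * det (mat_adjoint V)"
    using Vc A by (simp add: det_mult[of _ n] mult_carrier_mat[of _ n n])
  also have "\<dots> = det (V * mat_adjoint V) * det A" using Vc by (simp add: det_mult[of _ n])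
  finally show ?thesis unfolding VV by simp
qed

lemma one_plus_smult_conj_unitary:
  assumes V: "unitary_mat n V" and A: "A \<in> carrier_mat n n"
  shows "1\<^sub>m n + c \<cdot>\<^sub>m (V * A * mat_adjoint V) = V * (1\<^sub>m n + c \<cdot>\<^sub>m A) * mat_adjoint V"
proof -
  have Vc: "V \<in> carrier_mat n n" and VV: "V * mat_adjoint V = 1\<^sub>m n"
    using V by (auto simp: unitary_mat_def)
  have "V * (1\<^sub>m n + c \<cdot>\<^sub>m A) = V + c \<cdot>\<^sub>m (V * A)"
    using Vc A by (simp add: mult_add_distrib_mat[of _ n n _ n] mult_smult_distrib[of _ n n _ n])
  then have "V * (1\<^sub>m n + c \<cdot>\<^sub>m A) * mat_adjoint V = V * mat_adjoint V + (c \<cdot>\<^sub>m (V * A)) * mat_adjoint V"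
    using Vc A by (simp add: add_mult_distrib_mat[of _ n n _ _ n] mult_carrier_mat[of _ n n])
  then show ?thesis
    unfolding VV using Vc A by (simp add: mult_smult_assoc_mat[of _ n n _ n] mult_carrier_mat[of _ n n])
qed

lemma det_one_plus_spectral:
  assumes V: "unitary_mat n V"
  shows "det (1\<^sub>m n + complex_of_real t \<cdot>\<^sub>m (V * diag_of n d * mat_adjoint V)) = complex_of_real (\<Prod>i<n. 1 + t * d i)"
  using V by (simp add: one_plus_smult_conj_unitary one_plus_smult_diag_of det_mult_adjoint_unitary det_diag_of del: of_real_prod)

text \<open>The eigenvalues of a Kronecker product are the products of eigenvalues; grouping them by
  \<open>l k\<close> decouples the large determinant into \<open>a\<close> determinants of size
  \<open>b\<close>. Nonnegativity keeps every factor positive, as the logarithm of the product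
  requires.\<close>

lemma log_det_kronecker:
  assumes V: "unitary_mat a V" and U: "unitary_mat b U" and t: "0 \<le> t"
    and l: "\<And>k. k < a \<Longrightarrow> 0 \<le> l k" and g: "\<And>p. p < b \<Longrightarrow> 0 \<le> g p"
    and R: "R = V * diag_of a l * mat_adjoint V" and G: "G = U * diag_of b g * mat_adjoint U"
  shows "log_det (1\<^sub>m (a * b) + complex_of_real t \<cdot>\<^sub>m kronecker_product R G)
    = (\<Sum>k<a. log_det (1\<^sub>m b + complex_of_real (t * l k) \<cdot>\<^sub>m G))"
proof -
  have "kronecker_product R G = kronecker_product V U * diag_of (a * b) (\<lambda>i. l (i div b) * g (i mod b))
      * mat_adjoint (kronecker_product V U)"
    unfolding R G kronecker_product_diag_of[symmetric]
    using unitary_mat_carrier[OF V] unitary_mat_carrier[OF U]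
    by (simp add: kronecker_product_mult kronecker_product_adjoint)
  then have "det (1\<^sub>m (a * b) + complex_of_real t \<cdot>\<^sub>m kronecker_product R G)
      = complex_of_real (\<Prod>i<a * b. 1 + t * (l (i div b) * g (i mod b)))"
    using det_one_plus_spectral[OF unitary_mat_kronecker[OF V U]] by simp
  also have "(\<Prod>i<a * b. 1 + t * (l (i div b) * g (i mod b))) = (\<Prod>k<a. \<Prod>p<b. 1 + (t * l k) * g p)"
    using prod_div_mod[of "\<lambda>k p. 1 + t * (l k * g p)" b a] by (simp add: mult.assoc)
  finally have d: "det (1\<^sub>m (a * b) + complex_of_real t \<cdot>\<^sub>m kronecker_product R G) = complex_of_real (\<Prod>k<a. \<Prod>p<b. 1 + (t * l k) * g p)" .
  have pos: "0 < (\<Prod>p<b. 1 + (t * l k) * g p)" if "k < a" for k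
    using t l[OF that] g by (intro prod_pos) (auto intro!: add_pos_nonneg)
  show ?thesis unfolding log_det_def d unfolding G det_one_plus_spectral[OF U] Re_complex_of_real
    using pos by (subst ln_prod) (auto simp: less_imp_neq[symmetric])
qed

section \<open>The resolvent of a Gram matrix\<close>

definition gram1 :: "complex mat \<Rightarrow> complex mat" where
  "gram1 Y = 1\<^sub>m (dim_row Y) + Y * mat_adjoint Y"

text \<open>Writing the inverse through the adjugate makes its measurability evident.\<close>

definition resolvent :: "complex mat \<Rightarrow> complex mat" where
  "resolvent Y = inverse (det (gram1 Y)) \<cdot>\<^sub>m adj_mat (gram1 Y)"

lemma gram1_carrier [simp]: "Y \<in> carrier_mat n N \<Longrightarrow> gram1 Y \<in> carrier_mat n n"
  by (auto simp: gram1_def)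

lemma Re_self_cscalar_prod_nonneg: "0 \<le> Re (w \<bullet>c w)" for w :: "complex vec"
  by (auto simp: scalar_prod_def intro!: sum_nonneg add_nonneg_nonneg)

lemma one_smult_complex_mat: "(1 :: complex) \<cdot>\<^sub>m A = A"
  by (intro eq_matI) auto

lemma mult_mat_1_1: "A \<in> carrier_mat n 1 \<Longrightarrow> M \<in> carrier_mat 1 1 \<Longrightarrow> A * M = (M $$ (0, 0)) \<cdot>\<^sub>m A"
  for A :: "complex mat"
  by (intro eq_matI) (auto simp: scalar_prod_def)

lemma hermitian_psd_gram:
  assumes Y: "Y \<in> carrier_mat n N"
  shows "hermitian_psd (Y * mat_adjoint Y)"
proof -
  have "0 \<le> Re (((Y * mat_adjoint Y) *\<^sub>v v) \<bullet>c v)" if v: "v \<in> carrier_vec n" for v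
  proof -
    have w: "mat_adjoint Y *\<^sub>v v \<in> carrier_vec N"
      using Y v by (auto intro!: mult_mat_vec_carrier)
    have "((Y * mat_adjoint Y) *\<^sub>v v) \<bullet>c v = (mat_adjoint Y *\<^sub>v v) \<bullet>c (mat_adjoint Y *\<^sub>v v)"
      using scalar_prod_mat_adjoint[OF Y w v] Y v by (simp add: assoc_mult_mat_vec[of _ n N _ n])
    then show ?thesis by (simp add: Re_self_cscalar_prod_nonneg)
  qed
  then show ?thesis using Y by (auto simp: hermitian_psd_def mat_adjoint_mult)
qed

text \<open>The eigenvalues \<open>1 + d i\<close> are at least 1, so the determinant is nonzero and
  the adjugate formula is a genuine inverse; uniqueness of inverses identifies it with the spectral
  expression.\<close>

lemma gram1_spectral:
  assumes Y: "Y \<in> carrier_mat n N"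
  obtains V d where "unitary_mat n V" "\<And>i. i < n \<Longrightarrow> 0 \<le> d i"
    "gram1 Y = V * diag_of n (\<lambda>i. 1 + d i) * mat_adjoint V"
    "resolvent Y = V * diag_of n (\<lambda>i. inverse (1 + d i)) * mat_adjoint V"
    "det (gram1 Y) = complex_of_real (\<Prod>i<n. 1 + d i)"
    "resolvent Y * gram1 Y = 1\<^sub>m n" "gram1 Y * resolvent Y = 1\<^sub>m n"
proof -
  have "Y * mat_adjoint Y \<in> carrier_mat n n" using Y by auto
  from hermitian_psd_spectral[OF this hermitian_psd_gram[OF Y]] obtain V d where
    V: "unitary_mat n V" and YV: "Y * mat_adjoint Y = V * diag_of n d * mat_adjoint V"
    and d: "\<And>i. i < n \<Longrightarrow> 0 \<le> d i" by blast
  have Vc: "V \<in> carrier_mat n n" and VV: "mat_adjoint V * V = 1\<^sub>m n" "V * mat_adjoint V = 1\<^sub>m n"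
    using V by (auto simp: unitary_mat_def)
  have X: "gram1 Y = V * diag_of n (\<lambda>i. 1 + d i) * mat_adjoint V"
    using one_plus_smult_conj_unitary[OF V diag_of_carrier, of 1 d] one_plus_smult_diag_of[of n 1 d] Y
    by (simp add: gram1_def YV one_smult_complex_mat)
  have Xc: "gram1 Y \<in> carrier_mat n n" using Y by simp
  have dX: "det (gram1 Y) = complex_of_real (\<Prod>i<n. 1 + d i)"
    unfolding X by (simp add: det_mult_adjoint_unitary[OF V] det_diag_of)
  have p: "1 + d i \<noteq> 0" if "i < n" for i using d[OF that] by linarith
  then have "det (gram1 Y) \<noteq> 0" unfolding dX of_real_eq_0_iff by simp
  then have XQ: "gram1 Y * resolvent Y = 1\<^sub>m n" "resolvent Y * gram1 Y = 1\<^sub>m n" "resolvent Y \<in> carrier_mat n n"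
    unfolding resolvent_def using adj_mat[OF Xc] Xc
    by (auto simp: mult_smult_distrib[of _ n n _ n] mult_smult_assoc_mat[of _ n n _ n] smult_smult_assoc intro!: eq_matI)
  let ?Q = "V * diag_of n (\<lambda>i. inverse (1 + d i)) * mat_adjoint V"
  have "gram1 Y * ?Q = V * diag_of n (\<lambda>i. 1 + d i) * ((mat_adjoint V * V) * (diag_of n (\<lambda>i. inverse (1 + d i)) * mat_adjoint V))"
    unfolding X using Vc by (simp add: mat_assoc)
  also have "\<dots> = V * (diag_of n (\<lambda>i. 1 + d i) * diag_of n (\<lambda>i. inverse (1 + d i))) * mat_adjoint V"
    unfolding VV using Vc by (simp add: mat_assoc left_mult_one_mat[of _ n n])
  also have "\<dots> = 1\<^sub>m n"
    unfolding diag_of_mult using p Vc VV by (simp cong: diag_of_cong add: diag_of_one)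
  finally have XQ': "gram1 Y * ?Q = 1\<^sub>m n" .
  have "resolvent Y = resolvent Y * (gram1 Y * ?Q)" unfolding XQ' using XQ by simp
  also have "\<dots> = (resolvent Y * gram1 Y) * ?Q" using XQ(3) Xc Vc by (simp add: mat_assoc)
  also have "\<dots> = ?Q" unfolding XQ using Vc by (simp add: left_mult_one_mat[of _ n n] mat_assoc)
  finally have "resolvent Y = ?Q" .
  with V d X dX XQ that show ?thesis by blast
qed

lemma resolvent_carrier [simp]: "Y \<in> carrier_mat n N \<Longrightarrow> resolvent Y \<in> carrier_mat n n"
  unfolding resolvent_def using adj_mat(1)[OF gram1_carrier[of Y n N]] by simp

lemma resolvent_inverse:
  assumes "Y \<in> carrier_mat n N"
  shows "resolvent Y * gram1 Y = 1\<^sub>m n" "gram1 Y * resolvent Y = 1\<^sub>m n"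
  using gram1_spectral[OF assms] by blast+

lemma resolvent_psd:
  assumes Y: "Y \<in> carrier_mat n N"
  shows "hermitian_psd (resolvent Y)"
proof -
  obtain V d where V: "unitary_mat n V" and d: "\<And>i. i < n \<Longrightarrow> 0 \<le> d i"
    and Q: "resolvent Y = V * diag_of n (\<lambda>i. inverse (1 + d i)) * mat_adjoint V"
    using gram1_spectral[OF Y] by metis
  show ?thesis unfolding Q
    using hermitian_psd_of_spectral[of V n "\<lambda>i. inverse (1 + d i)"] V d
      by (simp add: unitary_mat_def)
qed

lemma resolvent_adjoint: "Y \<in> carrier_mat n N \<Longrightarrow> mat_adjoint (resolvent Y) = resolvent Y"
  using resolvent_psd by (auto simp: hermitian_psd_def)

lemma unitary_mat_entry_le_1:
  assumes V: "unitary_mat n V" and "a < n" "k < n"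
  shows "cmod (V $$ (a, k)) \<le> 1"
proof -
  have Vc: "V \<in> carrier_mat n n" using V by (simp add: unitary_mat_def)
  have "(V * mat_adjoint V) $$ (a, a) = (\<Sum>k<n. complex_of_real ((cmod (V $$ (a, k)))\<^sup>2))"
    using Vc assms
      by (auto simp: scalar_prod_def lessThan_atLeast0 complex_norm_square simp del: of_real_power intro!: sum.cong)
  also have "\<dots> = complex_of_real (\<Sum>k<n. (cmod (V $$ (a, k)))\<^sup>2)" by simp
  finally have "complex_of_real (\<Sum>k<n. (cmod (V $$ (a, k)))\<^sup>2) = 1"
    using V assms by (simp add: unitary_mat_def)
  then have "(\<Sum>k<n. (cmod (V $$ (a, k)))\<^sup>2) = 1" using of_real_eq_1_iff by blast
  moreover have "(cmod (V $$ (a, k)))\<^sup>2 \<le> (\<Sum>k<n. (cmod (V $$ (a, k)))\<^sup>2)"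
    using assms by (intro member_le_sum) auto
  ultimately have "(cmod (V $$ (a, k)))\<^sup>2 \<le> 1\<^sup>2" by simp
  then show ?thesis by (rule power2_le_imp_le) simp
qed

text \<open>The eigenvalues of the resolvent lie between 0 and 1 and the entries of a unitary matrix
  have modulus at most 1. Only uniformity in \<open>Y\<close> matters, for integrability, so the
  crude constant is enough.\<close>

lemma resolvent_entry_bound:
  assumes Y: "Y \<in> carrier_mat n N" and a: "a < n" and b: "b < n"
  shows "cmod (resolvent Y $$ (a, b)) \<le> real n"
proof -
  obtain V d where V: "unitary_mat n V" and d: "\<And>i. i < n \<Longrightarrow> 0 \<le> d i"
    and Q: "resolvent Y = V * diag_of n (\<lambda>i. inverse (1 + d i)) * mat_adjoint V"
    using gram1_spectral[OF Y] by metis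
  have Vc: "V \<in> carrier_mat n n" using V by (simp add: unitary_mat_def)
  have "cmod (resolvent Y $$ (a, b)) = cmod (\<Sum>k<n. V $$ (a, k) * complex_of_real (inverse (1 + d k)) * cnj (V $$ (b, k)))"
    unfolding Q diag_of_mult_right[OF Vc] using Vc a b by (simp add: scalar_prod_def lessThan_atLeast0)
  also have "\<dots> \<le> (\<Sum>k<n. 1)"
  proof (intro sum_norm_le)
    fix k assume "k \<in> {..<n}"
    then have k: "k < n" by simp
    have "\<bar>inverse (1 + d k)\<bar> \<le> 1" using d[OF k] by (simp add: field_simps abs_if)
    then show "cmod (V $$ (a, k) * complex_of_real (inverse (1 + d k)) * cnj (V $$ (b, k))) \<le> 1"
      using unitary_mat_entry_le_1[OF V a k] unitary_mat_entry_le_1[OF V b k]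
      unfolding norm_mult complex_mod_cnj norm_of_real by (intro mult_le_one) auto
  qed
  finally show ?thesis by simp
qed

text \<open>Both identities are free of division: the first expands
  \<open>Q\<^sub>0 = Q X Q\<^sub>0\<close>, and the second multiplies it by \<open>y\<close>, where
  the inner product collapses to a scalar.\<close>

lemma sherman_morrison:
  fixes X\<^sub>0 Q\<^sub>0 X Q y :: "complex mat"
  assumes c: "X\<^sub>0 \<in> carrier_mat n n" "Q\<^sub>0 \<in> carrier_mat n n" "X \<in> carrier_mat n n" "Q \<in> carrier_mat n n"
    and y: "y \<in> carrier_mat n 1"
    and X: "X = X\<^sub>0 + y * mat_adjoint y" and inv: "X\<^sub>0 * Q\<^sub>0 = 1\<^sub>m n" "Q * X = 1\<^sub>m n"
  shows "Q\<^sub>0 = Q + (Q * y) * (mat_adjoint y * Q\<^sub>0)"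
    and "Q\<^sub>0 * y = (1 + (mat_adjoint y * Q\<^sub>0 * y) $$ (0, 0)) \<cdot>\<^sub>m (Q * y)"
proof -
  have "Q\<^sub>0 = (Q * X) * Q\<^sub>0" unfolding inv using c by simp
  also have "\<dots> = Q * (X\<^sub>0 * Q\<^sub>0) + (Q * y) * (mat_adjoint y * Q\<^sub>0)"
    unfolding X using c y
    by (simp add: mat_distrib mat_assoc)
  finally show 1: "Q\<^sub>0 = Q + (Q * y) * (mat_adjoint y * Q\<^sub>0)" unfolding inv using c by simp
  have "Q\<^sub>0 * y = (Q + (Q * y) * (mat_adjoint y * Q\<^sub>0)) * y" using 1 by simp
  also have "\<dots> = Q * y + (Q * y) * (mat_adjoint y * Q\<^sub>0 * y)" using c y
    by (simp add: mat_distrib mat_assoc)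
  also have "\<dots> = (1 + (mat_adjoint y * Q\<^sub>0 * y) $$ (0, 0)) \<cdot>\<^sub>m (Q * y)"
    using c y by (subst mult_mat_1_1[of _ n]) (auto intro!: eq_matI simp: algebra_simps)
  finally show "Q\<^sub>0 * y = (1 + (mat_adjoint y * Q\<^sub>0 * y) $$ (0, 0)) \<cdot>\<^sub>m (Q * y)" .
qed

text \<open>With \<open>Q\<close> the resolvent of \<open>C S\<close>, cyclicity gives
  \<open>tr(C^H Q C) = tr(Q C C^H)\<close>, and sandwiching between \<open>S^H\<close> and
  \<open>S\<close> gives \<open>tr(W Q)\<close>. Its indices are those of the rows of
  \<open>S\<close>, so that it can be differentiated entry by entry in \<open>S\<close>.\<close>

definition compressed_resolvent :: "complex mat \<Rightarrow> complex mat \<Rightarrow> complex mat" where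
  "compressed_resolvent C S = mat_adjoint C * resolvent (C * S) * C"

lemma compressed_resolvent_carrier [simp]:
  assumes "C \<in> carrier_mat n m" "S \<in> carrier_mat m N"
  shows "compressed_resolvent C S \<in> carrier_mat m m"
  using assms resolvent_carrier[of "C * S" n N] by (auto simp: compressed_resolvent_def)

lemma compressed_resolvent_adjoint:
  assumes "C \<in> carrier_mat n m" "S \<in> carrier_mat m N"
  shows "mat_adjoint (compressed_resolvent C S) = compressed_resolvent C S"
  using assms resolvent_carrier[of "C * S" n N] resolvent_adjoint[of "C * S" n N]
  by (simp add: compressed_resolvent_def mat_adjoint_mult mat_assoc)

lemma mat_vec_assoc:
  fixes A B :: "complex mat"
  assumes "dim_col A = dim_row B" "dim_vec v = dim_col B"
  shows "A * B *\<^sub>v v = A *\<^sub>v (B *\<^sub>v v)"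
  using assms
  by (intro assoc_mult_mat_vec[of _ "dim_row A" "dim_col A" _ "dim_col B"]) (auto intro: carrier_vecI)

lemma hermitian_psd_cong:
  assumes Q: "Q \<in> carrier_mat n n" "hermitian_psd Q" and C: "C \<in> carrier_mat n m"
  shows "hermitian_psd (mat_adjoint C * Q * C)"
proof -
  have hQ: "mat_adjoint Q = Q" using Q by (simp add: hermitian_psd_def)
  have "0 \<le> Re (((mat_adjoint C * Q * C) *\<^sub>v v) \<bullet>c v)" if v: "v \<in> carrier_vec m" for v
  proof -
    have Cv: "C *\<^sub>v v \<in> carrier_vec n" using C v by (auto intro!: mult_mat_vec_carrier)
    have QCv: "Q *\<^sub>v (C *\<^sub>v v) \<in> carrier_vec n"
      using Q Cv by (auto intro!: mult_mat_vec_carrier)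
    have "(mat_adjoint C * Q * C) *\<^sub>v v = mat_adjoint C *\<^sub>v (Q *\<^sub>v (C *\<^sub>v v))"
      using C Q v by (simp add: mat_vec_assoc)
    then have "((mat_adjoint C * Q * C) *\<^sub>v v) \<bullet>c v = (Q *\<^sub>v (C *\<^sub>v v)) \<bullet>c (C *\<^sub>v v)"
      using scalar_prod_mat_adjoint[OF mat_adjoint_carrier[OF C] QCv v] by simp
    then show ?thesis using Q Cv by (auto simp: hermitian_psd_def)
  qed
  then show ?thesis using C Q hQ by (auto simp: hermitian_psd_def mat_adjoint_mult mat_assoc)
qed

lemma compressed_resolvent_psd:
  assumes "C \<in> carrier_mat n m" "S \<in> carrier_mat m N"
  shows "hermitian_psd (compressed_resolvent C S)"
  unfolding compressed_resolvent_def using assms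
  by (intro hermitian_psd_cong[of _ n] resolvent_carrier[of _ n N] resolvent_psd) auto

section \<open>Splitting off one column and the dependence on a single entry\<close>

definition col_mat :: "complex mat \<Rightarrow> nat \<Rightarrow> complex mat" where
  "col_mat S j = mat (dim_row S) 1 (\<lambda>(k, _). S $$ (k, j))"

text \<open>The column is zeroed instead of deleted, so the dimensions of \<open>S\<close> and the
  column indices stay the same.\<close>

definition zero_col :: "complex mat \<Rightarrow> nat \<Rightarrow> complex mat" where
  "zero_col S j = mat (dim_row S) (dim_col S) (\<lambda>(k, l). if l = j then 0 else S $$ (k, l))"

lemma gram_split_col:
  assumes S: "S \<in> carrier_mat m N" and j: "j < N"
  shows "S * mat_adjoint S = zero_col S j * mat_adjoint (zero_col S j) + col_mat S j * mat_adjoint (col_mat S j)"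
proof (rule eq_matI)
  fix a b assume "a < dim_row (zero_col S j * mat_adjoint (zero_col S j) + col_mat S j * mat_adjoint (col_mat S j))"
    "b < dim_col (zero_col S j * mat_adjoint (zero_col S j) + col_mat S j * mat_adjoint (col_mat S j))"
  then have ab: "a < m" "b < m" using S by (auto simp: col_mat_def)
  have "(S * mat_adjoint S) $$ (a, b) = (\<Sum>l<N. S $$ (a, l) * cnj (S $$ (b, l)))"
    using S ab by (simp add: scalar_prod_def lessThan_atLeast0)
  also have "\<dots> = S $$ (a, j) * cnj (S $$ (b, j)) + (\<Sum>l\<in>{..<N} - {j}. S $$ (a, l) * cnj (S $$ (b, l)))"
    using j by (subst sum.remove[of _ j]) auto
  also have "(\<Sum>l\<in>{..<N} - {j}. S $$ (a, l) * cnj (S $$ (b, l)))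
      = (\<Sum>l<N. (if l = j then 0 else S $$ (a, l)) * cnj (if l = j then 0 else S $$ (b, l)))"
    by (intro sum.mono_neutral_cong_left) auto
  finally show "(S * mat_adjoint S) $$ (a, b) = (zero_col S j * mat_adjoint (zero_col S j) + col_mat S j * mat_adjoint (col_mat S j)) $$ (a, b)"
    using S ab by (simp add: zero_col_def col_mat_def scalar_prod_def lessThan_atLeast0)
qed (use S in \<open>auto simp: col_mat_def\<close>)

text \<open>Removing column \<open>j\<close> changes the Gram matrix of \<open>C S\<close> by the
  rank-one term of \<open>y = C s\<close>; the update formula conjugated by \<open>C\<close> gives
  both claims. Since \<open>G\<close> does not see column \<open>j\<close>, the dependence of
  \<open>E\<close> on that column becomes explicit.\<close>

lemma compressed_resolvent_remove_col:
  assumes C: "C \<in> carrier_mat n m" and S: "S \<in> carrier_mat m N" and j: "j < N"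
  defines "E \<equiv> compressed_resolvent C S" and "G \<equiv> compressed_resolvent C (zero_col S j)" and "s \<equiv> col_mat S j"
  defines "q \<equiv> (mat_adjoint s * G * s) $$ (0, 0)"
  shows "G = E + (E * s) * (mat_adjoint s * G)" "G * s = (1 + q) \<cdot>\<^sub>m (E * s)"
proof -
  let ?SZ = "zero_col S j"
  let ?y = "C * s"
  have S0: "?SZ \<in> carrier_mat m N" and s: "s \<in> carrier_mat m 1"
    using S by (auto simp: zero_col_def s_def col_mat_def)
  have Y: "C * S \<in> carrier_mat n N" "C * ?SZ \<in> carrier_mat n N" using C S S0 by auto
  let ?Q = "resolvent (C * S)" and ?QZ = "resolvent (C * ?SZ)"
  note Qc = resolvent_carrier[OF Y(1)] resolvent_carrier[OF Y(2)]
  have "(C * S) * mat_adjoint (C * S) = C * (S * mat_adjoint S) * mat_adjoint C"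
    using C S by (simp add: mat_adjoint_mult mat_assoc)
  also have "\<dots> = (C * ?SZ) * mat_adjoint (C * ?SZ) + ?y * mat_adjoint ?y"
    unfolding gram_split_col[OF S j] s_def[symmetric] using C S0 s
    by (simp add: mat_distrib mat_adjoint_mult mat_assoc)
  finally have X: "gram1 (C * S) = gram1 (C * ?SZ) + ?y * mat_adjoint ?y"
    using C S S0 s unfolding gram1_def by (intro eq_matI) auto
  have y: "?y \<in> carrier_mat n 1" using C s by simp
  note sm = sherman_morrison[OF gram1_carrier[OF Y(2)] Qc(2) gram1_carrier[OF Y(1)] Qc(1) y X
      resolvent_inverse(2)[OF Y(2)] resolvent_inverse(1)[OF Y(1)]]
  have q: "(mat_adjoint ?y * ?QZ * ?y) $$ (0, 0) = q"
    unfolding q_def G_def compressed_resolvent_def using C s Qc by (simp add: mat_adjoint_mult mat_assoc)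
  have "G = mat_adjoint C * (?Q + (?Q * ?y) * (mat_adjoint ?y * ?QZ)) * C"
    unfolding G_def compressed_resolvent_def
      by (rule arg_cong[OF sm(1), of "\<lambda>M. mat_adjoint C * M * C"])
  also have "\<dots> = E + (E * s) * (mat_adjoint s * G)"
    unfolding G_def E_def compressed_resolvent_def using C s Qc
    by (simp add: mat_distrib mat_adjoint_mult mat_assoc)
  finally show "G = E + (E * s) * (mat_adjoint s * G)" .
  have "G * s = mat_adjoint C * (?QZ * ?y)"
    unfolding G_def compressed_resolvent_def using C s Qc by (simp add: mat_assoc)
  also have "\<dots> = (1 + q) \<cdot>\<^sub>m (mat_adjoint C * (?Q * ?y))"
    unfolding sm(2) q using C s Qc by (intro mult_smult_distrib[of _ m n _ 1]) auto
  also have "mat_adjoint C * (?Q * ?y) = E * s"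
    unfolding E_def compressed_resolvent_def using C s Qc by (simp add: mat_assoc)
  finally show "G * s = (1 + q) \<cdot>\<^sub>m (E * s)" .
qed

text \<open>A semidefinite 1 by 1 matrix is its own eigenvalue. This is what makes
  \<open>1 + q\<close> real and at least 1 in the rank-one formulas.\<close>

lemma quadratic_form_nonneg:
  assumes G: "G \<in> carrier_mat m m" "hermitian_psd G" and s: "s \<in> carrier_mat m 1"
  shows "\<exists>q \<ge> 0. (mat_adjoint s * G * s) $$ (0, 0) = complex_of_real q"
proof -
  have p: "hermitian_psd (mat_adjoint s * G * s)" by (rule hermitian_psd_cong[OF G s])
  let ?M = "mat_adjoint s * G * s"
  have M: "?M \<in> carrier_mat 1 1" using s G by auto
  obtain V d where V: "unitary_mat 1 V" and eq: "?M = V * diag_of 1 d * mat_adjoint V" and d: "\<And>i. i < 1 \<Longrightarrow> 0 \<le> d i"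
    using hermitian_psd_spectral[OF M p] by blast
  have "det ?M = complex_of_real (d 0)"
    unfolding eq by (simp add: det_mult_adjoint_unitary[OF V] det_diag_of)
  moreover have "det ?M = ?M $$ (0, 0)" using M by (simp add: det_single)
  ultimately show ?thesis using d[of 0] by auto
qed


definition upd_entry :: "complex mat \<Rightarrow> nat \<Rightarrow> nat \<Rightarrow> complex \<Rightarrow> complex mat" where
  "upd_entry S i j z = mat (dim_row S) (dim_col S) (\<lambda>(k, l). if k = i \<and> l = j then z else S $$ (k, l))"

text \<open>
  With \<open>E\<close> the compressed resolvent, \<open>E\<^sub>i\<^sub>i (1 - (S\<^sup>H E S)\<^sub>j\<^sub>j)\<close> is the Wirtinger derivative of
  \<open>(E S)\<^sub>i\<^sub>j\<close> with respect to \<open>S\<^sub>i\<^sub>j\<close>, so Stein's identity says that \<open>stein_fn\<close> has mean zero.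
\<close>

definition stein_fn :: "real \<Rightarrow> complex mat \<Rightarrow> nat \<Rightarrow> nat \<Rightarrow> complex mat \<Rightarrow> real" where
  "stein_fn v C i j S =
    (let E = compressed_resolvent C S in
      Re (cnj (S $$ (i, j)) * (E * S) $$ (i, j))
      - v * (Re (E $$ (i, i)) * (1 - Re ((mat_adjoint S * E * S) $$ (j, j)))))"

text \<open>With \<open>g = (G s)_i\<close> the update formulas give
  \<open>(E S)_ij = g / (1 + q)\<close>, \<open>E_ii = G_ii - |g|^2 / (1 + q)\<close> and
  \<open>1 - (S^H E S)_jj = 1 / (1 + q)\<close>. Their combination has the shape of the scalar Stein
  identity with denominator \<open>1 + q\<close>.\<close>

lemma stein_fn_col:
  fixes C S :: "complex mat" and j :: nat
  assumes C: "C \<in> carrier_mat n m" and S: "S \<in> carrier_mat m N" and i: "i < m" and j: "j < N"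
  defines "G \<equiv> compressed_resolvent C (zero_col S j)" and "s \<equiv> col_mat S j"
  assumes q: "(mat_adjoint s * G * s) $$ (0, 0) = complex_of_real q" "0 \<le> q"
  shows "stein_fn v C i j S = Re (cnj (S $$ (i, j)) * (G * s) $$ (i, 0)) / (1 + q)
    - v * (Re (G $$ (i, i)) / (1 + q) - (cmod ((G * s) $$ (i, 0)))\<^sup>2 / (1 + q)\<^sup>2)"
proof -
  define E where "E = compressed_resolvent C S"
  have SZ: "zero_col S j \<in> carrier_mat m N" and s: "s \<in> carrier_mat m 1"
    using S by (auto simp: zero_col_def s_def col_mat_def)
  have E: "E \<in> carrier_mat m m" and G: "G \<in> carrier_mat m m"
    using C S SZ by (auto simp: E_def G_def)
  have hG: "mat_adjoint G = G" unfolding G_def using compressed_resolvent_adjoint[OF C SZ] .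
  note rm = compressed_resolvent_remove_col[OF C S j, folded E_def G_def s_def, unfolded q]
  define g where "g = (G * s) $$ (i, 0)"
  have q1: "1 + q > 0" using q by simp
  have q1c: "1 + complex_of_real q \<noteq> 0"
    using q1 by (metis of_real_1 of_real_add of_real_eq_0_iff less_irrefl)
  have Es: "(G * s) $$ (k, 0) = (1 + complex_of_real q) * (E * s) $$ (k, 0)" if "k < m" for k
    using arg_cong[OF rm(2), of "\<lambda>M. M $$ (k, 0)"] that E s by simp
  have Esi: "(E * s) $$ (i, 0) = g / (1 + q)" using Es[OF i] q1c by (simp add: g_def)
  have ES: "(E * S) $$ (i, j) = (E * s) $$ (i, 0)"
    using E S s i j by (simp add: s_def col_mat_def scalar_prod_def)
  have sG: "(mat_adjoint s * G) $$ (0, i) = cnj g"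
  proof -
    have "mat_adjoint s * G = mat_adjoint (G * s)" using s G hG by (simp add: mat_adjoint_mult)
    then show ?thesis using s G i by (simp add: g_def)
  qed
  have Eii: "E $$ (i, i) = G $$ (i, i) - complex_of_real ((cmod g)\<^sup>2 / (1 + q))"
  proof -
    have "G $$ (i, i) = E $$ (i, i) + ((E * s) * (mat_adjoint s * G)) $$ (i, i)"
      using arg_cong[OF rm(1), of "\<lambda>M. M $$ (i, i)"] i E s G by simp
    also have "((E * s) * (mat_adjoint s * G)) $$ (i, i) = (E * s) $$ (i, 0) * (mat_adjoint s * G) $$ (0, i)"
      using i E s G
        by (simp add: scalar_prod_def[of "row (E * s) i"] del: index_mult_mat(1)) (simp add: scalar_prod_def[of _ "col (mat_adjoint s * G) i"])
    also have "\<dots> = complex_of_real ((cmod g)\<^sup>2 / (1 + q))"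
      unfolding Esi sG using complex_norm_square[of g] by simp
    finally show ?thesis by simp
  qed
  have SES: "(mat_adjoint S * E * S) $$ (j, j) = complex_of_real (q / (1 + q))"
  proof -
    have "(mat_adjoint S * E * S) $$ (j, j) = (mat_adjoint S * (E * S)) $$ (j, j)"
      using E S by (simp add: mat_assoc)
    also have "\<dots> = (\<Sum>k<m. cnj (S $$ (k, j)) * (E * S) $$ (k, j))"
      using E S j
        by (simp add: scalar_prod_def lessThan_atLeast0 del: index_mult_mat(1)) (simp add: scalar_prod_def lessThan_atLeast0)
    also have "\<dots> = (\<Sum>k<m. cnj (s $$ (k, 0)) * ((G * s) $$ (k, 0) / (1 + q)))"
    proof (intro sum.cong refl)
      fix k assume "k \<in> {..<m}"
      then have k: "k < m" by simp
      have "(E * S) $$ (k, j) = (E * s) $$ (k, 0)"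
        using E S s k j by (simp add: s_def col_mat_def scalar_prod_def)
      then show "cnj (S $$ (k, j)) * (E * S) $$ (k, j) = cnj (s $$ (k, 0)) * ((G * s) $$ (k, 0) / (1 + q))"
        using Es[OF k] q1c S k by (simp add: s_def col_mat_def)
    qed
    also have "\<dots> = (mat_adjoint s * (G * s)) $$ (0, 0) / (1 + q)"
    proof -
      have "(mat_adjoint s * (G * s)) $$ (0, 0) = (\<Sum>k<m. cnj (s $$ (k, 0)) * (G * s) $$ (k, 0))"
        using G s by (simp add: scalar_prod_def lessThan_atLeast0)
      then show ?thesis by (simp add: sum_divide_distrib del: index_mult_mat(1))
    qed
    also have "mat_adjoint s * (G * s) = mat_adjoint s * G * s" using G s by (simp add: mat_assoc)
    finally show ?thesis using q by simp
  qed
  have r: "1 - q / (1 + q) = 1 / (1 + q)" using q1 by (simp add: field_simps)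
  have t: "Re (x * (g / (1 + complex_of_real q))) = Re (x * g) / (1 + q)" for x
    using Re_divide_of_real[of "x * g" "1 + q"] by simp
  have u: "(Re (G $$ (i, i)) - (cmod g)\<^sup>2 / (1 + q)) * (1 / (1 + q))
      = Re (G $$ (i, i)) / (1 + q) - (cmod g)\<^sup>2 / (1 + q)\<^sup>2"
    by (simp add: left_diff_distrib diff_divide_distrib power2_eq_square)
  show ?thesis unfolding stein_fn_def E_def[symmetric] Let_def ES Esi Eii SES g_def[symmetric]
    minus_complex.sel Re_complex_of_real r t u by simp
qed

text \<open>
  By the rank-one update formula, the entry \<open>z = S\<^sub>i\<^sub>j\<close> enters only through a nonnegative
  quadratic polynomial, which is the situation of \<open>stein_circular_gaussian\<close>.
\<close>

lemma stein_fn_upd_entry: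
  assumes C: "C \<in> carrier_mat n m" and S: "S \<in> carrier_mat m N" and i: "i < m" and j: "j < N"
  obtains a b c where "\<And>z. 0 \<le> a + 2 * Re (cnj z * b) + c * (cmod z)\<^sup>2"
    "\<And>z. stein_fn v C i j (upd_entry S i j z) =
      Re (cnj z * (b + complex_of_real c * z)) / (1 + (a + 2 * Re (cnj z * b) + c * (cmod z)\<^sup>2))
      - v * (c / (1 + (a + 2 * Re (cnj z * b) + c * (cmod z)\<^sup>2))
        - (cmod (b + complex_of_real c * z))\<^sup>2 / (1 + (a + 2 * Re (cnj z * b) + c * (cmod z)\<^sup>2))\<^sup>2)"
proof -
  define G where "G = compressed_resolvent C (zero_col S j)"
  have SZ: "zero_col S j \<in> carrier_mat m N" using S by (auto simp: zero_col_def)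
  have G: "G \<in> carrier_mat m m" using C SZ by (simp add: G_def)
  have pG: "hermitian_psd G" unfolding G_def by (rule compressed_resolvent_psd[OF C SZ])
  have hG: "G $$ (k, l) = cnj (G $$ (l, k))" if "k < m" "l < m" for k l
  proof -
    have "mat_adjoint G $$ (k, l) = G $$ (k, l)" using pG by (simp add: hermitian_psd_def)
    then show ?thesis using that G by simp
  qed
  \<comment> \<open>Index \<open>i\<close> is singled out in the quadratic form
    \<open>s^H G s\<close>, whose entry \<open>i\<close> of \<open>s\<close> is \<open>z\<close>:
    \<open>c\<close> multiplies \<open>|z|^2\<close>, \<open>b\<close> collects the cross terms of
    row \<open>i\<close>, and \<open>a\<close> is the form on the other indices.\<close>
  define T where "T = {..<m} - {i}"
  define b where "b = (\<Sum>l\<in>T. G $$ (i, l) * S $$ (l, j))"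
  define c where "c = Re (G $$ (i, i))"
  define a where "a = Re (\<Sum>k\<in>T. cnj (S $$ (k, j)) * (\<Sum>l\<in>T. G $$ (k, l) * S $$ (l, j)))"
  have Gii: "G $$ (i, i) = complex_of_real c" using hG[OF i i] by (simp add: c_def complex_eq_iff)
  define s where "s z = col_mat (upd_entry S i j z) j" for z
  have s: "s z \<in> carrier_mat m 1" for z using S by (simp add: s_def col_mat_def upd_entry_def)
  have Gs: "(G * s z) $$ (k, 0) = G $$ (k, i) * z + (\<Sum>l\<in>T. G $$ (k, l) * S $$ (l, j))" if k: "k < m" for k z
  proof -
    have "(G * s z) $$ (k, 0) = (\<Sum>l<m. G $$ (k, l) * (if l = i then z else S $$ (l, j)))"
      using G S k j by (simp add: scalar_prod_def lessThan_atLeast0 s_def col_mat_def upd_entry_def)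
    also have "\<dots> = G $$ (k, i) * z + (\<Sum>l\<in>T. G $$ (k, l) * (if l = i then z else S $$ (l, j)))"
      unfolding T_def using i by (subst sum.remove[of _ i]) auto
    also have "(\<Sum>l\<in>T. G $$ (k, l) * (if l = i then z else S $$ (l, j))) = (\<Sum>l\<in>T. G $$ (k, l) * S $$ (l, j))"
      by (intro sum.cong) (auto simp: T_def)
    finally show ?thesis .
  qed
  have Gsi: "(G * s z) $$ (i, 0) = b + complex_of_real c * z" for z
    unfolding Gs[OF i] b_def Gii by simp
  have cb: "(\<Sum>k\<in>T. cnj (S $$ (k, j)) * G $$ (k, i)) = cnj b"
    unfolding b_def cnj_sum using i by (intro sum.cong) (auto simp: T_def hG[of _ i] mult.commute)
  have qz: "Re ((mat_adjoint (s z) * G * s z) $$ (0, 0)) = a + 2 * Re (cnj z * b) + c * (cmod z)\<^sup>2" for z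
  proof -
    have "(mat_adjoint (s z) * G * s z) $$ (0, 0) = (mat_adjoint (s z) * (G * s z)) $$ (0, 0)"
      using G s[of z] by (simp add: mat_assoc)
    also have "\<dots> = (\<Sum>k<m. cnj (s z $$ (k, 0)) * (G * s z) $$ (k, 0))"
      using G s[of z] by (simp add: scalar_prod_def lessThan_atLeast0)
    also have "\<dots> = cnj z * (b + complex_of_real c * z) + (\<Sum>k\<in>T. cnj (s z $$ (k, 0)) * (G * s z) $$ (k, 0))"
      unfolding T_def Gsi[symmetric] using i S j
      by (subst sum.remove[of _ i]) (auto simp: s_def col_mat_def upd_entry_def)
    also have "(\<Sum>k\<in>T. cnj (s z $$ (k, 0)) * (G * s z) $$ (k, 0))
        = (\<Sum>k\<in>T. cnj (S $$ (k, j)) * (G $$ (k, i) * z + (\<Sum>l\<in>T. G $$ (k, l) * S $$ (l, j))))"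
    proof (intro sum.cong refl)
      fix k assume "k \<in> T"
      then have k: "k < m" "k \<noteq> i" by (auto simp: T_def)
      have "s z $$ (k, 0) = S $$ (k, j)" using S j k by (simp add: s_def col_mat_def upd_entry_def)
      then show "cnj (s z $$ (k, 0)) * (G * s z) $$ (k, 0)
          = cnj (S $$ (k, j)) * (G $$ (k, i) * z + (\<Sum>l\<in>T. G $$ (k, l) * S $$ (l, j)))"
        unfolding Gs[OF k(1)] by simp
    qed
    also have "\<dots> = cnj b * z + (\<Sum>k\<in>T. cnj (S $$ (k, j)) * (\<Sum>l\<in>T. G $$ (k, l) * S $$ (l, j)))"
      unfolding cb[symmetric] by (simp add: distrib_left sum.distrib sum_distrib_right mult.assoc)
    finally show ?thesis
      unfolding a_def cmod_power2 by (simp add: power2_eq_square algebra_simps del: index_mult_mat(1))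
  qed
  have q: "(mat_adjoint (s z) * G * s z) $$ (0, 0) = complex_of_real (a + 2 * Re (cnj z * b) + c * (cmod z)\<^sup>2)"
    "0 \<le> a + 2 * Re (cnj z * b) + c * (cmod z)\<^sup>2" for z
    using quadratic_form_nonneg[OF G pG s[of z]] qz[of z] by (auto simp del: index_mult_mat(1))
  show ?thesis
  proof (rule that[of a b c])
    show "0 \<le> a + 2 * Re (cnj z * b) + c * (cmod z)\<^sup>2" for z by (rule q)
    fix z
    have U: "upd_entry S i j z \<in> carrier_mat m N" using S by (simp add: upd_entry_def)
    \<comment> \<open>Zeroing column \<open>j\<close> erases \<open>z\<close>, so \<open>G\<close>
      is the same for all values of the entry.\<close>
    have zc: "zero_col (upd_entry S i j z) j = zero_col S j"
      using S by (intro eq_matI) (auto simp: zero_col_def upd_entry_def)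
    have Uij: "upd_entry S i j z $$ (i, j) = z" using S i j by (simp add: upd_entry_def)
    show "stein_fn v C i j (upd_entry S i j z) =
      Re (cnj z * (b + complex_of_real c * z)) / (1 + (a + 2 * Re (cnj z * b) + c * (cmod z)\<^sup>2))
      - v * (c / (1 + (a + 2 * Re (cnj z * b) + c * (cmod z)\<^sup>2))
        - (cmod (b + complex_of_real c * z))\<^sup>2 / (1 + (a + 2 * Re (cnj z * b) + c * (cmod z)\<^sup>2))\<^sup>2)"
      using stein_fn_col[OF C U i j, unfolded zc, folded G_def s_def, OF q] unfolding Uij Gsi Gii by simp
  qed
qed

section \<open>Measurability and integrability\<close>

text \<open>Matrices of all sizes share one type, so measurability is taken entrywise together with
  fixed dimensions.\<close>

definition mat_measurable :: "'a measure \<Rightarrow> nat \<Rightarrow> nat \<Rightarrow> ('a \<Rightarrow> complex mat) \<Rightarrow> bool" where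
  "mat_measurable M n m F \<longleftrightarrow> (\<forall>x \<in> space M. F x \<in> carrier_mat n m) \<and>
     (\<forall>i < n. \<forall>j < m. (\<lambda>x. F x $$ (i, j)) \<in> borel_measurable M)"

lemma mat_measurableI:
  assumes "\<And>x. x \<in> space M \<Longrightarrow> F x \<in> carrier_mat n m"
    and "\<And>i j. i < n \<Longrightarrow> j < m \<Longrightarrow> (\<lambda>x. F x $$ (i, j)) \<in> borel_measurable M"
  shows "mat_measurable M n m F"
  using assms by (simp add: mat_measurable_def)

lemma mat_measurable_carrier: "mat_measurable M n m F \<Longrightarrow> x \<in> space M \<Longrightarrow> F x \<in> carrier_mat n m"
  by (simp add: mat_measurable_def)

lemma mat_measurable_entry:
  "mat_measurable M n m F \<Longrightarrow> i < n \<Longrightarrow> j < m \<Longrightarrow> (\<lambda>x. F x $$ (i, j)) \<in> borel_measurable M"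
  by (simp add: mat_measurable_def)

lemma mat_measurable_const: "A \<in> carrier_mat n m \<Longrightarrow> mat_measurable M n m (\<lambda>_. A)"
  by (simp add: mat_measurable_def)

lemma mat_measurable_entrywise:
  assumes F: "\<And>x. x \<in> space M \<Longrightarrow> F x \<in> carrier_mat n m"
    and eq: "\<And>x i j. x \<in> space M \<Longrightarrow> i < n \<Longrightarrow> j < m \<Longrightarrow> F x $$ (i, j) = f i j x"
    and meas: "\<And>i j. i < n \<Longrightarrow> j < m \<Longrightarrow> f i j \<in> borel_measurable M"
  shows "mat_measurable M n m F"
proof (rule mat_measurableI[OF F])
  fix i j assume "i < n" "j < m"
  then show "(\<lambda>x. F x $$ (i, j)) \<in> borel_measurable M"
    using measurable_cong[of M "\<lambda>x. F x $$ (i, j)" "f i j" borel] eq meas by simp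
qed

lemma mat_measurable_mult:
  assumes F: "mat_measurable M n m F" and G: "mat_measurable M m k G"
  shows "mat_measurable M n k (\<lambda>x. F x * G x)"
proof (rule mat_measurable_entrywise[where f="\<lambda>i j x. \<Sum>l<m. F x $$ (i, l) * G x $$ (l, j)"])
  fix x i j assume x: "x \<in> space M" and "i < n" "j < k"
  then show "(F x * G x) $$ (i, j) = (\<Sum>l<m. F x $$ (i, l) * G x $$ (l, j))"
    using mat_measurable_carrier[OF F x] mat_measurable_carrier[OF G x]
    by (simp add: scalar_prod_def lessThan_atLeast0)
qed (use mat_measurable_carrier[OF F] mat_measurable_carrier[OF G] mat_measurable_entry[OF F] mat_measurable_entry[OF G]
    in \<open>auto intro!: borel_measurable_sum borel_measurable_times mult_carrier_mat\<close>)

lemma mat_measurable_add: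
  assumes F: "mat_measurable M n m F" and G: "mat_measurable M n m G"
  shows "mat_measurable M n m (\<lambda>x. F x + G x)"
proof (rule mat_measurable_entrywise[where f="\<lambda>i j x. F x $$ (i, j) + G x $$ (i, j)"])
  fix x i j assume x: "x \<in> space M" and "i < n" "j < m"
  then show "(F x + G x) $$ (i, j) = F x $$ (i, j) + G x $$ (i, j)"
    using mat_measurable_carrier[OF F x] mat_measurable_carrier[OF G x] by simp
qed (use mat_measurable_carrier[OF F] mat_measurable_carrier[OF G] mat_measurable_entry[OF F] mat_measurable_entry[OF G]
    in \<open>auto intro!: borel_measurable_add\<close>)

lemma mat_measurable_adjoint:
  assumes F: "mat_measurable M n m F"
  shows "mat_measurable M m n (\<lambda>x. mat_adjoint (F x))"
proof (rule mat_measurable_entrywise[where f="\<lambda>i j x. cnj (F x $$ (j, i))"])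
  fix x i j assume x: "x \<in> space M" and "i < m" "j < n"
  then show "mat_adjoint (F x) $$ (i, j) = cnj (F x $$ (j, i))"
    using mat_measurable_carrier[OF F x] by simp
next
  fix i j assume "i < m" "j < n"
  note [measurable] = mat_measurable_entry[OF F this(2,1)]
  have "cnj \<in> borel_measurable borel" by (intro borel_measurable_continuous_onI continuous_intros)
  then show "(\<lambda>x. cnj (F x $$ (j, i))) \<in> borel_measurable M" by measurable
qed (use mat_measurable_carrier[OF F] in auto)

text \<open>By the Leibniz formula the determinant is a polynomial in the entries.\<close>

lemma borel_measurable_det:
  assumes F: "mat_measurable M n n F"
  shows "(\<lambda>x. det (F x)) \<in> borel_measurable M"
proof -
  have "(\<lambda>x. \<Sum>p | p permutes {0..<n}. signof p * (\<Prod>i = 0..<n. F x $$ (i, p i))) \<in> borel_measurable M"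
  proof (intro borel_measurable_sum borel_measurable_times borel_measurable_prod)
    fix p i assume "p \<in> {p. p permutes {0..<n}}" "i \<in> {0..<n}"
    then have "i < n" "p i < n" using permutes_in_image[of p "{0..<n}" i] by auto
    then show "(\<lambda>x. F x $$ (i, p i)) \<in> borel_measurable M"
      by (rule mat_measurable_entry[OF F])
  qed simp
  then show ?thesis
    using measurable_cong[of M "\<lambda>x. det (F x)" "\<lambda>x. \<Sum>p | p permutes {0..<n}. signof p * (\<Prod>i = 0..<n. F x $$ (i, p i))" borel]
      det_def'[OF mat_measurable_carrier[OF F]] by simp
qed

lemma mat_measurable_adj_mat:
  assumes F: "mat_measurable M n n F"
  shows "mat_measurable M n n (\<lambda>x. adj_mat (F x))"
proof (rule mat_measurable_entrywise[where f="\<lambda>i j x. (-1) ^ (j + i) * det (mat_delete (F x) j i)"])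
  fix x i j assume x: "x \<in> space M" and "i < n" "j < n"
  then show "adj_mat (F x) $$ (i, j) = (-1) ^ (j + i) * det (mat_delete (F x) j i)"
    using mat_measurable_carrier[OF F x] by (simp add: adj_mat_def cofactor_def)
next
  fix i j assume ij: "i < n" "j < n"
  have "mat_measurable M (n - 1) (n - 1) (\<lambda>x. mat_delete (F x) j i)"
  proof (rule mat_measurable_entrywise[where f="\<lambda>k l x. F x $$ (if k < j then k else Suc k, if l < i then l else Suc l)"])
    show "x \<in> space M \<Longrightarrow> mat_delete (F x) j i \<in> carrier_mat (n - 1) (n - 1)" for x
      using mat_measurable_carrier[OF F, of x] by (auto simp: mat_delete_def)
    show "x \<in> space M \<Longrightarrow> k < n - 1 \<Longrightarrow> l < n - 1 \<Longrightarrow>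
        mat_delete (F x) j i $$ (k, l) = F x $$ (if k < j then k else Suc k, if l < i then l else Suc l)" for x k l
      using mat_measurable_carrier[OF F, of x] by (auto simp: mat_delete_def)
    show "k < n - 1 \<Longrightarrow> l < n - 1 \<Longrightarrow>
        (\<lambda>x. F x $$ (if k < j then k else Suc k, if l < i then l else Suc l)) \<in> borel_measurable M" for k l
      by (rule mat_measurable_entry[OF F]) auto
  qed
  then show "(\<lambda>x. (-1) ^ (j + i) * det (mat_delete (F x) j i)) \<in> borel_measurable M"
    by (intro borel_measurable_times borel_measurable_det) auto
qed (use adj_mat(1)[OF mat_measurable_carrier[OF F]] in auto)

lemma mat_measurable_gram1:
  assumes F: "mat_measurable M n N F"
  shows "mat_measurable M n n (\<lambda>x. gram1 (F x))"
proof -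
  have "mat_measurable M n n (\<lambda>x. 1\<^sub>m n + F x * mat_adjoint (F x))"
    by (intro mat_measurable_add mat_measurable_const mat_measurable_mult[OF F] mat_measurable_adjoint F) simp
  moreover have "gram1 (F x) = 1\<^sub>m n + F x * mat_adjoint (F x)" if "x \<in> space M" for x
    using mat_measurable_carrier[OF F that] by (simp add: gram1_def)
  ultimately show ?thesis unfolding mat_measurable_def by (simp cong: measurable_cong)
qed

lemma mat_measurable_resolvent:
  assumes F: "mat_measurable M n N F"
  shows "mat_measurable M n n (\<lambda>x. resolvent (F x))"
proof (rule mat_measurable_entrywise[where f="\<lambda>i j x. inverse (det (gram1 (F x))) * adj_mat (gram1 (F x)) $$ (i, j)"])
  show "x \<in> space M \<Longrightarrow> resolvent (F x) \<in> carrier_mat n n" for x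
    using mat_measurable_carrier[OF F] by (rule resolvent_carrier)
  show "x \<in> space M \<Longrightarrow> i < n \<Longrightarrow> j < n \<Longrightarrow>
      resolvent (F x) $$ (i, j) = inverse (det (gram1 (F x))) * adj_mat (gram1 (F x)) $$ (i, j)" for x i j
    using adj_mat(1)[OF gram1_carrier[OF mat_measurable_carrier[OF F, of x]]]
      by (simp add: resolvent_def)
  note G = mat_measurable_gram1[OF F]
  show "i < n \<Longrightarrow> j < n \<Longrightarrow>
      (\<lambda>x. inverse (det (gram1 (F x))) * adj_mat (gram1 (F x)) $$ (i, j)) \<in> borel_measurable M" for i j
    by (intro borel_measurable_times borel_measurable_inverse borel_measurable_det[OF G]
        mat_measurable_entry[OF mat_measurable_adj_mat[OF G]])
qed

lemma borel_measurable_stein_fn: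
  assumes C: "C \<in> carrier_mat n m" and F: "mat_measurable M m N F" and i: "i < m" and j: "j < N"
  shows "(\<lambda>x. stein_fn v C i j (F x)) \<in> borel_measurable M"
proof -
  have E: "mat_measurable M m m (\<lambda>x. compressed_resolvent C (F x))"
    unfolding compressed_resolvent_def using C
    by (intro mat_measurable_mult[of _ m n] mat_measurable_mult[of _ m n _ n] mat_measurable_resolvent[of _ _ N]
        mat_measurable_mult[OF mat_measurable_const F] mat_measurable_const) auto
  note [measurable] = mat_measurable_entry[OF F i j] mat_measurable_entry[OF E i i]
    mat_measurable_entry[OF mat_measurable_mult[OF E F] i j]
    mat_measurable_entry[OF mat_measurable_mult[OF mat_measurable_mult[OF mat_measurable_adjoint[OF F] E] F] j j]
  have [measurable]: "cnj \<in> borel_measurable borel"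
    by (intro borel_measurable_continuous_onI continuous_intros)
  show ?thesis unfolding stein_fn_def Let_def by measurable
qed

text \<open>The squared Frobenius norm. It is integrable for Gaussian entries and serves as the
  common majorant in all integrability proofs for random matrices below.\<close>

definition sum_sq :: "complex mat \<Rightarrow> real" where
  "sum_sq S = (\<Sum>k<dim_row S. \<Sum>l<dim_col S. (cmod (S $$ (k, l)))\<^sup>2)"

lemma entry_sq_le_sum_sq:
  assumes "S \<in> carrier_mat m N" "k < m" "l < N"
  shows "(cmod (S $$ (k, l)))\<^sup>2 \<le> sum_sq S"
proof -
  have "(cmod (S $$ (k, l)))\<^sup>2 \<le> (\<Sum>l<N. (cmod (S $$ (k, l)))\<^sup>2)"
    using assms by (intro member_le_sum) auto
  also have "\<dots> \<le> (\<Sum>k<m. \<Sum>l<N. (cmod (S $$ (k, l)))\<^sup>2)"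
    using assms
      by (intro member_le_sum[of k _ "\<lambda>k. \<Sum>l<N. (cmod (S $$ (k, l)))\<^sup>2"]) (auto intro!: sum_nonneg)
  finally show ?thesis using assms by (simp add: sum_sq_def)
qed

lemma entry_mult_le_sum_sq:
  assumes S: "S \<in> carrier_mat m N" and "k < m" "l < N" "k' < m" "l' < N"
  shows "cmod (S $$ (k, l)) * cmod (S $$ (k', l')) \<le> sum_sq S"
proof -
  have "2 * (cmod (S $$ (k, l)) * cmod (S $$ (k', l'))) \<le> (cmod (S $$ (k, l)))\<^sup>2 + (cmod (S $$ (k', l')))\<^sup>2"
    using sum_squares_bound[of "cmod (S $$ (k, l))" "cmod (S $$ (k', l'))"] by (simp add: mult.assoc)
  then show ?thesis
    using entry_sq_le_sum_sq[OF S, of k l] entry_sq_le_sum_sq[OF S, of k' l'] assms by linarith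
qed

lemma mult_entry_bound:
  assumes A: "A \<in> carrier_mat n m" and B: "B \<in> carrier_mat m k" and i: "i < n" and j: "j < k"
    and a: "\<And>l. l < m \<Longrightarrow> cmod (A $$ (i, l)) \<le> a" and b: "\<And>l. l < m \<Longrightarrow> cmod (B $$ (l, j)) \<le> b" and "0 \<le> a"
  shows "cmod ((A * B) $$ (i, j)) \<le> real m * (a * b)"
proof -
  have "cmod ((A * B) $$ (i, j)) = cmod (\<Sum>l<m. A $$ (i, l) * B $$ (l, j))"
    using A B i j by (simp add: scalar_prod_def lessThan_atLeast0)
  also have "\<dots> \<le> (\<Sum>l<m. a * b)"
    by (intro sum_norm_le) (auto simp: norm_mult intro!: mult_mono a b \<open>0 \<le> a\<close>)
  finally show ?thesis by simp
qed

text \<open>Uniformity in \<open>S\<close> and in the number of its columns is inherited from the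
  bound on the resolvent.\<close>

lemma compressed_resolvent_bound:
  assumes C: "C \<in> carrier_mat n m"
  obtains K where "0 \<le> K"
    "\<And>(S :: complex mat) i j N. S \<in> carrier_mat m N \<Longrightarrow> i < m \<Longrightarrow> j < m \<Longrightarrow> cmod (compressed_resolvent C S $$ (i, j)) \<le> K"
proof -
  define c where "c = sqrt (sum_sq C)"
  have Cc: "cmod (C $$ (k, l)) \<le> c" if "k < n" "l < m" for k l
    using entry_sq_le_sum_sq[OF C that] real_le_rsqrt by (simp add: c_def)
  have c0: "0 \<le> c" unfolding c_def sum_sq_def by (auto intro!: sum_nonneg)
  \<comment> \<open>Each of the two products in \<open>C^H Q C\<close> contributes a factor
    \<open>n\<close>; the entries of \<open>C\<close> are at most \<open>c\<close> and those of the
    resolvent at most \<open>n\<close>.\<close>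
  define K where "K = real n * ((real n * (c * real n)) * c)"
  show thesis
  proof (rule that[of K])
    show "0 \<le> K" using c0 by (simp add: K_def)
    fix S :: "complex mat" and i j N assume S: "S \<in> carrier_mat m N" and i: "i < m" and j: "j < m"
    have Y: "C * S \<in> carrier_mat n N" using C S by simp
    note Q = resolvent_carrier[OF Y]
    have AQ: "mat_adjoint C * resolvent (C * S) \<in> carrier_mat m n" using C Q by auto
    show "cmod (compressed_resolvent C S $$ (i, j)) \<le> K"
      unfolding compressed_resolvent_def K_def
    proof (rule mult_entry_bound[OF AQ C i j])
      show "cmod ((mat_adjoint C * resolvent (C * S)) $$ (i, l)) \<le> real n * (c * real n)" if l: "l < n" for l
        using C i l c0
          by (intro mult_entry_bound[OF _ Q i l] resolvent_entry_bound[OF Y]) (auto intro: Cc)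
    qed (use Cc j c0 in auto)
  qed
qed

text \<open>As the compressed resolvent is bounded, \<open>stein_fn\<close> grows at most
  quadratically in \<open>S\<close>, within reach of the second moments of the entries.\<close>

lemma stein_fn_bound:
  assumes C: "C \<in> carrier_mat n m" and i: "i < m" and j: "j < N"
  obtains K where "0 \<le> K" "\<And>S :: complex mat. S \<in> carrier_mat m N \<Longrightarrow> \<bar>stein_fn v C i j S\<bar> \<le> K * (1 + sum_sq S)"
proof -
  obtain E0 where E0: "0 \<le> E0"
    and Eb: "\<And>(S :: complex mat) i j N. S \<in> carrier_mat m N \<Longrightarrow> i < m \<Longrightarrow> j < m \<Longrightarrow> cmod (compressed_resolvent C S $$ (i, j)) \<le> E0"
    using compressed_resolvent_bound[OF C] by blast
  define K1 where "K1 = real m * E0"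
  have K1: "0 \<le> K1" using E0 by (simp add: K1_def)
  define K where "K = K1 + \<bar>v\<bar> * (E0 * (1 + real m * K1))"
  show thesis
  proof (rule that[of K])
    show "0 \<le> K" using E0 K1 by (simp add: K_def)
    fix S :: "complex mat" assume S: "S \<in> carrier_mat m N"
    define E where "E = compressed_resolvent C S"
    have E: "E \<in> carrier_mat m m" using C S by (simp add: E_def)
    have s0: "0 \<le> sum_sq S" unfolding sum_sq_def by (auto intro!: sum_nonneg)
    have cES: "cmod (cnj (S $$ (k, j)) * (E * S) $$ (k, j)) \<le> K1 * sum_sq S" if k: "k < m" for k
    proof -
      have "cnj (S $$ (k, j)) * (E * S) $$ (k, j) = (\<Sum>l<m. cnj (S $$ (k, j)) * (E $$ (k, l) * S $$ (l, j)))"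
        using E S k j by (simp add: scalar_prod_def lessThan_atLeast0 sum_distrib_left)
      also have "cmod \<dots> \<le> (\<Sum>l<m. E0 * sum_sq S)"
      proof (intro sum_norm_le)
        fix l assume "l \<in> {..<m}"
        then have l: "l < m" by simp
        have "cmod (cnj (S $$ (k, j)) * (E $$ (k, l) * S $$ (l, j))) = cmod (E $$ (k, l)) * (cmod (S $$ (k, j)) * cmod (S $$ (l, j)))"
          by (simp add: norm_mult)
        also have "\<dots> \<le> E0 * sum_sq S" unfolding E_def
          by (intro mult_mono Eb[OF S k l] entry_mult_le_sum_sq[OF S k j l j] E0) auto
        finally show "cmod (cnj (S $$ (k, j)) * (E $$ (k, l) * S $$ (l, j))) \<le> E0 * sum_sq S" .
      qed
      finally show ?thesis by (simp add: K1_def mult.assoc)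
    qed
    have SES: "cmod ((mat_adjoint S * E * S) $$ (j, j)) \<le> real m * K1 * sum_sq S"
    proof -
      have "(mat_adjoint S * E * S) $$ (j, j) = (mat_adjoint S * (E * S)) $$ (j, j)"
        using E S by (simp add: mat_assoc)
      also have "\<dots> = (\<Sum>k<m. cnj (S $$ (k, j)) * (E * S) $$ (k, j))"
        using E S j by (simp add: scalar_prod_def lessThan_atLeast0)
      also have "cmod \<dots> \<le> (\<Sum>k<m. K1 * sum_sq S)" by (intro sum_norm_le cES) simp
      finally show ?thesis by simp
    qed
    have a: "\<bar>Re (cnj (S $$ (i, j)) * (E * S) $$ (i, j))\<bar> \<le> K1 * sum_sq S"
      using order_trans[OF abs_Re_le_cmod cES[OF i]] .
    have b: "\<bar>Re (E $$ (i, i))\<bar> \<le> E0"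
      unfolding E_def using order_trans[OF abs_Re_le_cmod Eb[OF S i i]] .
    have c: "\<bar>1 - Re ((mat_adjoint S * E * S) $$ (j, j))\<bar> \<le> 1 + real m * K1 * sum_sq S"
      using order_trans[OF abs_Re_le_cmod SES] by linarith
    have "\<bar>stein_fn v C i j S\<bar> \<le> K1 * sum_sq S + \<bar>v\<bar> * (E0 * (1 + real m * K1 * sum_sq S))"
      unfolding stein_fn_def Let_def E_def[symmetric]
      by (rule order_trans[OF abs_triangle_ineq4]) (unfold abs_mult, intro add_mono mult_mono a b c E0 mult_nonneg_nonneg, auto)
    also have "\<dots> \<le> K1 * (1 + sum_sq S) + \<bar>v\<bar> * (E0 * ((1 + real m * K1) * (1 + sum_sq S)))"
      using K1 E0 s0 by (intro add_mono mult_left_mono) (auto simp: algebra_simps)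
    also have "\<dots> = K * (1 + sum_sq S)" by (simp add: K_def algebra_simps)
    finally show "\<bar>stein_fn v C i j S\<bar> \<le> K * (1 + sum_sq S)" .
  qed
qed

section \<open>Gaussian matrices and the mean of \<open>stein_fn\<close>\<close>

lemma iid_gaussian_matD:
  assumes "iid_gaussian_mat M m N v S"
  shows "\<And>\<omega>. \<omega> \<in> space M \<Longrightarrow> S \<omega> \<in> carrier_mat m N"
    and "\<And>i j. i < m \<Longrightarrow> j < N \<Longrightarrow> circular_complex_gaussian M v (\<lambda>\<omega>. S \<omega> $$ (i, j))"
    and "prob_space.indep_vars M (\<lambda>_. borel) (\<lambda>(i, j) \<omega>. S \<omega> $$ (i, j)) ({..<m} \<times> {..<N})"
  using assms by (auto simp: iid_gaussian_mat_def)

lemma (in prob_space) mat_measurable_iid: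
  assumes S: "iid_gaussian_mat M m N v S"
  shows "mat_measurable M m N S"
proof (rule mat_measurableI)
  fix i j assume "i < m" "j < N"
  then show "(\<lambda>\<omega>. S \<omega> $$ (i, j)) \<in> borel_measurable M"
    using iid_gaussian_matD(3)[OF S] unfolding indep_vars_def by auto
qed (rule iid_gaussian_matD(1)[OF S])

lemma (in prob_space) integrable_normal_square:
  assumes \<sigma>: "\<sigma> > 0" and X: "distributed M lborel X (\<lambda>x. ennreal (normal_density 0 \<sigma> x))"
  shows "integrable M (\<lambda>\<omega>. (X \<omega>)\<^sup>2)"
proof -
  have "integrable lborel (\<lambda>x. normal_density 0 \<sigma> x * x\<^sup>2)"
    using integrable_normal_moment[OF \<sigma>, of 0 2] by simp
  then show ?thesis
    using distributed_integrable[OF X, of "\<lambda>x. x\<^sup>2"] by simp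
qed

lemma (in prob_space) integrable_sum_sq:
  assumes S: "iid_gaussian_mat M m N v S" and v: "v > 0"
  shows "integrable M (\<lambda>\<omega>. sum_sq (S \<omega>))"
proof -
  have "integrable M (\<lambda>\<omega>. \<Sum>k<m. \<Sum>l<N. (Re (S \<omega> $$ (k, l)))\<^sup>2 + (Im (S \<omega> $$ (k, l)))\<^sup>2)"
  proof (intro Bochner_Integration.integrable_sum Bochner_Integration.integrable_add)
    fix k l assume "k \<in> {..<m}" "l \<in> {..<N}"
    then have "circular_complex_gaussian M v (\<lambda>\<omega>. S \<omega> $$ (k, l))"
      using iid_gaussian_matD(2)[OF S] by simp
    then show "integrable M (\<lambda>\<omega>. (Re (S \<omega> $$ (k, l)))\<^sup>2)" "integrable M (\<lambda>\<omega>. (Im (S \<omega> $$ (k, l)))\<^sup>2)"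
      using v by (auto simp: circular_complex_gaussian_def intro!: integrable_normal_square[of "sqrt (v / 2)"])
  qed
  moreover have "sum_sq (S \<omega>) = (\<Sum>k<m. \<Sum>l<N. (Re (S \<omega> $$ (k, l)))\<^sup>2 + (Im (S \<omega> $$ (k, l)))\<^sup>2)" if "\<omega> \<in> space M" for \<omega>
    using iid_gaussian_matD(1)[OF S that] by (simp add: sum_sq_def cmod_power2)
  ultimately show ?thesis by (simp cong: Bochner_Integration.integrable_cong)
qed

text \<open>The entry at \<open>(i, j)\<close> is independent of the family of all others. Freezing
  the others leaves the scalar Stein identity in one circular Gaussian variable, which holds for
  every frozen value.\<close>

lemma (in prob_space) stein_fn_expectation:
  assumes S: "iid_gaussian_mat M m N v S" and v: "v > 0"
    and C: "C \<in> carrier_mat n m" and i: "i < m" and j: "j < N"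
  shows "integrable M (\<lambda>\<omega>. stein_fn v C i j (S \<omega>))" "expectation (\<lambda>\<omega>. stein_fn v C i j (S \<omega>)) = 0"
proof -
  note Sc = iid_gaussian_matD(1)[OF S] and circ = iid_gaussian_matD(2)[OF S] and ind = iid_gaussian_matD(3)[OF S]
  have Sm: "mat_measurable M m N S" by (rule mat_measurable_iid[OF S])
  obtain K where K: "0 \<le> K" "\<And>S. S \<in> carrier_mat m N \<Longrightarrow> \<bar>stein_fn v C i j S\<bar> \<le> K * (1 + sum_sq S)"
    using stein_fn_bound[OF C i j] by metis
  show int: "integrable M (\<lambda>\<omega>. stein_fn v C i j (S \<omega>))"
  proof (rule Bochner_Integration.integrable_bound)
    show "integrable M (\<lambda>\<omega>. K * (1 + sum_sq (S \<omega>)))"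
      using integrable_sum_sq[OF S v] by simp
    show "(\<lambda>\<omega>. stein_fn v C i j (S \<omega>)) \<in> borel_measurable M"
      by (rule borel_measurable_stein_fn[OF C Sm i j])
    show "AE \<omega> in M. norm (stein_fn v C i j (S \<omega>)) \<le> norm (K * (1 + sum_sq (S \<omega>)))"
      using K(2)[OF Sc] by (intro AE_I2) fastforce
  qed
  define I where "I = {..<m} \<times> {..<N}"
  define B where "B = I - {(i, j)}"
  define X where "X = (\<lambda>(i, j) \<omega>. S \<omega> $$ (i, j))"
  define Y where "Y \<omega> = restrict (\<lambda>p. X p \<omega>) B" for \<omega>
  \<comment> \<open>Both variables of \<open>indep_var\<close> must have the same type, so the single entry is kept as a
    function on the singleton \<open>{(i, j)}\<close>.\<close>
  define Z where "Z \<omega> = restrict (\<lambda>p. X p \<omega>) {(i, j)}" for \<omega>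
  have ZY: "indep_var (PiM {(i, j)} (\<lambda>_. borel)) Z (PiM B (\<lambda>_. borel)) Y"
    unfolding Y_def Z_def using i j
    by (intro indep_var_restrict[OF ind[folded X_def I_def]]) (auto simp: I_def B_def)
  \<comment> \<open>Rebuilds the matrix from the single entry and the remaining ones, which makes
    \<open>stein_fn\<close> a measurable function of the two independent variables.\<close>
  define F :: "(nat \<times> nat \<Rightarrow> complex) \<times> (nat \<times> nat \<Rightarrow> complex) \<Rightarrow> complex mat" where
    "F = (\<lambda>(z, y). mat m N (\<lambda>(k, l). if k = i \<and> l = j then z (i, j) else y (k, l)))"
  have Fm: "mat_measurable (PiM {(i, j)} (\<lambda>_. borel) \<Otimes>\<^sub>M PiM B (\<lambda>_. borel)) m N F"
  proof (rule mat_measurable_entrywise[where f="\<lambda>k l zy. if k = i \<and> l = j then fst zy (i, j) else snd zy (k, l)"])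
    fix k l assume "k < m" "l < N"
    then have "k = i \<and> l = j \<or> (k, l) \<in> B" by (auto simp: B_def I_def)
    then show "(\<lambda>zy. if k = i \<and> l = j then fst zy (i, j) else snd zy (k, l))
        \<in> borel_measurable (PiM {(i, j)} (\<lambda>_. borel) \<Otimes>\<^sub>M PiM B (\<lambda>_. borel))"
      by (cases "k = i \<and> l = j")
        (auto intro!: measurable_compose[OF measurable_snd measurable_component_singleton]
          measurable_compose[OF measurable_fst measurable_component_singleton])
  qed (auto simp: F_def)
  have SF: "F (Z \<omega>, Y \<omega>) = S \<omega>" if "\<omega> \<in> space M" for \<omega>
    using Sc[OF that] by (intro eq_matI) (auto simp: F_def Z_def Y_def X_def B_def I_def)
  have "expectation (\<lambda>\<omega>. stein_fn v C i j (F (Z \<omega>, Y \<omega>))) = 0"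
  proof (rule expectation_indep_eq_0[OF ZY, where h = "\<lambda>zy. stein_fn v C i j (F zy)"])
    show "(\<lambda>zy. stein_fn v C i j (F zy)) \<in> borel_measurable (PiM {(i, j)} (\<lambda>_. borel) \<Otimes>\<^sub>M PiM B (\<lambda>_. borel))"
      by (rule borel_measurable_stein_fn[OF C Fm i j])
    show "integrable M (\<lambda>\<omega>. stein_fn v C i j (F (Z \<omega>, Y \<omega>)))"
      using int by (simp add: SF cong: Bochner_Integration.integrable_cong)
    fix y :: "nat \<times> nat \<Rightarrow> complex"
    \<comment> \<open>The filler 0 at position \<open>(i, j)\<close> is arbitrary, as
      \<open>upd_entry\<close> overwrites it.\<close>
    define U where "U = F (\<lambda>_. 0, y)"
    have U: "U \<in> carrier_mat m N" by (simp add: U_def F_def)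
    have Fz: "F (Z \<omega>, y) = upd_entry U i j (S \<omega> $$ (i, j))" for \<omega>
      by (intro eq_matI) (auto simp: U_def F_def upd_entry_def Z_def X_def)
    obtain a b c where nn: "\<And>z. 0 \<le> a + 2 * Re (cnj z * b) + c * (cmod z)\<^sup>2"
      and eq: "\<And>z. stein_fn v C i j (upd_entry U i j z) =
      Re (cnj z * (b + complex_of_real c * z)) / (1 + (a + 2 * Re (cnj z * b) + c * (cmod z)\<^sup>2))
      - v * (c / (1 + (a + 2 * Re (cnj z * b) + c * (cmod z)\<^sup>2))
        - (cmod (b + complex_of_real c * z))\<^sup>2 / (1 + (a + 2 * Re (cnj z * b) + c * (cmod z)\<^sup>2))\<^sup>2)"
      using stein_fn_upd_entry[OF C U i j, of v] by metis
    show "expectation (\<lambda>\<omega>. stein_fn v C i j (F (Z \<omega>, y))) = 0"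
      unfolding Fz eq by (rule stein_circular_gaussian[OF v circ[OF i j] nn])
  qed
  then show "expectation (\<lambda>\<omega>. stein_fn v C i j (S \<omega>)) = 0"
    by (simp add: SF cong: Bochner_Integration.integral_cong)
qed

section \<open>Traces and the summed Stein identity\<close>

definition mtrace :: "complex mat \<Rightarrow> complex" where
  "mtrace A = (\<Sum>i<dim_row A. A $$ (i, i))"

lemma mtrace_mult_commute:
  assumes "A \<in> carrier_mat n m" "B \<in> carrier_mat m n"
  shows "mtrace (A * B) = mtrace (B * A)"
proof -
  have "mtrace (A * B) = (\<Sum>i<n. \<Sum>j<m. A $$ (i, j) * B $$ (j, i))"
    using assms by (simp add: mtrace_def scalar_prod_def lessThan_atLeast0)
  also have "\<dots> = (\<Sum>j<m. \<Sum>i<n. A $$ (i, j) * B $$ (j, i))" by (rule sum.swap)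
  also have "\<dots> = mtrace (B * A)"
    using assms by (simp add: mtrace_def scalar_prod_def lessThan_atLeast0 mult.commute)
  finally show ?thesis .
qed

text \<open>The first trace is cyclicity together with \<open>C C^H = D\<close>. The second is
  cyclicity together with \<open>Q W = I - Q\<close>, which comes from
  \<open>Q (I + W) = I\<close>.\<close>

lemma mtrace_compressed_resolvent:
  assumes C: "C \<in> carrier_mat n m" and S: "S \<in> carrier_mat m N" and D: "C * mat_adjoint C = diag_of n d"
  shows "mtrace (compressed_resolvent C S) = (\<Sum>i<n. complex_of_real (d i) * resolvent (C * S) $$ (i, i))"
    and "mtrace (mat_adjoint S * compressed_resolvent C S * S) = (\<Sum>i<n. 1 - resolvent (C * S) $$ (i, i))"
proof -
  let ?Q = "resolvent (C * S)"
  have Y: "C * S \<in> carrier_mat n N" using C S by simp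
  note Q = resolvent_carrier[OF Y]
  have "mtrace (compressed_resolvent C S) = mtrace (mat_adjoint C * (?Q * C))"
    using C Q by (simp add: compressed_resolvent_def mat_assoc)
  also have "\<dots> = mtrace (?Q * C * mat_adjoint C)"
    using C Q by (intro mtrace_mult_commute[of _ m n]) auto
  also have "?Q * C * mat_adjoint C = ?Q * diag_of n d" using C Q by (simp add: mat_assoc D)
  also have "mtrace \<dots> = (\<Sum>i<n. complex_of_real (d i) * ?Q $$ (i, i))"
    unfolding diag_of_mult_right[OF Q] by (simp add: mtrace_def mult.commute)
  finally show "mtrace (compressed_resolvent C S) = (\<Sum>i<n. complex_of_real (d i) * ?Q $$ (i, i))" .
  have "mtrace (mat_adjoint S * compressed_resolvent C S * S) = mtrace (mat_adjoint (C * S) * (?Q * (C * S)))"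
    using C S Q by (simp add: compressed_resolvent_def mat_assoc mat_adjoint_mult)
  also have "\<dots> = mtrace (?Q * (C * S) * mat_adjoint (C * S))"
    using Y mult_carrier_mat[OF Q Y] by (intro mtrace_mult_commute[of _ N n]) auto
  also have "?Q * (C * S) * mat_adjoint (C * S) = ?Q * ((C * S) * mat_adjoint (C * S))"
    using C S by (simp add: mat_assoc carrier_matD[OF Q])
  finally have 1: "mtrace (mat_adjoint S * compressed_resolvent C S * S) = mtrace (?Q * ((C * S) * mat_adjoint (C * S)))" .
  have W: "(C * S) * mat_adjoint (C * S) \<in> carrier_mat n n" using Y by auto
  have "?Q * (1\<^sub>m n + (C * S) * mat_adjoint (C * S)) = 1\<^sub>m n"
    using resolvent_inverse(1)[OF Y] C by (simp add: gram1_def)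
  then have eq: "?Q + ?Q * ((C * S) * mat_adjoint (C * S)) = 1\<^sub>m n"
    unfolding mult_add_distrib_mat[OF Q one_carrier_mat W] right_mult_one_mat[OF Q] .
  have "(?Q * ((C * S) * mat_adjoint (C * S))) $$ (i, i) = 1 - ?Q $$ (i, i)" if i: "i < n" for i
  proof -
    have "?Q $$ (i, i) + (?Q * ((C * S) * mat_adjoint (C * S))) $$ (i, i) = 1"
      using arg_cong[OF eq, of "\<lambda>M. M $$ (i, i)"] i carrier_matD[OF mult_carrier_mat[OF Q W]]
      by (simp del: index_mult_mat(1))
    then show ?thesis by (simp add: algebra_simps del: index_mult_mat(1))
  qed
  then show "mtrace (mat_adjoint S * compressed_resolvent C S * S) = (\<Sum>i<n. 1 - ?Q $$ (i, i))"
    unfolding 1 unfolding mtrace_def using carrier_matD[OF mult_carrier_mat[OF Q W]]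
    by (simp del: index_mult_mat(1))
qed

text \<open>The derivative term is a factor depending on \<open>i\<close> times a factor depending
  on \<open>j\<close>, so its double sum is a product of traces; summing the constant 1 over the
  columns produces \<open>N\<close>.\<close>

lemma sum_stein_fn:
  assumes C: "C \<in> carrier_mat n m" and S: "S \<in> carrier_mat m N"
  shows "(\<Sum>i<m. \<Sum>j<N. stein_fn v C i j S)
    = Re (mtrace (mat_adjoint S * compressed_resolvent C S * S))
      - v * (Re (mtrace (compressed_resolvent C S)) * (real N - Re (mtrace (mat_adjoint S * compressed_resolvent C S * S))))"
proof -
  define E where "E = compressed_resolvent C S"
  have E: "E \<in> carrier_mat m m" using C S by (simp add: E_def)
  have "mtrace (mat_adjoint S * (E * S)) = (\<Sum>j<N. \<Sum>i<m. cnj (S $$ (i, j)) * (E * S) $$ (i, j))"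
    using E S by (simp add: mtrace_def scalar_prod_def lessThan_atLeast0)
  also have "\<dots> = (\<Sum>i<m. \<Sum>j<N. cnj (S $$ (i, j)) * (E * S) $$ (i, j))" by (rule sum.swap)
  finally have t: "mtrace (mat_adjoint S * E * S) = (\<Sum>i<m. \<Sum>j<N. cnj (S $$ (i, j)) * (E * S) $$ (i, j))"
    using E S by (simp add: mat_assoc)
  have u: "Re (mtrace (mat_adjoint S * E * S)) = (\<Sum>j<N. Re ((mat_adjoint S * E * S) $$ (j, j)))"
    using E S by (simp add: mtrace_def del: index_mult_mat(1))
  have w: "Re (mtrace E) = (\<Sum>i<m. Re (E $$ (i, i)))" using E by (simp add: mtrace_def)
  have "(\<Sum>i<m. \<Sum>j<N. stein_fn v C i j S) = Re (mtrace (mat_adjoint S * E * S))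
      - v * (\<Sum>i<m. \<Sum>j<N. Re (E $$ (i, i)) * (1 - Re ((mat_adjoint S * E * S) $$ (j, j))))"
    unfolding t stein_fn_def Let_def E_def[symmetric] Re_sum
    by (simp add: sum_subtractf sum_distrib_left del: index_mult_mat(1))
  also have "(\<Sum>i<m. \<Sum>j<N. Re (E $$ (i, i)) * (1 - Re ((mat_adjoint S * E * S) $$ (j, j))))
      = Re (mtrace E) * (real N - Re (mtrace (mat_adjoint S * E * S)))"
    unfolding w u by (simp add: sum_product[symmetric] sum_subtractf del: index_mult_mat(1))
  finally show ?thesis unfolding E_def .
qed

lemma resolvent_diag_nonneg:
  assumes Y: "Y \<in> carrier_mat n N" and i: "i < n"
  shows "0 \<le> Re (resolvent Y $$ (i, i))"
proof -
  note Q = resolvent_carrier[OF Y]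
  have "resolvent Y *\<^sub>v unit_vec n i = col (resolvent Y) i" by (rule mult_unit_vec_eq_col[OF Q i])
  moreover have "col (resolvent Y) i \<bullet>c unit_vec n i = resolvent Y $$ (i, i)"
    using Q i
      by (simp add: scalar_prod_def unit_vec_def if_distrib[of cnj] if_distrib[of "\<lambda>x. _ * x"] cong: if_cong)
  moreover have "0 \<le> Re ((resolvent Y *\<^sub>v unit_vec n i) \<bullet>c unit_vec n i)"
    using resolvent_psd[OF Y] Q by (auto simp: hermitian_psd_def)
  ultimately show ?thesis by simp
qed

text \<open>Row \<open>i\<close> of \<open>gram1 Y\<close> is a unit row. Vanishing diagonal entries
  of \<open>D\<close> therefore contribute nothing to \<open>tr(W Q)\<close>, which is how the bound
  becomes \<open>r\<close> and not the full dimension.\<close>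

lemma resolvent_diag_zero_row:
  assumes Y: "Y \<in> carrier_mat n N" and i: "i < n" and z: "\<And>j. j < N \<Longrightarrow> Y $$ (i, j) = 0"
  shows "resolvent Y $$ (i, i) = 1"
proof -
  note Q = resolvent_carrier[OF Y]
  have X: "gram1 Y $$ (i, k) = (if i = k then 1 else 0)" if "k < n" for k
    using Y i that z by (simp add: gram1_def scalar_prod_def)
  have "1 = (gram1 Y * resolvent Y) $$ (i, i)" using resolvent_inverse(2)[OF Y] i by simp
  also have "\<dots> = (\<Sum>k<n. (if i = k then 1 else 0) * resolvent Y $$ (k, i))"
    using gram1_carrier[OF Y] Q i X by (simp add: scalar_prod_def lessThan_atLeast0)
  also have "\<dots> = resolvent Y $$ (i, i)"
    using i by (simp add: if_distrib[of "\<lambda>x. x * _"] cong: if_cong)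
  finally show ?thesis by simp
qed

lemma mtrace_conj_unitary_diag:
  assumes V: "unitary_mat n V"
  shows "mtrace (V * diag_of n d * mat_adjoint V) = complex_of_real (\<Sum>i<n. d i)"
proof -
  have Vc: "V \<in> carrier_mat n n" and VV: "mat_adjoint V * V = 1\<^sub>m n"
    using V by (auto simp: unitary_mat_def)
  have VD: "V * diag_of n d \<in> carrier_mat n n" using Vc by auto
  have "mtrace (V * diag_of n d * mat_adjoint V) = mtrace (mat_adjoint V * (V * diag_of n d))"
    using Vc VD by (intro mtrace_mult_commute[of _ n n]) auto
  also have "mat_adjoint V * (V * diag_of n d) = (mat_adjoint V * V) * diag_of n d"
    using Vc by (simp add: mat_assoc)
  also have "\<dots> = diag_of n d" unfolding VV by simp
  finally show ?thesis by (simp add: mtrace_def)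
qed

text \<open>The eigenvalues \<open>d\<close> of \<open>Y Y^H\<close> are nonnegative with sum
  \<open>sum_sq Y\<close>, and \<open>0 \<le> ln (1 + d) \<le> d\<close>. This gives the integrable
  majorant of the log determinant.\<close>

lemma log_det_gram1_bounds:
  assumes Y: "Y \<in> carrier_mat n N"
  shows "0 \<le> log_det (gram1 Y)" "log_det (gram1 Y) \<le> sum_sq Y"
proof -
  obtain V d where V: "unitary_mat n V" and d: "\<And>i. i < n \<Longrightarrow> 0 \<le> d i"
    and X: "gram1 Y = V * diag_of n (\<lambda>i. 1 + d i) * mat_adjoint V"
    and dX: "det (gram1 Y) = complex_of_real (\<Prod>i<n. 1 + d i)"
    using gram1_spectral[OF Y] by metis
  have pos: "0 < 1 + d i" if "i < n" for i using d[OF that] by linarith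
  have ld: "log_det (gram1 Y) = (\<Sum>i<n. ln (1 + d i))"
    unfolding log_det_def dX Re_complex_of_real
      using pos by (intro ln_prod) (auto simp: less_imp_neq[symmetric])
  show "0 \<le> log_det (gram1 Y)" unfolding ld using d by (intro sum_nonneg ln_ge_zero) auto
  have "complex_of_real (\<Sum>i<n. 1 + d i) = mtrace (gram1 Y)"
    unfolding X mtrace_conj_unitary_diag[OF V] ..
  also have "\<dots> = (\<Sum>i<n. 1 + (\<Sum>j<N. Y $$ (i, j) * cnj (Y $$ (i, j))))"
    using Y by (simp add: mtrace_def gram1_def scalar_prod_def lessThan_atLeast0)
  also have "\<dots> = complex_of_real (real n + sum_sq Y)"
    using Y by (simp add: sum_sq_def complex_norm_square[symmetric] sum.distrib)
  finally have "(\<Sum>i<n. 1 + d i) = real n + sum_sq Y" using of_real_eq_iff by blast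
  then have "(\<Sum>i<n. d i) = sum_sq Y" by (simp add: sum.distrib)
  moreover have "log_det (gram1 Y) \<le> (\<Sum>i<n. d i)"
    unfolding ld using d by (intro sum_mono ln_add_one_self_le_self) auto
  ultimately show "log_det (gram1 Y) \<le> sum_sq Y" by simp
qed

lemma sum_sq_mult_le:
  assumes C: "C \<in> carrier_mat n m"
  obtains K where "0 \<le> K" "\<And>S. S \<in> carrier_mat m N \<Longrightarrow> sum_sq (C * S) \<le> K * sum_sq S"
proof -
  define c where "c = sqrt (sum_sq C)"
  have Cc: "cmod (C $$ (k, l)) \<le> c" if "k < n" "l < m" for k l
    using entry_sq_le_sum_sq[OF C that] real_le_rsqrt by (simp add: c_def)
  have c0: "0 \<le> c" unfolding c_def sum_sq_def by (auto intro!: sum_nonneg)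
  show thesis
  proof (rule that[of "real n * real N * (real m * c)\<^sup>2"])
    fix S :: "complex mat" assume S: "S \<in> carrier_mat m N"
    have s0: "0 \<le> sum_sq S" unfolding sum_sq_def by (auto intro!: sum_nonneg)
    have "(cmod ((C * S) $$ (k, l)))\<^sup>2 \<le> (real m * c)\<^sup>2 * sum_sq S" if k: "k < n" and l: "l < N" for k l
    proof -
      have "cmod ((C * S) $$ (k, l)) \<le> real m * (c * sqrt (sum_sq S))"
        using entry_sq_le_sum_sq[OF S _ l] real_le_rsqrt
        by (intro mult_entry_bound[OF C S k l] Cc[OF k] c0) auto
      then have "(cmod ((C * S) $$ (k, l)))\<^sup>2 \<le> (real m * (c * sqrt (sum_sq S)))\<^sup>2"
        by (intro power_mono) auto
      also have "\<dots> = (real m * c)\<^sup>2 * sum_sq S" using s0 by (simp add: power_mult_distrib)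
      finally show ?thesis .
    qed
    then have "(\<Sum>k<n. \<Sum>l<N. (cmod ((C * S) $$ (k, l)))\<^sup>2) \<le> (\<Sum>k<n. \<Sum>l<N. (real m * c)\<^sup>2 * sum_sq S)"
      by (intro sum_mono) auto
    then show "sum_sq (C * S) \<le> real n * real N * (real m * c)\<^sup>2 * sum_sq S"
      using C S by (simp add: sum_sq_def[of "C * S"] del: index_mult_mat(1))
  qed simp
qed

text \<open>
  The tangent inequality of \<open>log det\<close>: it is \<open>ln \<mu> \<le> \<mu> - 1\<close> for the eigenvalues \<open>\<mu>\<close> of the
  resolvent multiplied on both sides by the square root of \<open>diag y\<close>.
\<close>

lemma log_det_gram1_tangent:
  assumes Y: "Y \<in> carrier_mat n N" and y: "\<And>i. i < n \<Longrightarrow> 0 < y i"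
  shows "(\<Sum>i<n. ln (y i)) + real n - (\<Sum>i<n. y i * Re (resolvent Y $$ (i, i))) \<le> log_det (gram1 Y)"
proof -
  obtain d where d: "\<And>i. i < n \<Longrightarrow> 0 \<le> d i" and dX: "det (gram1 Y) = complex_of_real (\<Prod>i<n. 1 + d i)"
    using gram1_spectral[OF Y] by metis
  define x where "x = (\<Prod>i<n. 1 + d i)"
  have x: "0 < x" unfolding x_def using d by (intro prod_pos) (auto intro!: add_pos_nonneg)
  note Q = resolvent_carrier[OF Y]
  define R where "R = diag_of n (\<lambda>i. sqrt (y i))"
  \<comment> \<open>The symmetric product has the trace and determinant of \<open>diag y\<close>
    times the resolvent, but it is Hermitian, so the spectral theorem applies.\<close>
  define A where "A = mat_adjoint R * resolvent Y * R"
  have R: "R \<in> carrier_mat n n" by (simp add: R_def)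
  have A: "A \<in> carrier_mat n n" unfolding A_def using R Q by auto
  have "hermitian_psd A" unfolding A_def by (rule hermitian_psd_cong[OF Q resolvent_psd[OF Y] R])
  from hermitian_psd_spectral[OF A this] obtain V \<mu> where V: "unitary_mat n V"
    and AV: "A = V * diag_of n \<mu> * mat_adjoint V" and \<mu>: "\<And>i. i < n \<Longrightarrow> 0 \<le> \<mu> i" by blast
  have sq: "(\<Prod>i<n. sqrt (y i)) * (\<Prod>i<n. sqrt (y i)) = (\<Prod>i<n. y i)"
    unfolding prod.distrib[symmetric] using y by (intro prod.cong) (auto simp: less_imp_le)
  have "complex_of_real (\<Prod>i<n. \<mu> i) = det A"
    unfolding AV by (simp add: det_mult_adjoint_unitary[OF V] det_diag_of)
  moreover have "det A = det R * det (resolvent Y) * det R"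
    unfolding A_def using R Q by (simp add: det_mult[of _ n] mult_carrier_mat[of _ n n] R_def)
  moreover have "det (resolvent Y) * complex_of_real x = 1"
    using det_mult[OF Q gram1_carrier[OF Y]] resolvent_inverse(1)[OF Y] by (simp add: dX x_def)
  ultimately have "complex_of_real ((\<Prod>i<n. \<mu> i) * x) = complex_of_real ((\<Prod>i<n. sqrt (y i)) * (\<Prod>i<n. sqrt (y i)))"
    unfolding R_def det_diag_of by (simp add: mult.assoc mult.left_commute)
  then have \<mu>x: "(\<Prod>i<n. \<mu> i) * x = (\<Prod>i<n. y i)" unfolding sq of_real_eq_iff .
  have yp: "0 < (\<Prod>i<n. y i)" using y by (intro prod_pos) auto
  \<comment> \<open>Semidefiniteness yields only \<open>\<mu> i \<ge> 0\<close>; the strict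
    positivity required by the logarithms is read off from the determinant identity.\<close>
  have "(\<Prod>i<n. \<mu> i) \<noteq> 0"
  proof
    assume eq: "(\<Prod>i<n. \<mu> i) = 0"
    show False using yp unfolding \<mu>x[symmetric] eq by simp
  qed
  then have \<mu>p: "0 < \<mu> i" if "i < n" for i
    using \<mu>[OF that] that by (metis finite_lessThan lessThan_iff order_le_imp_less_or_eq prod_zero)
  have "ln ((\<Prod>i<n. \<mu> i) * x) = (\<Sum>i<n. ln (\<mu> i)) + ln x"
    using \<mu>p x prod_pos[of "{..<n}" \<mu>]
      by (subst ln_mult) (auto intro!: ln_prod simp: less_imp_neq[symmetric])
  then have 1: "(\<Sum>i<n. ln (y i)) = (\<Sum>i<n. ln (\<mu> i)) + log_det (gram1 Y)"
    unfolding \<mu>x log_det_def dX x_def[symmetric] Re_complex_of_real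
    using y by (subst (asm) ln_prod) (auto simp: less_imp_neq[symmetric])
  have 2: "(\<Sum>i<n. ln (\<mu> i)) \<le> (\<Sum>i<n. \<mu> i - 1)"
    using \<mu>p by (intro sum_mono ln_le_minus_one) auto
  have "complex_of_real (\<Sum>i<n. \<mu> i) = mtrace A" unfolding AV mtrace_conj_unitary_diag[OF V] ..
  also have "\<dots> = (\<Sum>i<n. complex_of_real (y i) * resolvent Y $$ (i, i))"
  proof -
    have "A $$ (i, i) = complex_of_real (y i) * resolvent Y $$ (i, i)" if i: "i < n" for i
    proof -
      have "complex_of_real (sqrt (y i)) * complex_of_real (sqrt (y i)) = complex_of_real (y i)"
        unfolding of_real_mult[symmetric] using y[OF i] by simp
      then show ?thesis using i Q unfolding A_def R_def diag_of_adjoint diag_of_mult_left[OF Q]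
        by (subst diag_of_mult_right[of _ n n]) (auto simp: ac_simps)
    qed
    then show ?thesis using A by (simp add: mtrace_def)
  qed
  finally have "(\<Sum>i<n. \<mu> i) = Re (\<Sum>i<n. complex_of_real (y i) * resolvent Y $$ (i, i))"
    by (metis Re_complex_of_real)
  then have 3: "(\<Sum>i<n. \<mu> i) = (\<Sum>i<n. y i * Re (resolvent Y $$ (i, i)))" by simp
  show ?thesis using 1 2 3 by (simp add: sum_subtractf)
qed

text \<open>\<open>1 + a x\<close> is the convex combination of 1 and \<open>1 + x\<close> with
  weight \<open>a\<close>, and \<open>ln 1 = 0\<close>.\<close>

lemma ln_one_plus_scaled_ge:
  fixes a x :: real
  assumes "0 \<le> a" "a \<le> 1" "0 \<le> x"
  shows "a * ln (1 + x) \<le> ln (1 + a * x)"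
  using concave_onD[OF ln_concave, of a 1 "1 + x"] assms by (simp add: algebra_simps)

text \<open>Integrability is part of the conclusion: the expectation of a non-integrable function is
  0 by convention, and the sum over the eigenvalues of \<open>R\<^sub>R\<close> is later exchanged
  with the expectation.\<close>

lemma (in prob_space) expectation_log_det_gaussian_diag:
  assumes S: "iid_gaussian_mat M m N (1 / real N) S" and N: "0 < N"
    and C: "C \<in> carrier_mat n m" and D: "C * mat_adjoint C = diag_of n d"
    and r: "card {i. i < n \<and> d i \<noteq> 0} \<le> r" and rN: "r \<le> N"
  shows "integrable M (\<lambda>\<omega>. log_det (gram1 (C * S \<omega>)))"
    and "(real N - real r) / real N * (\<Sum>i<n. ln (1 + d i)) \<le> expectation (\<lambda>\<omega>. log_det (gram1 (C * S \<omega>)))"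
proof -
  define v where "v = 1 / real N"
  have v: "0 < v" using N by (simp add: v_def)
  note S' = S[folded v_def]
  note Sc = iid_gaussian_matD(1)[OF S]
  have Yc: "C * S \<omega> \<in> carrier_mat n N" if "\<omega> \<in> space M" for \<omega>
    using C Sc[OF that] by simp
  have Ym: "mat_measurable M n N (\<lambda>\<omega>. C * S \<omega>)"
    by (intro mat_measurable_mult[OF mat_measurable_const[OF C] mat_measurable_iid[OF S]])
  \<comment> \<open>The diagonal entries of \<open>D\<close> are the squared row norms of
    \<open>C\<close>, so \<open>d i = 0\<close> annihilates row \<open>i\<close> of
    \<open>C\<close>.\<close>
  have d0: "0 \<le> d i" and row0: "d i = 0 \<Longrightarrow> j < m \<Longrightarrow> C $$ (i, j) = 0" if i: "i < n" for i j
  proof -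
    have "complex_of_real (d i) = (C * mat_adjoint C) $$ (i, i)" unfolding D using i by simp
    also have "\<dots> = (\<Sum>j<m. complex_of_real ((cmod (C $$ (i, j)))\<^sup>2))"
      using C i by (simp add: scalar_prod_def lessThan_atLeast0 complex_norm_square[symmetric])
    also have "\<dots> = complex_of_real (\<Sum>j<m. (cmod (C $$ (i, j)))\<^sup>2)" by simp
    finally have di: "d i = (\<Sum>j<m. (cmod (C $$ (i, j)))\<^sup>2)" using of_real_eq_iff by blast
    show "0 \<le> d i" unfolding di by (intro sum_nonneg) auto
    show "C $$ (i, j) = 0" if "d i = 0" "j < m"
      using that unfolding di by (subst (asm) sum_nonneg_eq_0_iff) auto
  qed
  \<comment> \<open>\<tau> is \<open>tr(W Q)\<close>, by \<open>W Q = I - Q\<close>, and \<rho> is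
    \<open>tr(Q D)\<close>; written this way both are affine in the bounded entries of the
    resolvent.\<close>
  define \<tau> where "\<tau> \<omega> = (\<Sum>i<n. 1 - Re (resolvent (C * S \<omega>) $$ (i, i)))" for \<omega>
  define \<rho> where "\<rho> \<omega> = (\<Sum>i<n. d i * Re (resolvent (C * S \<omega>) $$ (i, i)))" for \<omega>
  have Qm: "(\<lambda>\<omega>. Re (resolvent (C * S \<omega>) $$ (i, i))) \<in> borel_measurable M" if "i < n" for i
    using mat_measurable_entry[OF mat_measurable_resolvent[OF Ym] that that] by measurable
  have Qi: "integrable M (\<lambda>\<omega>. Re (resolvent (C * S \<omega>) $$ (i, i)))" if i: "i < n" for i
  proof (rule integrable_const_bound[where B = "real n"])
    show "AE \<omega> in M. norm (Re (resolvent (C * S \<omega>) $$ (i, i))) \<le> real n"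
      using order_trans[OF abs_Re_le_cmod resolvent_entry_bound[OF Yc i i]] by (intro AE_I2) simp
  qed (rule Qm[OF i])
  have i\<tau>: "integrable M \<tau>" and i\<rho>: "integrable M \<rho>"
    unfolding \<tau>_def \<rho>_def using Qi by auto
  have \<rho>0: "0 \<le> \<rho> \<omega>" if "\<omega> \<in> space M" for \<omega>
    unfolding \<rho>_def
      using d0 resolvent_diag_nonneg[OF Yc[OF that]] by (intro sum_nonneg mult_nonneg_nonneg) auto
  have \<tau>r: "\<tau> \<omega> \<le> real r" if \<omega>: "\<omega> \<in> space M" for \<omega>
  proof -
    have "\<tau> \<omega> \<le> (\<Sum>i<n. if d i \<noteq> 0 then 1 else 0)" unfolding \<tau>_def
    proof (intro sum_mono)
      fix i assume "i \<in> {..<n}"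
      then have i: "i < n" by simp
      have "resolvent (C * S \<omega>) $$ (i, i) = 1" if "d i = 0"
        using C Sc[OF \<omega>] row0[OF i that] i
        by (intro resolvent_diag_zero_row[OF Yc[OF \<omega>] i]) (auto simp: scalar_prod_def)
      then show "1 - Re (resolvent (C * S \<omega>) $$ (i, i)) \<le> (if d i \<noteq> 0 then 1 else 0)"
        using resolvent_diag_nonneg[OF Yc[OF \<omega>] i] by auto
    qed
    also have "\<dots> = real (card {i. i < n \<and> d i \<noteq> 0})"
      by (simp add: sum.If_cases Int_def lessThan_def conj_commute)
    finally show ?thesis using r by linarith
  qed
  have stein: "(\<Sum>i<m. \<Sum>j<N. stein_fn v C i j (S \<omega>)) = \<tau> \<omega> - v * (\<rho> \<omega> * (real N - \<tau> \<omega>))" if \<omega>: "\<omega> \<in> space M" for \<omega>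
    unfolding sum_stein_fn[OF C Sc[OF \<omega>]] mtrace_compressed_resolvent[OF C Sc[OF \<omega>] D]
      by (simp add: \<tau>_def \<rho>_def)
  have E0: "expectation (\<lambda>\<omega>. \<tau> \<omega> - v * (\<rho> \<omega> * (real N - \<tau> \<omega>))) = 0"
    and I0: "integrable M (\<lambda>\<omega>. \<tau> \<omega> - v * (\<rho> \<omega> * (real N - \<tau> \<omega>)))"
  proof -
    note se = stein_fn_expectation[OF S' v C]
    have "expectation (\<lambda>\<omega>. \<Sum>i<m. \<Sum>j<N. stein_fn v C i j (S \<omega>))
        = (\<Sum>i<m. expectation (\<lambda>\<omega>. \<Sum>j<N. stein_fn v C i j (S \<omega>)))"
      by (intro Bochner_Integration.integral_sum Bochner_Integration.integrable_sum se(1)) auto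
    also have "\<dots> = (\<Sum>i<m. \<Sum>j<N. expectation (\<lambda>\<omega>. stein_fn v C i j (S \<omega>)))"
      by (intro sum.cong refl Bochner_Integration.integral_sum se(1)) auto
    also have "\<dots> = 0" using se(2) by simp
    finally show "expectation (\<lambda>\<omega>. \<tau> \<omega> - v * (\<rho> \<omega> * (real N - \<tau> \<omega>))) = 0"
      by (simp add: stein cong: Bochner_Integration.integral_cong)
    have "integrable M (\<lambda>\<omega>. \<Sum>i<m. \<Sum>j<N. stein_fn v C i j (S \<omega>))"
      using stein_fn_expectation(1)[OF S' v C] by (intro Bochner_Integration.integrable_sum) auto
    then show "integrable M (\<lambda>\<omega>. \<tau> \<omega> - v * (\<rho> \<omega> * (real N - \<tau> \<omega>)))"
      by (simp add: stein cong: Bochner_Integration.integrable_cong)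
  qed
  define a where "a = (real N - real r) / real N"
  have a: "0 \<le> a" "a \<le> 1" using N rN by (auto simp: a_def field_simps)
  have "0 \<le> expectation (\<lambda>\<omega>. \<tau> \<omega> - a * \<rho> \<omega>)"
  proof -
    have "expectation (\<lambda>\<omega>. \<tau> \<omega> - v * (\<rho> \<omega> * (real N - \<tau> \<omega>))) \<le> expectation (\<lambda>\<omega>. \<tau> \<omega> - a * \<rho> \<omega>)"
    proof (intro integral_mono I0)
      show "integrable M (\<lambda>\<omega>. \<tau> \<omega> - a * \<rho> \<omega>)"
        using i\<tau> i\<rho> by auto
      fix \<omega> assume \<omega>: "\<omega> \<in> space M"
      \<comment> \<open>As \<rho> is nonnegative, \<open>N - \<tau>\<close> may be replaced by its
        lower bound \<open>N - r\<close>; with \<open>v = 1 / N\<close> this is where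
        \<open>a\<close> arises.\<close>
      have "a * \<rho> \<omega> = v * (\<rho> \<omega> * (real N - real r))" by (simp add: a_def v_def)
      also have "\<dots> \<le> v * (\<rho> \<omega> * (real N - \<tau> \<omega>))"
        using v \<rho>0[OF \<omega>] \<tau>r[OF \<omega>] by (intro mult_left_mono) auto
      finally show "\<tau> \<omega> - v * (\<rho> \<omega> * (real N - \<tau> \<omega>)) \<le> \<tau> \<omega> - a * \<rho> \<omega>"
        by simp
    qed
    then show ?thesis using E0 by simp
  qed
  then have pos: "0 \<le> expectation \<tau> - a * expectation \<rho>" using i\<tau> i\<rho> by simp
  obtain K where K: "0 \<le> K" "\<And>S. S \<in> carrier_mat m N \<Longrightarrow> sum_sq (C * S) \<le> K * sum_sq S"
    using sum_sq_mult_le[OF C] by metis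
  show int: "integrable M (\<lambda>\<omega>. log_det (gram1 (C * S \<omega>)))"
  proof (rule Bochner_Integration.integrable_bound)
    show "integrable M (\<lambda>\<omega>. K * sum_sq (S \<omega>))"
      using integrable_sum_sq[OF S' v] by simp
    show "(\<lambda>\<omega>. log_det (gram1 (C * S \<omega>))) \<in> borel_measurable M"
      using borel_measurable_det[OF mat_measurable_gram1[OF Ym]] unfolding log_det_def by measurable
    show "AE \<omega> in M. norm (log_det (gram1 (C * S \<omega>))) \<le> norm (K * sum_sq (S \<omega>))"
    proof (intro AE_I2)
      fix \<omega> assume \<omega>: "\<omega> \<in> space M"
      show "norm (log_det (gram1 (C * S \<omega>))) \<le> norm (K * sum_sq (S \<omega>))"
        using log_det_gram1_bounds[OF Yc[OF \<omega>]] K(2)[OF Sc[OF \<omega>]] by simp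
    qed
  qed
  have "a * (\<Sum>i<n. ln (1 + d i)) \<le> (\<Sum>i<n. ln (1 + a * d i))"
    unfolding sum_distrib_left using a d0 by (intro sum_mono ln_one_plus_scaled_ge) auto
  also have "\<dots> \<le> (\<Sum>i<n. ln (1 + a * d i)) + (expectation \<tau> - a * expectation \<rho>)"
    using pos by simp
  also have "\<dots> = expectation (\<lambda>\<omega>. (\<Sum>i<n. ln (1 + a * d i)) + (\<tau> \<omega> - a * \<rho> \<omega>))"
    using i\<tau> i\<rho> by (simp add: prob_space)
  also have "\<dots> \<le> expectation (\<lambda>\<omega>. log_det (gram1 (C * S \<omega>)))"
  proof (intro integral_mono int)
    show "integrable M (\<lambda>\<omega>. (\<Sum>i<n. ln (1 + a * d i)) + (\<tau> \<omega> - a * \<rho> \<omega>))"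
      using i\<tau> i\<rho> by auto
    fix \<omega> assume \<omega>: "\<omega> \<in> space M"
    \<comment> \<open>Since \<open>tr Q = n - \<tau>\<close>, the dimension cancels in the tangent
      inequality and leaves exactly the combination whose mean is nonnegative.\<close>
    have "(\<Sum>i<n. (1 + a * d i) * Re (resolvent (C * S \<omega>) $$ (i, i))) = real n - \<tau> \<omega> + a * \<rho> \<omega>"
      unfolding \<tau>_def \<rho>_def
        by (simp add: sum_subtractf distrib_right sum.distrib sum_distrib_left mult.assoc)
    then show "(\<Sum>i<n. ln (1 + a * d i)) + (\<tau> \<omega> - a * \<rho> \<omega>) \<le> log_det (gram1 (C * S \<omega>))"
      using log_det_gram1_tangent[OF Yc[OF \<omega>], of "\<lambda>i. 1 + a * d i"] a d0
      by (simp add: add_pos_nonneg)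
  qed
  finally show "(real N - real r) / real N * (\<Sum>i<n. ln (1 + d i)) \<le> expectation (\<lambda>\<omega>. log_det (gram1 (C * S \<omega>)))"
    by (simp add: a_def)
qed

section \<open>The lower bound\<close>

text \<open>The unitary \<open>V\<close> is absorbed into the deterministic factor:
  \<open>gram1 (A * X)\<close> and \<open>gram1 (C * X)\<close> are unitarily conjugate for every
  \<open>X\<close>, so the distribution of \<open>S\<close> is never transformed. The bound
  \<open>r\<close> is asked of every diagonalisation because the proof picks one.\<close>

lemma (in prob_space) expectation_log_det_gaussian:
  assumes S: "iid_gaussian_mat M m N (1 / real N) S" and N: "0 < N" and rN: "r \<le> N"
    and A: "A \<in> carrier_mat n m"
    and r: "\<And>V d. unitary_mat n V \<Longrightarrow> A * mat_adjoint A = V * diag_of n d * mat_adjoint V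
      \<Longrightarrow> card {i. i < n \<and> d i \<noteq> 0} \<le> r"
  shows "integrable M (\<lambda>\<omega>. log_det (gram1 (A * S \<omega>)))"
    and "(real N - real r) / real N * log_det (gram1 A) \<le> expectation (\<lambda>\<omega>. log_det (gram1 (A * S \<omega>)))"
proof -
  have AA: "A * mat_adjoint A \<in> carrier_mat n n" using A by auto
  obtain V d where V: "unitary_mat n V" and AV: "A * mat_adjoint A = V * diag_of n d * mat_adjoint V"
    and d: "\<And>i. i < n \<Longrightarrow> 0 \<le> d i"
    using hermitian_psd_spectral[OF AA hermitian_psd_gram[OF A]] by blast
  have Vc: "V \<in> carrier_mat n n" and VV: "mat_adjoint V * V = 1\<^sub>m n" "V * mat_adjoint V = 1\<^sub>m n"
    using V by (auto simp: unitary_mat_def)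
  define C where "C = mat_adjoint V * A"
  have C: "C \<in> carrier_mat n m" using Vc A by (auto simp: C_def)
  have "C * mat_adjoint C = mat_adjoint V * (A * mat_adjoint A) * V"
    using Vc A by (simp add: C_def mat_adjoint_mult mat_assoc)
  also have "\<dots> = (mat_adjoint V * V) * diag_of n d * (mat_adjoint V * V)"
    unfolding AV using Vc by (simp add: mat_assoc)
  finally have CC: "C * mat_adjoint C = diag_of n d" unfolding VV by simp
  have "V * C = (V * mat_adjoint V) * A" using Vc A by (simp add: C_def mat_assoc)
  then have AC: "A = V * C" unfolding VV using A by simp
  have det: "log_det (gram1 (A * X)) = log_det (gram1 (C * X))" if X: "X \<in> carrier_mat m k" for X k
  proof -
    have W: "(C * X) * mat_adjoint (C * X) \<in> carrier_mat n n" using C X by auto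
    have "gram1 (A * X) = 1\<^sub>m n + 1 \<cdot>\<^sub>m (V * ((C * X) * mat_adjoint (C * X)) * mat_adjoint V)"
      unfolding AC gram1_def using Vc C X by (simp add: mat_assoc mat_adjoint_mult one_smult_complex_mat)
    also have "\<dots> = V * gram1 (C * X) * mat_adjoint V"
      unfolding one_plus_smult_conj_unitary[OF V W]
        using C by (simp add: gram1_def one_smult_complex_mat)
    finally show ?thesis
      using det_mult_adjoint_unitary[OF V gram1_carrier[of "C * X" n k]] C X by (simp add: log_det_def)
  qed
  have "gram1 A = 1\<^sub>m n + complex_of_real 1 \<cdot>\<^sub>m (V * diag_of n d * mat_adjoint V)"
    using A by (simp add: gram1_def AV one_smult_complex_mat)
  then have "det (gram1 A) = complex_of_real (\<Prod>i<n. 1 + 1 * d i)"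
    using det_one_plus_spectral[OF V, of 1 d] by (simp only:)
  then have lA: "log_det (gram1 A) = (\<Sum>i<n. ln (1 + d i))"
    unfolding log_det_def Re_complex_of_real using d
    by (simp only: Re_complex_of_real mult_1) (intro ln_prod, auto simp: add_pos_nonneg add_nonneg_eq_0_iff)
  note main = expectation_log_det_gaussian_diag[OF S N C CC r[OF V AV] rN]
  note Sc = iid_gaussian_matD(1)[OF S]
  show "integrable M (\<lambda>\<omega>. log_det (gram1 (A * S \<omega>)))"
    using main(1) by (simp add: det[OF Sc] cong: Bochner_Integration.integrable_cong)
  show "(real N - real r) / real N * log_det (gram1 A) \<le> expectation (\<lambda>\<omega>. log_det (gram1 (A * S \<omega>)))"
    using main(2) by (simp add: lA det[OF Sc] cong: Bochner_Integration.integral_cong)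
qed

text \<open>One formula for both sides: \<open>Z\<close> is the root of \<open>R\<^sub>T\<close>
  times \<open>F S\<close> for the random term and times \<open>F\<close> for the deterministic one.
  Moving the square root of \<open>l k / s2\<close> into \<open>Z\<close> gives each summand the
  form to which the Gaussian bound applies.\<close>

lemma mi_log_det_eq_sum:
  assumes RR: "R\<^sub>R \<in> carrier_mat a a" and V: "unitary_mat a V" and R: "R\<^sub>R = V * diag_of a l * mat_adjoint V"
    and l: "\<And>k. k < a \<Longrightarrow> 0 \<le> l k" and s2: "0 < s2"
    and RT: "R\<^sub>T \<in> carrier_mat n n"
    and Z: "Z \<in> carrier_mat n m" and X: "psd_sqrt R\<^sub>T * X * psd_sqrt R\<^sub>T = Z * mat_adjoint Z"
  shows "mi_log_det s2 R\<^sub>R R\<^sub>T X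
    = (\<Sum>k<a. log_det (gram1 (complex_of_real (sqrt (inverse s2 * l k)) \<cdot>\<^sub>m Z)))"
proof -
  have ZZ: "Z * mat_adjoint Z \<in> carrier_mat n n" using Z by auto
  obtain U g where U: "unitary_mat n U" and G: "Z * mat_adjoint Z = U * diag_of n g * mat_adjoint U"
    and g: "\<And>p. p < n \<Longrightarrow> 0 \<le> g p"
    using hermitian_psd_spectral[OF ZZ hermitian_psd_gram[OF Z]] by blast
  have gram: "1\<^sub>m n + complex_of_real (inverse s2 * l k) \<cdot>\<^sub>m (Z * mat_adjoint Z)
      = gram1 (complex_of_real (sqrt (inverse s2 * l k)) \<cdot>\<^sub>m Z)" if "k < a" for k
  proof -
    define q where "q = sqrt (inverse s2 * l k)"
    have q: "q * q = inverse s2 * l k" using l[OF that] s2 by (simp add: q_def)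
    have "(complex_of_real q \<cdot>\<^sub>m Z) * mat_adjoint (complex_of_real q \<cdot>\<^sub>m Z)
        = complex_of_real (inverse s2 * l k) \<cdot>\<^sub>m (Z * mat_adjoint Z)"
      unfolding q[symmetric]
        using Z by (intro eq_matI) (auto simp: scalar_prod_def sum_distrib_left mult_ac)
    then show ?thesis by (simp only: gram1_def q_def[symmetric] index_smult_mat carrier_matD[OF Z])
  qed
  have "mi_log_det s2 R\<^sub>R R\<^sub>T X
      = log_det (1\<^sub>m (a * n) + complex_of_real (inverse s2) \<cdot>\<^sub>m kronecker_product R\<^sub>R (Z * mat_adjoint Z))"
    unfolding mi_log_det_def X using RR RT by simp
  also have "\<dots> = (\<Sum>k<a. log_det (1\<^sub>m n + complex_of_real (inverse s2 * l k) \<cdot>\<^sub>m (Z * mat_adjoint Z)))"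
    using s2 by (intro log_det_kronecker[OF V U _ l g R G]) auto
  also have "\<dots> = (\<Sum>k<a. log_det (gram1 (complex_of_real (sqrt (inverse s2 * l k)) \<cdot>\<^sub>m Z)))"
    by (intro sum.cong refl) (simp add: gram del: of_real_mult)
  finally show ?thesis .
qed

lemma mat_rank_le_dim: "A \<in> carrier_mat n m \<Longrightarrow> mat_rank A \<le> m"
  unfolding mat_rank_def using vec_space.rank_le_nc by auto

theorem proposition2:
  fixes M :: "'w measure" and N\<^sub>T N\<^sub>S N\<^sub>R K :: nat and s2 :: real
    and F R\<^sub>R R\<^sub>T \<Phi> :: "complex mat" and S :: "'w \<Rightarrow> complex mat"
  assumes "prob_space M"
    and "N\<^sub>T > 0" and "N\<^sub>R > 0" and "K > 0" and "s2 > 0"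
    and "F \<in> carrier_mat N\<^sub>T N\<^sub>T"
    and "iid_gaussian_mat M N\<^sub>T N\<^sub>S (1 / real N\<^sub>S) S"
    and "R\<^sub>R \<in> carrier_mat N\<^sub>R N\<^sub>R" and "hermitian_psd R\<^sub>R" and "mat_rank R\<^sub>R \<le> K"
    and "R\<^sub>T \<in> carrier_mat N\<^sub>T N\<^sub>T" and "hermitian_psd R\<^sub>T" and "mat_rank R\<^sub>T \<le> K"
    and "\<Phi> = F * mat_adjoint F"
    and "N\<^sub>S \<ge> N\<^sub>T"
  shows "sensing_mi M s2 R\<^sub>R R\<^sub>T F S \<ge>
    (real N\<^sub>S - real (min K (mat_rank \<Phi>))) / real N\<^sub>S * sensing_mi_max s2 R\<^sub>R R\<^sub>T F"
proof -
  interpret prob_space M by fact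
  note F = assms(6) and S = assms(7) and RT = assms(11)
  have NS: "0 < N\<^sub>S" using assms by simp
  note Sc = iid_gaussian_matD(1)[OF S]
  obtain V l where V: "unitary_mat N\<^sub>R V" and R: "R\<^sub>R = V * diag_of N\<^sub>R l * mat_adjoint V"
    and l: "\<And>k. k < N\<^sub>R \<Longrightarrow> 0 \<le> l k"
    using hermitian_psd_spectral[OF assms(8,9)] by blast
  define B where "B = psd_sqrt R\<^sub>T"
  have B: "B \<in> carrier_mat N\<^sub>T N\<^sub>T" and hB: "mat_adjoint B = B"
    using psd_sqrt_factor[OF RT assms(12)] by (auto simp: B_def)
  obtain T where T: "T \<in> carrier_mat N\<^sub>T N\<^sub>T" and BT: "B = R\<^sub>T * T" using psd_sqrt_factor[OF RT assms(12)] by (auto simp: B_def)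
  have \<Phi>: "\<Phi> \<in> carrier_mat N\<^sub>T N\<^sub>T" using F assms(14) by auto
  define q where "q k = complex_of_real (sqrt (inverse s2 * l k))" for k
  define A where "A k = q k \<cdot>\<^sub>m (B * F)" for k
  have A: "A k \<in> carrier_mat N\<^sub>T N\<^sub>T" for k using B F by (simp add: A_def)
  define r where "r = min K (mat_rank \<Phi>)"
  \<comment> \<open>The rank of \<Phi> is at most \<open>N\<^sub>T\<close>, hence at most
    \<open>N\<^sub>S\<close>, so the coefficient is nonnegative.\<close>
  have rN: "r \<le> N\<^sub>S" using mat_rank_le_dim[OF \<Phi>] assms by (simp add: r_def)
  have AA: "A k * mat_adjoint (A k) = (q k * cnj (q k)) \<cdot>\<^sub>m (B * \<Phi> * B)" for k
  proof -
    have "A k * mat_adjoint (A k) = (q k * cnj (q k)) \<cdot>\<^sub>m ((B * F) * mat_adjoint (B * F))"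
      unfolding A_def using B F by (intro eq_matI) (auto simp: scalar_prod_def sum_distrib_left mult_ac)
    also have "(B * F) * mat_adjoint (B * F) = B * \<Phi> * B"
      using B F hB assms(14) by (simp add: mat_adjoint_mult mat_assoc)
    finally show ?thesis .
  qed
  have rank: "card {i. i < N\<^sub>T \<and> d i \<noteq> 0} \<le> r"
    if W: "unitary_mat N\<^sub>T W" and eq: "A k * mat_adjoint (A k) = W * diag_of N\<^sub>T d * mat_adjoint W" for W d k
  proof -
    let ?c = "q k * cnj (q k)"
    \<comment> \<open>The scalar goes into the left factor, which leaves a product with \<Phi> in
      the middle.\<close>
    have "(?c \<cdot>\<^sub>m B) * \<Phi> * B = W * diag_of N\<^sub>T d * mat_adjoint W"
      unfolding eq[symmetric] AA using B \<Phi>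
      by (simp add: mult_smult_assoc_mat[of _ "N\<^sub>T" "N\<^sub>T" _ "N\<^sub>T"] mult_carrier_mat[of _ "N\<^sub>T" "N\<^sub>T"])
    then have 1: "card {i. i < N\<^sub>T \<and> d i \<noteq> 0} \<le> mat_rank \<Phi>"
      using B \<Phi> by (intro card_spectral_le_rank[OF W _ \<Phi> _]) auto
    have TPB: "T * \<Phi> * B \<in> carrier_mat N\<^sub>T N\<^sub>T" using T \<Phi> B by auto
    \<comment> \<open>Writing the left root as \<open>R\<^sub>T * T\<close> exposes
      \<open>R\<^sub>T\<close> as a factor and so brings in \<open>K\<close>.\<close>
    have "B * \<Phi> * B = R\<^sub>T * (T * \<Phi> * B)" using BT RT T \<Phi> B by (simp add: mat_assoc)
    then have "(?c \<cdot>\<^sub>m 1\<^sub>m N\<^sub>T) * R\<^sub>T * (T * \<Phi> * B) = W * diag_of N\<^sub>T d * mat_adjoint W"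
      unfolding eq[symmetric] AA using RT TPB
      by (simp add: mult_smult_assoc_mat[of _ "N\<^sub>T" "N\<^sub>T" _ "N\<^sub>T"])
    then have "card {i. i < N\<^sub>T \<and> d i \<noteq> 0} \<le> mat_rank R\<^sub>T"
      using RT TPB by (intro card_spectral_le_rank[OF W _ RT TPB]) auto
    with 1 assms(13) show ?thesis by (simp add: r_def)
  qed
  note main = expectation_log_det_gaussian[OF S NS rN A rank]
  have sum_S: "mi_log_det s2 R\<^sub>R R\<^sub>T (F * S \<omega> * mat_adjoint (S \<omega>) * mat_adjoint F)
      = (\<Sum>k<N\<^sub>R. log_det (gram1 (A k * S \<omega>)))" if \<omega>: "\<omega> \<in> space M" for \<omega>
  proof -
    note Sw = Sc[OF \<omega>]
    have Z: "B * F * S \<omega> \<in> carrier_mat N\<^sub>T N\<^sub>S" using B F Sw by auto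
    have "psd_sqrt R\<^sub>T * (F * S \<omega> * mat_adjoint (S \<omega>) * mat_adjoint F) * psd_sqrt R\<^sub>T
        = (B * F * S \<omega>) * mat_adjoint (B * F * S \<omega>)"
      unfolding B_def[symmetric] using B F Sw hB by (simp add: mat_adjoint_mult mat_assoc)
    from mi_log_det_eq_sum[OF assms(8) V R l assms(5) RT Z this]
    show ?thesis
      unfolding A_def q_def using B F Sw by (simp add: mult_smult_assoc_mat[of _ "N\<^sub>T" "N\<^sub>T" _ "N\<^sub>S"])
  qed
  have "psd_sqrt R\<^sub>T * (F * mat_adjoint F) * psd_sqrt R\<^sub>T = (B * F) * mat_adjoint (B * F)"
    unfolding B_def[symmetric] using B F hB by (simp add: mat_adjoint_mult mat_assoc)
  from mi_log_det_eq_sum[OF assms(8) V R l assms(5) RT mult_carrier_mat[OF B F] this]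
  have sum_max: "sensing_mi_max s2 R\<^sub>R R\<^sub>T F = (\<Sum>k<N\<^sub>R. log_det (gram1 (A k)))"
    by (simp add: sensing_mi_max_def A_def q_def)
  \<comment> \<open>The coefficient is the same for every eigenvalue of \<open>R\<^sub>R\<close>, so
    the termwise bounds add up.\<close>
  have "(real N\<^sub>S - real r) / real N\<^sub>S * sensing_mi_max s2 R\<^sub>R R\<^sub>T F
      \<le> (\<Sum>k<N\<^sub>R. expectation (\<lambda>\<omega>. log_det (gram1 (A k * S \<omega>))))"
    unfolding sum_max sum_distrib_left by (intro sum_mono main(2))
  also have "\<dots> = expectation (\<lambda>\<omega>. \<Sum>k<N\<^sub>R. log_det (gram1 (A k * S \<omega>)))"
    by (rule Bochner_Integration.integral_sum[symmetric]) (rule main(1))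
  also have "\<dots> = sensing_mi M s2 R\<^sub>R R\<^sub>T F S"
    unfolding sensing_mi_def by (intro Bochner_Integration.integral_cong refl sum_S[symmetric])
  finally show ?thesis by (simp add: r_def)
qed

end
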